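(* Let $d\ge 1$, $H\in(0,1)$, let $k=(k_1,\dots,k_d)\in\mathbb{N}^d$ (with $0\in\mathbb{N}$) and $|k|=k_1+\cdots+k_d$. Let $\hat\alpha^{(k)}$ be the $k$-th derivative of the self-intersection local time on $\{0<r<s<1\}$ of a $d$-dimensional fractional Brownian motion $B^H$ with Hurst parameter $H$. If $$H|k|+Hd<1\quad\text{and}\quad 0\le\beta<\frac{1}{|k|+|k|H+dH},$$ then there exists a constant $M>0$ such that $$\mathbb{E}\left[e^{M|\hat\alpha^{(k)}|^{\beta}}\right]<\infty .$$
   Context: A $d$-dimensional fractional Brownian motion $B^H=(B^{H,1},\dots,B^{H,d})$ with Hurst parameter $H\in(0,1)$ is an a.s. continuous centered Gaussian process whose components are independent copies of a one-dimensional fractional Brownian motion with covariance $\mathbb{E}[B^{H,j}_tB^{H,j}_s]=\tfrac12(t^{2H}+s^{2H}-|t-s|^{2H})$. For $\epsilon>0$ and $x\in\mathbb{R}^d$, $\delta_\epsilon(x)=(2\pi\epsilon)^{-d/2}e^{-|x|^2/(2\epsilon)}$, and $\delta_\epsilon^{(k)}=\partial_{x_1}^{k_1}\cdots\partial_{x_d}^{k_d}\delta_\epsilon$. The random variable $\hat\alpha^{(k)}$ (formally $\int_0^1\int_0^s\delta^{(k)}(B^H_s-B^H_r)\,dr\,ds$) is the limit as $\epsilon\to0$ of $\int_0^1\int_0^s\delta_\epsilon^{(k)}(B^H_s-B^H_r)\,dr\,ds$, which is known to exist in $L^p(\Omega)$ for all $p\ge 1$ when $H|k|+Hd<1$. 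*)

theory Defs
  imports "HOL-Probability.Probability"
begin

text \<open>Constants count as Gaussian (variance zero); they are a separate disjunct because
  \<^term>\<open>normal_density m 0\<close> is identically zero.\<close>

definition gaussian_rv :: "'w measure \<Rightarrow> ('w \<Rightarrow> real) \<Rightarrow> bool" where
  "gaussian_rv P X \<longleftrightarrow>
     X \<in> borel_measurable P \<and>
     (\<exists>m. (AE \<omega> in P. X \<omega> = m) \<or> (\<exists>\<sigma>>0. distributed P lborel X (normal_density m \<sigma>)))"

definition centered_gaussian_process ::
    "'w measure \<Rightarrow> 'i set \<Rightarrow> ('i \<Rightarrow> 'w \<Rightarrow> real) \<Rightarrow> bool" where
  "centered_gaussian_process P T X \<longleftrightarrow>
     (\<forall>I c. finite I \<and> I \<subseteq> T \<longrightarrow> gaussian_rv P (\<lambda>\<omega>. \<Sum>i\<in>I. c i * X i \<omega>)) \<and>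
     (\<forall>i\<in>T. (\<integral>\<omega>. X i \<omega> \<partial>P) = 0)"

text \<open>The process is indexed by times in \<^term>\<open>{0::real..}\<close>; values of \<open>B\<close> at negative times
  are irrelevant. Independence is that of the components as random elements of the space of
  functions on \<^term>\<open>{0::real..}\<close> with the product sigma-algebra.\<close>

definition fractional_brownian_motion ::
    "'w measure \<Rightarrow> real \<Rightarrow> (real \<Rightarrow> 'w \<Rightarrow> real ^ 'd::finite) \<Rightarrow> bool" where
  "fractional_brownian_motion P H B \<longleftrightarrow>
     centered_gaussian_process P (UNIV \<times> {0..}) (\<lambda>(j, t) \<omega>. B t \<omega> $ j) \<and>
     (AE \<omega> in P. continuous_on {0..} (\<lambda>t. B t \<omega>)) \<and>
     prob_space.indep_vars P (\<lambda>j. \<Pi>\<^sub>M t\<in>{0..}. borel) (\<lambda>j \<omega>. \<lambda>t\<in>{0..}. B t \<omega> $ j) UNIV \<and>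
     (\<forall>j. \<forall>t\<ge>0. \<forall>s\<ge>0.
        (\<integral>\<omega>. B t \<omega> $ j * B s \<omega> $ j \<partial>P) =
          1/2 * (t powr (2 * H) + s powr (2 * H) - \<bar>t - s\<bar> powr (2 * H)))"

definition heat_kernel :: "real \<Rightarrow> real ^ 'd::finite \<Rightarrow> real" where
  "heat_kernel \<epsilon> x =
     (2 * pi * \<epsilon>) powr (- real CARD('d) / 2) * exp (- (norm x)\<^sup>2 / (2 * \<epsilon>))"

definition partial_deriv :: "'d::finite \<Rightarrow> (real ^ 'd::finite \<Rightarrow> real) \<Rightarrow> real ^ 'd::finite \<Rightarrow> real" where
  "partial_deriv j f x = deriv (\<lambda>t. f (x + t *\<^sub>R axis j 1)) 0"

text \<open>The linear order on the index type only serves to fix the order of differentiation: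
  the outermost derivative is the one in the smallest coordinate.\<close>

definition multi_deriv ::
    "nat ^ 'd::{finite,linorder} \<Rightarrow> (real ^ 'd::{finite,linorder} \<Rightarrow> real) \<Rightarrow> real ^ 'd::{finite,linorder} \<Rightarrow> real" where
  "multi_deriv k f = foldr (\<lambda>j. partial_deriv j ^^ (k $ j)) (sorted_list_of_set UNIV) f"

definition multi_order :: "nat ^ 'd::finite \<Rightarrow> nat" where
  "multi_order k = (\<Sum>j\<in>UNIV. k $ j)"

definition silt_approx ::
    "(real \<Rightarrow> 'w \<Rightarrow> real ^ 'd::{finite,linorder}) \<Rightarrow> nat ^ 'd::{finite,linorder} \<Rightarrow> real \<Rightarrow> 'w \<Rightarrow> real" where
  "silt_approx B k \<epsilon> \<omega> =
     (LINT s:{0..1}|lborel. LINT r:{0..s}|lborel.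
        multi_deriv k (heat_kernel \<epsilon>) (B s \<omega> - B r \<omega>))"

definition converges_in_Lp ::
    "'w measure \<Rightarrow> real \<Rightarrow> ('i \<Rightarrow> 'w \<Rightarrow> real) \<Rightarrow> ('w \<Rightarrow> real) \<Rightarrow> 'i filter \<Rightarrow> bool" where
  "converges_in_Lp P p X Y F \<longleftrightarrow>
     (\<forall>\<^sub>F i in F. X i \<in> borel_measurable P \<and> integrable P (\<lambda>\<omega>. \<bar>X i \<omega>\<bar> powr p)) \<and>
     Y \<in> borel_measurable P \<and> integrable P (\<lambda>\<omega>. \<bar>Y \<omega>\<bar> powr p) \<and>
     ((\<lambda>i. \<integral>\<omega>. \<bar>X i \<omega> - Y \<omega>\<bar> powr p \<partial>P) \<longlongrightarrow> 0) F"

text \<open>\<open>\<alpha>\<close> is (a version of) the \<open>k\<close>-th derivative of the self-intersection local time of \<open>B\<close>.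
  The convergence is taken over the completion of \<open>P\<close>: paths are only almost surely continuous,
  so the pathwise integrals agree with a \<open>P\<close>-measurable function only outside a null set.
  For \<open>P\<close>-measurable functions the two spaces have the same integrals.\<close>

definition is_silt_deriv ::
    "'w measure \<Rightarrow> (real \<Rightarrow> 'w \<Rightarrow> real ^ 'd::{finite,linorder}) \<Rightarrow> nat ^ 'd::{finite,linorder} \<Rightarrow> ('w \<Rightarrow> real) \<Rightarrow> bool"
  where
  "is_silt_deriv P B k \<alpha> \<longleftrightarrow>
     \<alpha> \<in> borel_measurable P \<and>
     (\<forall>p\<ge>1. converges_in_Lp (completion P) p (silt_approx B k) \<alpha> (at_right 0))"

end

theory Submission
  imports Defs "HOL-Real_Asymp.Real_Asymp"
begin

text \<open>
  Write \<open>\<alpha>\<close> as the limit of \<open>\<alpha>\<^sub>\<epsilon>\<close>, and \<open>\<alpha>\<^sub>\<epsilon>\<^sup>n\<close> for even \<open>n\<close> as an integral over \<open>2n\<close> times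
  \<open>u\<^sub>i\<close>, two for each increment of the path. The derivatives of the heat kernel are Fourier integrals,
  so the expectation of the integrand is at most \<open>\<integral> (\<Prod> \<bar>p\<bar>\<^sup>k) exp (- V p / 2) dp\<close>, where \<open>V p\<close> is the
  variance of a linear combination of increments. By strong local nondeterminism (obtained from the
  spectral representation of the covariance) \<open>V p\<close> dominates \<open>c p\<^sub>j\<^sup>2 r powr (2H)\<close> for each single
  coordinate \<open>p\<^sub>j\<close>, \<open>r\<close> being the distance of either endpoint of the \<open>j\<close>-th increment to the nearest
  other time. Taking the geometric mean over the two endpoints, the integrand is at most
  \<open>C\<^sup>n n powr (n \<bar>k\<bar> / 2) \<Prod> r\<^sub>i powr (-g)\<close> with \<open>g = H (\<bar>k\<bar> + d) / 2 < 1/2\<close>. A gap between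
  neighbouring times is charged at most twice, and \<open>2g < 1\<close>, so this is integrable, with integral over
  the cube of order \<open>C\<^sup>n n powr (2 g n)\<close>. Hence the \<open>n\<close>-th moment of \<open>\<alpha>\<close> is at most
  \<open>C\<^sup>n n powr (\<theta> n)\<close> with \<open>\<theta> = \<bar>k\<bar>/2 + H (\<bar>k\<bar> + d)\<close>, and the exponential series converges as soon
  as \<open>\<theta> \<beta> < 1\<close>.
\<close>

section \<open>Strong local nondeterminism\<close>

text \<open>The even split over the two endpoints of an increment is what makes the spacings
  integrable. One increment costs total exponent 2g. Charged to a single endpoint, two increments
  could meet in the same gap and give it exponent 4g, which may exceed 1. After the split every time
  carries only g, and a gap can be the nearest distance of no more than its two ends, so it carries
  at most 2g. No determinant of a covariance matrix is computed: the lower bounds for single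
  coordinates survive the successive Gaussian integrations, and they alone bound the result. The
  Gaussian factor with \<epsilon> in the Fourier integrand is needed for Fubini, but is bounded by 1
  afterwards, so every moment estimate is uniform in \<epsilon>. For the spacings, the cutoff of the
  cube at 1 is traded for exponential decay in the last point. Integrating that point out then
  reproduces an integrand of the same form, because the exponential is memoryless.\<close>

lemma integrable_powr_near_0:
  assumes "a > -1"
  shows "integrable lborel (\<lambda>x::real. indicator {0<..1} x * x powr a)"
proof -
  have i: "((\<lambda>x. x powr a) has_integral integral {0<..1} (\<lambda>x. x powr a)) {0<..1}"
    using integrable_on_powr_from_0'[OF assms, of 1] by (simp add: integrable_integral)
  have "(\<integral>\<^sup>+x. ennreal (indicator {0<..1} x * x powr a) \<partial>lborel) < \<infinity>"
    using nn_integral_has_integral_lebesgue[OF _ i] by simp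
  then show ?thesis
    by (intro integrableI_nonneg) (auto simp: indicator_def)
qed

lemma integrable_powr_near_infinity:
  assumes "a < -1"
  shows "integrable lborel (\<lambda>x::real. indicator {1..} x * x powr a)"
proof -
  have i: "((\<lambda>x. x powr a) has_integral -(1 powr (a+1) / (a+1))) {1..}"
    using has_integral_powr_to_inf[of a 1] assms by simp
  have "(\<integral>\<^sup>+x. ennreal (indicator {1..} x * x powr a) \<partial>lborel) < \<infinity>"
    using nn_integral_has_integral_lebesgue[OF _ i] by simp
  then show ?thesis
    by (intro integrableI_nonneg) (auto simp: indicator_def)
qed

lemma integrable_powr_bounds:
  fixes f :: "real \<Rightarrow> real"
  assumes [measurable]: "f \<in> borel_measurable borel"
    and "a > -1" "b < -1"
    and small: "\<And>x. 0 < x \<Longrightarrow> x \<le> 1 \<Longrightarrow> \<bar>f x\<bar> \<le> C * x powr a"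
    and large: "\<And>x. 1 \<le> x \<Longrightarrow> \<bar>f x\<bar> \<le> C * x powr b"
  shows "integrable lborel (\<lambda>x. indicator {0<..} x * f x)"
proof (rule Bochner_Integration.integrable_bound[OF _ _ AE_I2])
  show "integrable lborel (\<lambda>x::real. C * (indicator {0<..1} x * x powr a) + C * (indicator {1..} x * x powr b))"
    using assms by (intro Bochner_Integration.integrable_add integrable_mult_right
        integrable_powr_near_0 integrable_powr_near_infinity)
  have C: "C \<ge> 0" using small[of 1] by simp
  show "norm (indicator {0<..} x * f x) \<le> norm (C * (indicator {0<..1} x * x powr a) + C * (indicator {1..} x * x powr b))" for x
  proof -
    consider "x \<le> 0" | "0 < x" "x < 1" | "x = 1" | "1 < x" by linarith
    then show ?thesis
    proof cases
      case 2 then show ?thesis using small[of x] C by (auto simp: indicator_def)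
    next
      case 3 then show ?thesis using small[of x] C by (auto simp: indicator_def)
    next
      case 4 then show ?thesis using large[of x] C by (auto simp: indicator_def)
    qed auto
  qed
qed auto

section \<open>Spectral integral of the power \<open>2 * H\<close> of a distance\<close>

lemma one_minus_cos_le: "1 - cos (x::real) \<le> x\<^sup>2"
proof -
  have "1 - cos x = 2 * (sin (x/2))\<^sup>2"
    using cos_double_sin[of "x/2"] by simp
  also have "\<dots> \<le> 2 * (x/2)\<^sup>2"
  proof -
    have "\<bar>sin (x/2)\<bar> \<le> \<bar>x/2\<bar>" by (rule abs_sin_x_le_abs_x)
    then have "(sin (x/2))\<^sup>2 \<le> (x/2)\<^sup>2" by (rule abs_le_square_iff[THEN iffD1])
    then show ?thesis by simp
  qed
  also have "\<dots> \<le> x\<^sup>2" by (simp add: power2_eq_square)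
  finally show ?thesis .
qed

text \<open>The spectral integral at distance 1. Its value is never computed; only finiteness and
  positivity matter. The case H = 1/2 also normalises the tent function.\<close>

definition fbm_const :: "real \<Rightarrow> real" where
  "fbm_const H = (\<integral>x. indicator {0<..} x * ((1 - cos x) * x powr (-1 - 2*H)) \<partial>lborel)"

lemma integrable_one_minus_cos:
  assumes "0 < H" "H < 1"
  shows "integrable lborel (\<lambda>x::real. indicator {0<..} x * ((1 - cos x) * x powr (-1 - 2*H)))"
proof (rule integrable_powr_bounds[where a = "1 - 2*H" and b = "-1 - 2*H" and C = 2])
  fix x :: real assume x: "0 < x" "x \<le> 1"
  have "(1 - cos x) * x powr (-1 - 2*H) \<le> x\<^sup>2 * x powr (-1 - 2*H)"
    by (intro mult_right_mono one_minus_cos_le) auto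
  also have "\<dots> = x powr (1 - 2*H)"
    using x by (simp flip: powr_numeral powr_add)
  also have "\<dots> \<le> 2 * x powr (1 - 2*H)" by simp
  finally show "\<bar>(1 - cos x) * x powr (-1 - 2*H)\<bar> \<le> 2 * x powr (1 - 2*H)"
    by (simp add: abs_mult)
next
  fix x :: real assume x: "1 \<le> x"
  have "(1 - cos x) * x powr (-1 - 2*H) \<le> 2 * x powr (-1 - 2*H)"
    using cos_ge_minus_one[of x] by (intro mult_right_mono) (auto simp del: cos_ge_minus_one)
  then show "\<bar>(1 - cos x) * x powr (-1 - 2*H)\<bar> \<le> 2 * x powr (-1 - 2*H)"
    by (simp add: abs_mult)
qed (use assms in auto)

lemma fbm_const_pos:
  assumes "0 < H" "H < 1"
  shows "fbm_const H > 0"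
proof -
  have "0 < (pi - pi/2) * pi powr (-1 - 2*H)" by simp
  also have "\<dots> = (\<integral>x. indicator {pi/2..pi} x * pi powr (-1 - 2*H) \<partial>lborel)" by simp
  also have "\<dots> \<le> fbm_const H"
    unfolding fbm_const_def
  proof (rule integral_mono)
    show "integrable lborel (\<lambda>x::real. indicator {0<..} x * ((1 - cos x) * x powr (-1 - 2*H)))"
      by (rule integrable_one_minus_cos[OF assms])
    fix x :: real
    show "indicator {pi/2..pi} x * pi powr (-1 - 2*H) \<le> indicator {0<..} x * ((1 - cos x) * x powr (-1 - 2*H))"
    proof (cases "x \<in> {pi/2..pi}")
      case True
      then have x: "0 < x" "pi/2 \<le> x" "x \<le> pi" using pi_gt_zero by (auto intro: less_le_trans[of 0 "pi/2"])
      have "cos x \<le> cos (pi/2)" using x by (intro cos_monotone_0_pi_le) auto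
      moreover have "pi powr (-1 - 2*H) \<le> x powr (-1 - 2*H)" using x assms by (intro powr_mono2') auto
      ultimately have "1 * pi powr (-1 - 2*H) \<le> (1 - cos x) * x powr (-1 - 2*H)"
        by (intro mult_mono) auto
      then show ?thesis using x by simp
    qed (auto simp: indicator_def)
  qed simp
  finally show ?thesis .
qed

text \<open>The integrand is homogeneous, so the substitution scaling \<xi> by the absolute value of
  x reduces everything to distance 1. The point of the representation is that a quadratic form in
  these powers becomes the integral of a square against a positive density.\<close>

lemma spectral_integral:
  assumes "0 < H" "H < 1"
  shows "has_bochner_integral lborel
    (\<lambda>\<xi>::real. indicator {0<..} \<xi> * ((1 - cos (x * \<xi>)) * \<xi> powr (-1 - 2*H))) (fbm_const H * \<bar>x\<bar> powr (2*H))"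
proof (cases "x = 0")
  case False
  define y where "y = \<bar>x\<bar>"
  have y: "y > 0" using False by (simp add: y_def)
  have "has_bochner_integral lborel (\<lambda>\<xi>::real. indicator {0<..} \<xi> * ((1 - cos \<xi>) * \<xi> powr (-1 - 2*H))) (fbm_const H)"
    unfolding fbm_const_def by (intro has_bochner_integral_integrable integrable_one_minus_cos assms)
  then have "has_bochner_integral lborel (\<lambda>\<xi>::real. indicator {0<..} (0 + y * \<xi>) * ((1 - cos (0 + y * \<xi>)) * (0 + y * \<xi>) powr (-1 - 2*H))) (fbm_const H /\<^sub>R \<bar>y\<bar>)"
    by (subst lborel_has_bochner_integral_real_affine_iff[symmetric]) (use y in auto)
  then have "has_bochner_integral lborel (\<lambda>\<xi>::real. y powr (1 + 2*H) * (indicator {0<..} (0 + y * \<xi>) * ((1 - cos (0 + y * \<xi>)) * (0 + y * \<xi>) powr (-1 - 2*H)))) (y powr (1 + 2*H) * (fbm_const H /\<^sub>R \<bar>y\<bar>))"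
    by (rule has_bochner_integral_mult_right)
  moreover have "y powr (1 + 2*H) * (fbm_const H /\<^sub>R \<bar>y\<bar>) = fbm_const H * y powr (2*H)"
    using y by (simp add: powr_add field_simps)
  moreover have "y powr (1 + 2*H) * (indicator {0<..} (0 + y * \<xi>) * ((1 - cos (0 + y * \<xi>)) * (0 + y * \<xi>) powr (-1 - 2*H)))
      = indicator {0<..} \<xi> * ((1 - cos (x * \<xi>)) * \<xi> powr (-1 - 2*H))" for \<xi> :: real
  proof (cases "\<xi> > 0")
    case True
    have "cos (y * \<xi>) = cos (x * \<xi>)"
      unfolding y_def by (cases "x > 0") (auto simp: abs_if)
    moreover have "(y * \<xi>) powr (-1 - 2*H) = y powr (-1 - 2*H) * \<xi> powr (-1 - 2*H)"
      using True y by (simp add: powr_mult)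
    moreover have "y powr (1 + 2*H) * y powr (-1 - 2*H) = 1"
      using y by (simp flip: powr_add)
    ultimately show ?thesis using True y by (simp add: zero_less_mult_iff)
  qed (use y in \<open>auto simp: indicator_def zero_less_mult_iff\<close>)
  ultimately show ?thesis by (simp only: y_def)
qed auto

text \<open>The squared norm of the transform of the tent of width 1 with respect to the reciprocal
  spectral density: the power \<open>2*H - 3\<close> is -4 from the squared kernel plus
  \<open>1 + 2*H\<close> from the density.\<close>

definition fejer_const :: "real \<Rightarrow> real" where
  "fejer_const H = (\<integral>x. indicator {0<..} x * ((1 - cos x)\<^sup>2 * x powr (2*H - 3)) \<partial>lborel)"

lemma fejer_const_integral:
  assumes "0 < H" "H < 1" "r > 0"
  shows "has_bochner_integral lborel
    (\<lambda>\<xi>::real. indicator {0<..} \<xi> * ((1 - cos (r * \<xi>))\<^sup>2 * \<xi> powr (2*H - 3))) (fejer_const H * r powr (2 - 2*H))"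
proof -
  have int: "integrable lborel (\<lambda>x::real. indicator {0<..} x * ((1 - cos x)\<^sup>2 * x powr (2*H - 3)))"
  proof (rule integrable_powr_bounds[where a = "1 + 2*H" and b = "2*H - 3" and C = 4])
    fix x :: real assume x: "0 < x" "x \<le> 1"
    have "(1 - cos x)\<^sup>2 * x powr (2*H - 3) \<le> (x\<^sup>2)\<^sup>2 * x powr (2*H - 3)"
      by (intro mult_right_mono power_mono one_minus_cos_le) auto
    also have "\<dots> = x powr 4 * x powr (2*H - 3)"
      using x by (simp add: powr_numeral flip: power_mult)
    also have "\<dots> = x powr (1 + 2*H)"
      by (subst powr_add[symmetric]) simp
    also have "\<dots> \<le> 4 * x powr (1 + 2*H)" by simp
    finally show "\<bar>(1 - cos x)\<^sup>2 * x powr (2*H - 3)\<bar> \<le> 4 * x powr (1 + 2*H)"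
      by (simp add: abs_mult)
  next
    fix x :: real assume x: "1 \<le> x"
    have "(1 - cos x)\<^sup>2 * x powr (2*H - 3) \<le> 2\<^sup>2 * x powr (2*H - 3)"
      using cos_ge_minus_one[of x] by (intro mult_right_mono power_mono) (auto simp del: cos_ge_minus_one)
    then show "\<bar>(1 - cos x)\<^sup>2 * x powr (2*H - 3)\<bar> \<le> 4 * x powr (2*H - 3)"
      by (simp add: abs_mult)
  qed (use assms in auto)
  have "has_bochner_integral lborel (\<lambda>x::real. indicator {0<..} x * ((1 - cos x)\<^sup>2 * x powr (2*H - 3))) (fejer_const H)"
    unfolding fejer_const_def by (intro has_bochner_integral_integrable int)
  then have "has_bochner_integral lborel (\<lambda>\<xi>::real. indicator {0<..} (0 + r * \<xi>) * ((1 - cos (0 + r * \<xi>))\<^sup>2 * (0 + r * \<xi>) powr (2*H - 3))) (fejer_const H /\<^sub>R \<bar>r\<bar>)"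
    by (subst lborel_has_bochner_integral_real_affine_iff[symmetric]) (use assms in auto)
  then have "has_bochner_integral lborel (\<lambda>\<xi>::real. r powr (3 - 2*H) * (indicator {0<..} (0 + r * \<xi>) * ((1 - cos (0 + r * \<xi>))\<^sup>2 * (0 + r * \<xi>) powr (2*H - 3)))) (r powr (3 - 2*H) * (fejer_const H /\<^sub>R \<bar>r\<bar>))"
    by (rule has_bochner_integral_mult_right)
  moreover have "r powr (3 - 2*H) * (fejer_const H /\<^sub>R \<bar>r\<bar>) = fejer_const H * r powr (2 - 2*H)"
  proof -
    have "r powr (3 - 2*H) = r powr (2 - 2*H) * r powr 1"
      by (subst powr_add[symmetric]) simp
    then show ?thesis using assms by (simp add: field_simps)
  qed
  moreover have "r powr (3 - 2*H) * (indicator {0<..} (0 + r * \<xi>) * ((1 - cos (0 + r * \<xi>))\<^sup>2 * (0 + r * \<xi>) powr (2*H - 3)))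
      = indicator {0<..} \<xi> * ((1 - cos (r * \<xi>))\<^sup>2 * \<xi> powr (2*H - 3))" for \<xi> :: real
  proof (cases "\<xi> > 0")
    case True
    have "(r * \<xi>) powr (2*H - 3) = r powr (2*H - 3) * \<xi> powr (2*H - 3)"
      using True assms by (simp add: powr_mult)
    moreover have "r powr (3 - 2*H) * r powr (2*H - 3) = 1"
      using assms by (simp flip: powr_add)
    ultimately show ?thesis using True assms by (simp add: zero_less_mult_iff)
  qed (use assms in \<open>auto simp: indicator_def zero_less_mult_iff\<close>)
  ultimately show ?thesis by (simp only:)
qed

lemma fejer_const_nonneg: "fejer_const H \<ge> 0"
  unfolding fejer_const_def by (intro integral_nonneg_AE AE_I2) auto

text \<open>The Fourier transform of the Fejer kernel is a tent function, hence has compact support.\<close>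

lemma tent_integral:
  "has_bochner_integral lborel
    (\<lambda>\<xi>::real. indicator {0<..} \<xi> * (cos (x * \<xi>) * ((1 - cos (r * \<xi>)) * \<xi> powr (-2))))
    (fbm_const (1/2) * (\<bar>x + r\<bar>/2 + \<bar>x - r\<bar>/2 - \<bar>x\<bar>))"
proof -
  let ?s = "\<lambda>x \<xi>::real. indicator {0<..} \<xi> * ((1 - cos (x * \<xi>)) * \<xi> powr (-2)) :: real"
  \<comment> \<open>At H = 1/2 the spectral integral represents the absolute value, and the tent is
    a second difference of absolute values; the product formula for cosines does the rest.\<close>
  have s: "has_bochner_integral lborel (?s y) (fbm_const (1/2) * \<bar>y\<bar>)" for y
    using spectral_integral[of "1/2" y] by simp
  have "has_bochner_integral lborel (\<lambda>\<xi>. ?s (x+r) \<xi> * (1/2) + ?s (x-r) \<xi> * (1/2) - ?s x \<xi>)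
     (fbm_const (1/2) * \<bar>x+r\<bar> * (1/2) + fbm_const (1/2) * \<bar>x-r\<bar> * (1/2) - fbm_const (1/2) * \<bar>x\<bar>)"
    by (intro has_bochner_integral_diff has_bochner_integral_add has_bochner_integral_mult_left s)
  moreover have "?s (x+r) \<xi> * (1/2) + ?s (x-r) \<xi> * (1/2) - ?s x \<xi>
      = indicator {0<..} \<xi> * (cos (x * \<xi>) * ((1 - cos (r * \<xi>)) * \<xi> powr (-2)))" for \<xi>
  proof -
    have "cos ((x+r) * \<xi>) + cos ((x-r) * \<xi>) = 2 * cos (x * \<xi>) * cos (r * \<xi>)"
      by (simp add: distrib_right left_diff_distrib cos_add cos_diff)
    then have e: "cos ((x+r) * \<xi>) = 2 * cos (x * \<xi>) * cos (r * \<xi>) - cos ((x-r) * \<xi>)" by simp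
    show ?thesis unfolding e by (simp add: algebra_simps)
  qed
  ultimately show ?thesis by (simp add: algebra_simps)
qed

text \<open>The value that the optimal choice of \<open>t\<close> in the next proof produces. Adding
  1 to \<open>fejer_const H\<close> keeps the denominator positive when only nonnegativity of that
  constant is known.\<close>

definition lnd_const :: "real \<Rightarrow> real" where
  "lnd_const H = (fbm_const (1/2))\<^sup>2 / (2 * fbm_const H * (fejer_const H + 1))"

lemma lnd_const_pos: "0 < H \<Longrightarrow> H < 1 \<Longrightarrow> lnd_const H > 0"
  unfolding lnd_const_def using fbm_const_pos[of H] fbm_const_pos[of "1/2"] fejer_const_nonneg[of H]
  by (intro divide_pos_pos mult_pos_pos) auto

lemma has_bochner_integral_le:
  fixes f g :: "'a \<Rightarrow> real"
  assumes "has_bochner_integral M f x" "has_bochner_integral M g y" "\<And>z. f z \<le> g z"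
  shows "x \<le> y"
  using assms integral_mono[of M f g] by (auto simp: has_bochner_integral_iff)

text \<open>Strong local nondeterminism (Pitt): the spectral density of the form is compared, by
  completing the square, with the Fourier transform of a tent function centred at \<open>u i\<close> which
  vanishes at all other points.\<close>

lemma strong_local_nondeterminism:
  fixes a u :: "'i \<Rightarrow> real"
  assumes H: "0 < H" "H < 1" and L: "finite L" "i \<in> L" and sum0: "(\<Sum>l\<in>L. a l) = 0" and r: "r > 0"
    and sep: "\<And>l. l \<in> L \<Longrightarrow> l \<noteq> i \<Longrightarrow> \<bar>u l - u i\<bar> \<ge> r"
  shows "lnd_const H * (a i)\<^sup>2 * r powr (2*H) \<le> - (1/2) * (\<Sum>j\<in>L. \<Sum>l\<in>L. a j * a l * \<bar>u j - u l\<bar> powr (2*H))"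
proof -
  define C where "C \<xi> = (\<Sum>l\<in>L. a l * cos ((u l - u i) * \<xi>))" for \<xi> :: real
  define S where "S \<xi> = (\<Sum>l\<in>L. a l * sin ((u l - u i) * \<xi>))" for \<xi> :: real
  define w where "w \<xi> = \<xi> powr (-1 - 2*H)" for \<xi> :: real
  define g where "g \<xi> = (1 - cos (r * \<xi>)) * \<xi> powr (-2)" for \<xi> :: real
  define K where "K = fejer_const H + 1"
  define c where "c = fbm_const (1/2)"
  define Q where "Q = - (\<Sum>j\<in>L. \<Sum>l\<in>L. a j * a l * \<bar>u j - u l\<bar> powr (2*H))"
  \<comment> \<open>The maximiser of
    \<open>2 * t * (a i * c * r) - t\<^sup>2 * K * r powr (2 - 2*H)\<close>, the lower bound
    obtained below.\<close>
  define t where "t = a i * c * r powr (2*H - 1) / K"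
  have K: "K > 0" using fejer_const_nonneg[of H] by (simp add: K_def)
  \<comment> \<open>With phases taken relative to \<open>u i\<close>, the double sum of cosines is
    the squared modulus of one trigonometric sum; the constant term disappears because the
    coefficients sum to 0.\<close>
  have CS: "(\<Sum>j\<in>L. \<Sum>l\<in>L. a j * a l * (1 - cos ((u j - u l) * \<xi>))) = - ((C \<xi>)\<^sup>2 + (S \<xi>)\<^sup>2)" for \<xi>
  proof -
    have "(\<Sum>j\<in>L. \<Sum>l\<in>L. a j * a l * (1 - cos ((u j - u l) * \<xi>)))
      = (\<Sum>j\<in>L. \<Sum>l\<in>L. a j * a l - (a j * cos ((u j - u i) * \<xi>)) * (a l * cos ((u l - u i) * \<xi>))
           - (a j * sin ((u j - u i) * \<xi>)) * (a l * sin ((u l - u i) * \<xi>)))"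
    proof (intro sum.cong refl)
      fix j l
      have "(u j - u l) * \<xi> = (u j - u i) * \<xi> - (u l - u i) * \<xi>" by (simp add: algebra_simps)
      then have "cos ((u j - u l) * \<xi>) = cos ((u j - u i) * \<xi>) * cos ((u l - u i) * \<xi>) + sin ((u j - u i) * \<xi>) * sin ((u l - u i) * \<xi>)"
        by (simp add: cos_diff)
      then show "a j * a l * (1 - cos ((u j - u l) * \<xi>)) = a j * a l - (a j * cos ((u j - u i) * \<xi>)) * (a l * cos ((u l - u i) * \<xi>))
           - (a j * sin ((u j - u i) * \<xi>)) * (a l * sin ((u l - u i) * \<xi>))"
        by (simp add: algebra_simps)
    qed
    also have "\<dots> = (\<Sum>l\<in>L. a l)\<^sup>2 - (C \<xi>)\<^sup>2 - (S \<xi>)\<^sup>2"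
      unfolding C_def S_def power2_eq_square sum_product by (simp add: sum_subtractf)
    finally show ?thesis using sum0 by simp
  qed
  have "has_bochner_integral lborel (\<lambda>\<xi>. \<Sum>j\<in>L. \<Sum>l\<in>L. a j * a l * (indicator {0<..} \<xi> * ((1 - cos ((u j - u l) * \<xi>)) * w \<xi>)))
     (\<Sum>j\<in>L. \<Sum>l\<in>L. a j * a l * (fbm_const H * \<bar>u j - u l\<bar> powr (2*H)))"
    unfolding w_def
    by (intro has_bochner_integral_sum has_bochner_integral_mult_right spectral_integral H)
  then have "has_bochner_integral lborel (\<lambda>\<xi>. - (\<Sum>j\<in>L. \<Sum>l\<in>L. a j * a l * (indicator {0<..} \<xi> * ((1 - cos ((u j - u l) * \<xi>)) * w \<xi>))))
     (- (\<Sum>j\<in>L. \<Sum>l\<in>L. a j * a l * (fbm_const H * \<bar>u j - u l\<bar> powr (2*H))))"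
    by (rule has_bochner_integral_minus)
  moreover have "- (\<Sum>j\<in>L. \<Sum>l\<in>L. a j * a l * (fbm_const H * \<bar>u j - u l\<bar> powr (2*H))) = fbm_const H * Q"
    by (simp add: Q_def sum_distrib_left algebra_simps)
  moreover have "- (\<Sum>j\<in>L. \<Sum>l\<in>L. a j * a l * (indicator {0<..} \<xi> * ((1 - cos ((u j - u l) * \<xi>)) * w \<xi>)))
      = indicator {0<..} \<xi> * (((C \<xi>)\<^sup>2 + (S \<xi>)\<^sup>2) * w \<xi>)" for \<xi>
  proof -
    have e: "(\<Sum>j\<in>L. \<Sum>l\<in>L. a j * a l * (indicator {0<..} \<xi> * ((1 - cos ((u j - u l) * \<xi>)) * w \<xi>)))
      = (\<Sum>j\<in>L. \<Sum>l\<in>L. a j * a l * (1 - cos ((u j - u l) * \<xi>))) * (indicator {0<..} \<xi> * w \<xi>)"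
      by (simp add: sum_distrib_right mult.assoc mult.left_commute[of "indicator {0<..} \<xi>"])
    show ?thesis unfolding e CS by (simp only: minus_mult_left[symmetric] minus_minus mult_ac)
  qed
  ultimately have I1: "has_bochner_integral lborel (\<lambda>\<xi>. indicator {0<..} \<xi> * (((C \<xi>)\<^sup>2 + (S \<xi>)\<^sup>2) * w \<xi>)) (fbm_const H * Q)"
    by simp
  have "has_bochner_integral lborel (\<lambda>\<xi>. \<Sum>l\<in>L. a l * (indicator {0<..} \<xi> * (cos ((u l - u i) * \<xi>) * g \<xi>)))
    (\<Sum>l\<in>L. a l * (c * (\<bar>(u l - u i) + r\<bar>/2 + \<bar>(u l - u i) - r\<bar>/2 - \<bar>u l - u i\<bar>)))"
    unfolding g_def c_def by (intro has_bochner_integral_sum has_bochner_integral_mult_right tent_integral)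
  moreover have "(\<Sum>l\<in>L. a l * (c * (\<bar>(u l - u i) + r\<bar>/2 + \<bar>(u l - u i) - r\<bar>/2 - \<bar>u l - u i\<bar>))) = a i * (c * r)"
  proof -
    have "a l * (c * (\<bar>(u l - u i) + r\<bar>/2 + \<bar>(u l - u i) - r\<bar>/2 - \<bar>u l - u i\<bar>)) = (if l = i then a i * (c * r) else 0)" if "l \<in> L" for l
    proof (cases "l = i")
      case False
      have "\<bar>(u l - u i) + r\<bar>/2 + \<bar>(u l - u i) - r\<bar>/2 - \<bar>u l - u i\<bar> = 0"
      proof -
        have "u l - u i \<ge> r \<or> u l - u i \<le> - r" using sep[OF that False] by linarith
        then show ?thesis
        proof
          assume x: "u l - u i \<ge> r"
          then have "\<bar>u l - u i + r\<bar> = u l - u i + r" "\<bar>u l - u i - r\<bar> = u l - u i - r" "\<bar>u l - u i\<bar> = u l - u i"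
            using r by linarith+
          then show ?thesis by (simp add: field_simps)
        next
          assume x: "u l - u i \<le> - r"
          then have "\<bar>u l - u i + r\<bar> = -(u l - u i + r)" "\<bar>u l - u i - r\<bar> = -(u l - u i - r)" "\<bar>u l - u i\<bar> = -(u l - u i)"
            using r by linarith+
          then show ?thesis by (simp add: field_simps)
        qed
      qed
      then show ?thesis using False by simp
    qed (use r in auto)
    then show ?thesis using L by (simp cong: sum.cong)
  qed
  moreover have "(\<Sum>l\<in>L. a l * (indicator {0<..} \<xi> * (cos ((u l - u i) * \<xi>) * g \<xi>))) = indicator {0<..} \<xi> * (C \<xi> * g \<xi>)" for \<xi>
    by (simp add: C_def sum_distrib_left sum_distrib_right mult_ac)
  ultimately have I2: "has_bochner_integral lborel (\<lambda>\<xi>. indicator {0<..} \<xi> * (C \<xi> * g \<xi>)) (a i * (c * r))"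
    by simp
  have I3: "has_bochner_integral lborel (\<lambda>\<xi>::real. indicator {0<..} \<xi> * ((1 - cos (r * \<xi>))\<^sup>2 * \<xi> powr (2*H - 3))) (fejer_const H * r powr (2 - 2*H))"
    by (rule fejer_const_integral[OF H r])
  have I4: "has_bochner_integral lborel (\<lambda>\<xi>. (2 * t) * (indicator {0<..} \<xi> * (C \<xi> * g \<xi>)) - t\<^sup>2 * (indicator {0<..} \<xi> * ((1 - cos (r * \<xi>))\<^sup>2 * \<xi> powr (2*H - 3))))
     ((2 * t) * (a i * (c * r)) - t\<^sup>2 * (fejer_const H * r powr (2 - 2*H)))"
    by (intro has_bochner_integral_diff has_bochner_integral_mult_right I2 I3)
  have "(2 * t) * (a i * (c * r)) - t\<^sup>2 * (fejer_const H * r powr (2 - 2*H)) \<le> fbm_const H * Q"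
  proof (rule has_bochner_integral_le[OF I4 I1])
    fix \<xi> :: real
    show "(2 * t) * (indicator {0<..} \<xi> * (C \<xi> * g \<xi>)) - t\<^sup>2 * (indicator {0<..} \<xi> * ((1 - cos (r * \<xi>))\<^sup>2 * \<xi> powr (2*H - 3)))
       \<le> indicator {0<..} \<xi> * (((C \<xi>)\<^sup>2 + (S \<xi>)\<^sup>2) * w \<xi>)"
    proof (cases "\<xi> > 0")
      case True
      have w: "w \<xi> > 0" using True by (simp add: w_def)
      have gg: "(1 - cos (r * \<xi>))\<^sup>2 * \<xi> powr (2*H - 3) = (g \<xi>)\<^sup>2 / w \<xi>"
      proof -
        have "(\<xi> powr (-2))\<^sup>2 / \<xi> powr (-1 - 2*H) = \<xi> powr (2*H - 3)"
          using True by (simp add: power2_eq_square flip: powr_add powr_diff)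
        then show ?thesis unfolding g_def w_def by (simp add: power_mult_distrib flip: times_divide_eq_right)
      qed
      have "0 \<le> w \<xi> * (C \<xi> - t * g \<xi> / w \<xi>)\<^sup>2" using w by simp
      also have "\<dots> = (C \<xi>)\<^sup>2 * w \<xi> - 2 * t * (C \<xi> * g \<xi>) + t\<^sup>2 * ((g \<xi>)\<^sup>2 / w \<xi>)"
        using w by (simp add: power2_eq_square field_simps)
      finally have "2 * t * (C \<xi> * g \<xi>) - t\<^sup>2 * ((g \<xi>)\<^sup>2 / w \<xi>) \<le> (C \<xi>)\<^sup>2 * w \<xi>" by simp
      also have "\<dots> \<le> ((C \<xi>)\<^sup>2 + (S \<xi>)\<^sup>2) * w \<xi>" using w by simp
      finally show ?thesis using True by (simp add: gg)
    qed simp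
  qed
  moreover have "t\<^sup>2 * (fejer_const H * r powr (2 - 2*H)) \<le> t\<^sup>2 * (K * r powr (2 - 2*H))"
    by (intro mult_left_mono mult_right_mono) (auto simp: K_def)
  moreover have "t\<^sup>2 * (K * r powr (2 - 2*H)) = (a i)\<^sup>2 * c\<^sup>2 * r powr (2*H) / K"
  proof -
    have "(r powr (2*H - 1))\<^sup>2 * r powr (2 - 2*H) = r powr (2*H)"
      unfolding power2_eq_square by (simp flip: powr_add)
    then show ?thesis using K unfolding t_def
      by (simp add: power_mult_distrib power_divide power2_eq_square field_simps)
  qed
  moreover have "(2 * t) * (a i * (c * r)) = 2 * ((a i)\<^sup>2 * c\<^sup>2 * r powr (2*H) / K)"
  proof -
    have "r powr (2*H - 1) * r = r powr (2*H)"
      using r powr_add[of r "2*H - 1" 1] by simp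
    then show ?thesis using K unfolding t_def
      by (simp add: power2_eq_square field_simps)
  qed
  ultimately have "(a i)\<^sup>2 * c\<^sup>2 * r powr (2*H) / K \<le> fbm_const H * Q" by linarith
  then have "(a i)\<^sup>2 * c\<^sup>2 * r powr (2*H) / K / (2 * fbm_const H) \<le> fbm_const H * Q / (2 * fbm_const H)"
    using fbm_const_pos[OF H] by (intro divide_right_mono) auto
  then have "(a i)\<^sup>2 * c\<^sup>2 * r powr (2*H) / K / (2 * fbm_const H) \<le> Q / 2"
    using fbm_const_pos[OF H] by simp
  then show ?thesis unfolding lnd_const_def Q_def c_def[symmetric] K_def[symmetric]
    by (simp add: mult_ac)
qed

section \<open>Gaussian integrals of quadratic forms\<close>

lemma nn_integral_exp_square:
  assumes "a > 0"
  shows "(\<integral>\<^sup>+t. ennreal (exp (-(a * (t + b)\<^sup>2))) \<partial>lborel) = ennreal (sqrt (pi / a))"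
proof -
  define s where "s = sqrt (1 / (2*a))"
  have s: "s > 0" "s\<^sup>2 = 1 / (2*a)" using assms by (auto simp: s_def)
  have "has_bochner_integral lborel (normal_density (-b) s) 1"
    using normal_moment_even[OF s(1), of "-b" 0] by simp
  then have "has_bochner_integral lborel (\<lambda>t. sqrt (pi / a) * normal_density (-b) s t) (sqrt (pi / a) * 1)"
    by (rule has_bochner_integral_mult_right)
  moreover have "sqrt (pi / a) * normal_density (-b) s t = exp (-(a * (t + b)\<^sup>2))" for t
    using assms unfolding normal_density_def s(2) by (simp add: field_simps)
  ultimately have "has_bochner_integral lborel (\<lambda>t. exp (-(a * (t + b)\<^sup>2))) (sqrt (pi / a))"
    by simp
  then show ?thesis
    by (intro nn_integral_eq_integral[THEN trans]) (auto simp: has_bochner_integral_iff)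
qed

text \<open>Integrating out coordinate x contributes \<open>sqrt (pi / a x x)\<close>, and testing
  the bound on a unit vector shows that \<open>a x x\<close> is at least \<open>m x\<close>. What
  remains is the Schur complement, which is the minimum of the form over that coordinate and
  therefore inherits the lower bounds for all other coordinates.\<close>

lemma gaussian_integral_le:
  fixes a :: "'i \<Rightarrow> 'i \<Rightarrow> real" and m :: "'i \<Rightarrow> real"
  assumes "finite I" and sym: "\<And>i j. a i j = a j i" and pos: "\<And>i. i \<in> I \<Longrightarrow> m i > 0"
    and lb: "\<And>p i. i \<in> I \<Longrightarrow> m i * (p i)\<^sup>2 \<le> (\<Sum>i\<in>I. \<Sum>j\<in>I. a i j * p i * p j)"
  shows "(\<integral>\<^sup>+p. ennreal (exp (- (\<Sum>i\<in>I. \<Sum>j\<in>I. a i j * p i * p j))) \<partial>Pi\<^sub>M I (\<lambda>_. lborel))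
    \<le> ennreal (\<Prod>i\<in>I. sqrt (pi / m i))"
  using assms
proof (induction I arbitrary: a rule: finite_induct)
  case empty
  interpret product_sigma_finite "\<lambda>_. lborel :: real measure" by standard
  show ?case by (simp add: space_PiM_empty)
next
  case (insert x I)
  interpret product_sigma_finite "\<lambda>_. lborel :: real measure" by standard
  note fin = insert.hyps
  define s where "s = a x x"
  define \<beta> where "\<beta> p = (\<Sum>i\<in>I. a x i * p i)" for p
  \<comment> \<open>The Schur complement of the entry \<open>a x x\<close>.\<close>
  define a' where "a' i j = a i j - a x i * a x j / s" for i j
  have s: "s \<ge> m x"
    using insert.prems(3)[of x "\<lambda>i. if i = x then 1 else 0"] fin
    by (simp add: s_def sum.neutral)
  have mx: "m x > 0" using insert.prems(2)[of x] by simp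
  have s0: "s > 0" using s mx by simp
  have Q: "(\<Sum>i\<in>insert x I. \<Sum>j\<in>insert x I. a i j * (p(x:=t)) i * (p(x:=t)) j)
      = s * (t + \<beta> p / s)\<^sup>2 + (\<Sum>i\<in>I. \<Sum>j\<in>I. a' i j * p i * p j)" for p t
  proof -
    have "(\<Sum>i\<in>insert x I. \<Sum>j\<in>insert x I. a i j * (p(x:=t)) i * (p(x:=t)) j)
      = s * t\<^sup>2 + t * \<beta> p + (\<Sum>i\<in>I. a i x * p i * t) + (\<Sum>i\<in>I. \<Sum>j\<in>I. a i j * p i * p j)"
    proof -
      have ne: "j \<noteq> x" if "j \<in> I" for j using that fin by auto
      have "(\<Sum>j\<in>I. a x j * t * (p(x:=t)) j) = t * \<beta> p"
        unfolding \<beta>_def sum_distrib_left by (intro sum.cong refl) (auto dest: ne)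
      moreover have "(\<Sum>i\<in>I. \<Sum>j\<in>insert x I. a i j * (p(x:=t)) i * (p(x:=t)) j)
         = (\<Sum>i\<in>I. a i x * p i * t + (\<Sum>j\<in>I. a i j * p i * p j))"
      proof (intro sum.cong refl)
        fix i assume i: "i \<in> I"
        have "(\<Sum>j\<in>I. a i j * (p(x:=t)) i * (p(x:=t)) j) = (\<Sum>j\<in>I. a i j * p i * p j)"
          by (intro sum.cong refl) (use ne[OF i] in \<open>auto dest: ne\<close>)
        then show "(\<Sum>j\<in>insert x I. a i j * (p(x:=t)) i * (p(x:=t)) j) = a i x * p i * t + (\<Sum>j\<in>I. a i j * p i * p j)"
          using fin ne[OF i] by simp
      qed
      ultimately show ?thesis using fin
        by (simp add: sum.distrib s_def power2_eq_square)
    qed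
    moreover have "(\<Sum>i\<in>I. a i x * p i * t) = t * \<beta> p"
      unfolding \<beta>_def sum_distrib_left using insert.prems(1) by (intro sum.cong refl) simp
    moreover have "(\<Sum>i\<in>I. \<Sum>j\<in>I. a' i j * p i * p j) = (\<Sum>i\<in>I. \<Sum>j\<in>I. a i j * p i * p j) - (\<beta> p)\<^sup>2 / s"
    proof -
      have "(\<beta> p)\<^sup>2 / s = (\<Sum>i\<in>I. \<Sum>j\<in>I. (a x i * p i) * (a x j * p j) / s)"
        unfolding \<beta>_def power2_eq_square sum_product by (simp add: sum_divide_distrib)
      then show ?thesis
        unfolding a'_def by (simp add: sum_subtractf[symmetric] algebra_simps)
    qed
    moreover have "s * (t + \<beta> p / s)\<^sup>2 = s * t\<^sup>2 + 2 * (t * \<beta> p) + (\<beta> p)\<^sup>2 / s"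
      using s0 by (simp add: power2_eq_square field_simps)
    ultimately show ?thesis by simp
  qed
  have IH: "(\<integral>\<^sup>+p. ennreal (exp (- (\<Sum>i\<in>I. \<Sum>j\<in>I. a' i j * p i * p j))) \<partial>Pi\<^sub>M I (\<lambda>_. lborel))
    \<le> ennreal (\<Prod>i\<in>I. sqrt (pi / m i))"
  proof (rule insert.IH)
    show "a' i j = a' j i" for i j unfolding a'_def by (simp add: insert.prems(1)[of i j] mult.commute)
    show "m i > 0" if "i \<in> I" for i using insert.prems(2) that by auto
    fix p :: "'i \<Rightarrow> real" and i assume i: "i \<in> I"
    \<comment> \<open>This value of coordinate x makes the completed square vanish, so the full form
      equals the reduced one there.\<close>
    have "m i * ((p(x := - \<beta> p / s)) i)\<^sup>2 \<le> (\<Sum>i\<in>I. \<Sum>j\<in>I. a' i j * p i * p j)"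
      using insert.prems(3)[of i "p(x := - \<beta> p / s)"] i unfolding Q by simp
    then show "m i * (p i)\<^sup>2 \<le> (\<Sum>i\<in>I. \<Sum>j\<in>I. a' i j * p i * p j)"
      using i fin by (auto split: if_splits)
  qed
  have "(\<integral>\<^sup>+p. ennreal (exp (- (\<Sum>i\<in>insert x I. \<Sum>j\<in>insert x I. a i j * p i * p j))) \<partial>Pi\<^sub>M (insert x I) (\<lambda>_. lborel))
    = (\<integral>\<^sup>+p. (\<integral>\<^sup>+t. ennreal (exp (- (\<Sum>i\<in>insert x I. \<Sum>j\<in>insert x I. a i j * (p(x:=t)) i * (p(x:=t)) j))) \<partial>lborel) \<partial>Pi\<^sub>M I (\<lambda>_. lborel))"
    using fin by (intro product_nn_integral_insert) auto
  also have "\<dots> = (\<integral>\<^sup>+p. ennreal (exp (- (\<Sum>i\<in>I. \<Sum>j\<in>I. a' i j * p i * p j))) * ennreal (sqrt (pi / s)) \<partial>Pi\<^sub>M I (\<lambda>_. lborel))"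
  proof (intro nn_integral_cong)
    fix p :: "'i \<Rightarrow> real"
    have "(\<integral>\<^sup>+t. ennreal (exp (- (\<Sum>i\<in>insert x I. \<Sum>j\<in>insert x I. a i j * (p(x:=t)) i * (p(x:=t)) j))) \<partial>lborel)
      = (\<integral>\<^sup>+t. ennreal (exp (- (\<Sum>i\<in>I. \<Sum>j\<in>I. a' i j * p i * p j))) * ennreal (exp (-(s * (t + \<beta> p / s)\<^sup>2))) \<partial>lborel)"
      unfolding Q by (intro nn_integral_cong) (simp flip: ennreal_mult exp_add)
    also have "\<dots> = ennreal (exp (- (\<Sum>i\<in>I. \<Sum>j\<in>I. a' i j * p i * p j))) * ennreal (sqrt (pi / s))"
      by (subst nn_integral_cmult) (auto simp: nn_integral_exp_square[OF s0])
    finally show "(\<integral>\<^sup>+t. ennreal (exp (- (\<Sum>i\<in>insert x I. \<Sum>j\<in>insert x I. a i j * (p(x:=t)) i * (p(x:=t)) j))) \<partial>lborel) = \<dots>" .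
  qed
  also have "\<dots> = (\<integral>\<^sup>+p. ennreal (exp (- (\<Sum>i\<in>I. \<Sum>j\<in>I. a' i j * p i * p j))) \<partial>Pi\<^sub>M I (\<lambda>_. lborel)) * ennreal (sqrt (pi / s))"
    by (intro nn_integral_multc) auto
  also have "\<dots> \<le> ennreal (\<Prod>i\<in>I. sqrt (pi / m i)) * ennreal (sqrt (pi / m x))"
  proof (intro mult_mono IH ennreal_leI real_sqrt_le_mono)
    show "pi / s \<le> pi / m x" using s mx by (intro divide_left_mono) auto
  qed auto
  also have "\<dots> = ennreal (\<Prod>i\<in>insert x I. sqrt (pi / m i))"
  proof -
    have "0 \<le> (\<Prod>i\<in>I. sqrt (pi / m i))"
      using insert.prems(2) by (intro prod_nonneg) (auto intro: less_imp_le)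
    then show ?thesis using fin mx by (simp add: ennreal_mult[symmetric] mult.commute)
  qed
  finally show ?case .
qed

section \<open>Polynomial factors against a Gaussian form\<close>

lemma power_div_fact_le_exp:
  assumes "y \<ge> (0::real)"
  shows "y ^ k / fact k \<le> exp y"
proof -
  have "(\<Sum>i\<in>{k}. y ^ i /\<^sub>R fact i) \<le> (\<Sum>i. y ^ i /\<^sub>R fact i)"
    using assms summable_exp_generic[of y] by (intro sum_le_suminf) auto
  then show ?thesis by (simp add: exp_def field_simps)
qed

text \<open>A crude bound for \<open>y ^ k * exp (- y\<^sup>2)\<close>, coming from
  \<open>y ^ k / fact k \<le> exp y\<close> and \<open>y \<le> 1 + y\<^sup>2\<close>.\<close>

definition moment_const :: "nat \<Rightarrow> real" where
  "moment_const k = exp 1 * fact k"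

lemma power_exp_square_le:
  assumes "t > 0"
  shows "\<bar>p\<bar> ^ k * exp (- (t * p\<^sup>2)) \<le> moment_const k * (1 / sqrt t) ^ k"
proof -
  define y where "y = sqrt t * \<bar>p\<bar>"
  have y: "y \<ge> 0" "y\<^sup>2 = t * p\<^sup>2" using assms by (auto simp: y_def power_mult_distrib)
  have "y ^ k / fact k \<le> exp y" by (rule power_div_fact_le_exp[OF y(1)])
  also have "y \<le> 1 + y\<^sup>2"
  proof -
    have "0 \<le> (y - 1/2)\<^sup>2" by simp
    then show ?thesis by (simp add: power2_eq_square algebra_simps)
  qed
  then have "exp y \<le> exp 1 * exp (y\<^sup>2)" by (simp flip: exp_add)
  finally have "y ^ k \<le> exp 1 * fact k * exp (y\<^sup>2)" by (simp add: field_simps)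
  then have "y ^ k * exp (- y\<^sup>2) \<le> exp 1 * fact k * exp (y\<^sup>2) * exp (- y\<^sup>2)"
    by (intro mult_right_mono) auto
  also have "\<dots> = moment_const k" by (simp add: moment_const_def flip: exp_add)
  finally have *: "y ^ k * exp (- y\<^sup>2) \<le> moment_const k" .
  have "\<bar>p\<bar> ^ k = y ^ k * (1 / sqrt t) ^ k"
    using assms by (simp add: y_def power_mult_distrib power_divide)
  then have "\<bar>p\<bar> ^ k * exp (- (t * p\<^sup>2)) = (y ^ k * exp (- y\<^sup>2)) * (1 / sqrt t) ^ k"
    by (simp add: y(2))
  also have "\<dots> \<le> moment_const k * (1 / sqrt t) ^ k"
    using * assms by (intro mult_right_mono) auto
  finally show ?thesis .
qed

text \<open>Half of the quadratic form absorbs the polynomial factor; bounding that half by an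
  average over the coordinates costs a factor of order \<open>sqrt (card A)\<close> per derivative. The other
  half is integrated without loss.\<close>

lemma gaussian_moment_integral_le:
  fixes a :: "'i \<Rightarrow> 'i \<Rightarrow> real" and m :: "'i \<Rightarrow> real" and \<kappa> :: "'i \<Rightarrow> nat"
  assumes A: "finite A" "A \<noteq> {}" and sym: "\<And>i j. a i j = a j i" and pos: "\<And>i. i \<in> A \<Longrightarrow> m i > 0"
    and lb: "\<And>p i. i \<in> A \<Longrightarrow> m i * (p i)\<^sup>2 \<le> (\<Sum>i\<in>A. \<Sum>j\<in>A. a i j * p i * p j)"
  shows "(\<integral>\<^sup>+p. ennreal ((\<Prod>i\<in>A. \<bar>p i\<bar> ^ \<kappa> i) * exp (- (\<Sum>i\<in>A. \<Sum>j\<in>A. a i j * p i * p j) / 2)) \<partial>Pi\<^sub>M A (\<lambda>_. lborel))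
    \<le> ennreal (\<Prod>i\<in>A. moment_const (\<kappa> i) * sqrt (4 * card A / m i) ^ \<kappa> i * sqrt (4 * pi / m i))"
proof -
  define n where "n = real (card A)"
  have n: "n > 0" using A by (simp add: n_def card_gt_0_iff)
  define C where "C = (\<Prod>i\<in>A. moment_const (\<kappa> i) * sqrt (4 * n / m i) ^ \<kappa> i)"
  define Q where "Q p = (\<Sum>i\<in>A. \<Sum>j\<in>A. a i j * p i * p j)" for p
  have C: "C \<ge> 0" unfolding C_def moment_const_def
    using pos n by (intro prod_nonneg) (auto intro!: mult_nonneg_nonneg simp: less_imp_le)
  have Q4: "(\<Sum>i\<in>A. \<Sum>j\<in>A. (a i j / 4) * p i * p j) = Q p / 4" for p
    unfolding Q_def by (simp add: sum_divide_distrib)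
  have "(\<integral>\<^sup>+p. ennreal ((\<Prod>i\<in>A. \<bar>p i\<bar> ^ \<kappa> i) * exp (- Q p / 2)) \<partial>Pi\<^sub>M A (\<lambda>_. lborel))
    \<le> (\<integral>\<^sup>+p. ennreal C * ennreal (exp (- (\<Sum>i\<in>A. \<Sum>j\<in>A. (a i j / 4) * p i * p j))) \<partial>Pi\<^sub>M A (\<lambda>_. lborel))"
  proof (intro nn_integral_mono)
    fix p :: "'i \<Rightarrow> real"
    have "(\<Sum>i\<in>A. m i * (p i)\<^sup>2) \<le> (\<Sum>i\<in>A. Q p)"
      unfolding Q_def by (intro sum_mono lb)
    then have "(\<Sum>i\<in>A. m i / (4*n) * (p i)\<^sup>2) \<le> Q p / 4"
      using n by (simp add: sum_divide_distrib[symmetric] field_simps n_def[symmetric])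
    then have "exp (- Q p / 4) \<le> exp (- (\<Sum>i\<in>A. m i / (4*n) * (p i)\<^sup>2))" by simp
    also have "\<dots> = (\<Prod>i\<in>A. exp (- (m i / (4*n) * (p i)\<^sup>2)))"
      using A by (simp add: exp_sum sum_negf[symmetric])
    finally have "(\<Prod>i\<in>A. \<bar>p i\<bar> ^ \<kappa> i) * exp (- Q p / 4) \<le> (\<Prod>i\<in>A. \<bar>p i\<bar> ^ \<kappa> i) * (\<Prod>i\<in>A. exp (- (m i / (4*n) * (p i)\<^sup>2)))"
      by (intro mult_left_mono prod_nonneg) auto
    also have "\<dots> = (\<Prod>i\<in>A. \<bar>p i\<bar> ^ \<kappa> i * exp (- (m i / (4*n) * (p i)\<^sup>2)))"
      by (simp add: prod.distrib)
    also have "\<dots> \<le> C"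
      unfolding C_def
    proof (intro prod_mono conjI)
      fix i assume i: "i \<in> A"
      have "\<bar>p i\<bar> ^ \<kappa> i * exp (- (m i / (4*n) * (p i)\<^sup>2)) \<le> moment_const (\<kappa> i) * (1 / sqrt (m i / (4*n))) ^ \<kappa> i"
        using pos[OF i] n by (intro power_exp_square_le) auto
      also have "1 / sqrt (m i / (4*n)) = sqrt (4 * n / m i)" by (simp add: real_sqrt_divide)
      finally show "\<bar>p i\<bar> ^ \<kappa> i * exp (- (m i / (4*n) * (p i)\<^sup>2)) \<le> moment_const (\<kappa> i) * sqrt (4 * n / m i) ^ \<kappa> i" .
    qed auto
    finally have "(\<Prod>i\<in>A. \<bar>p i\<bar> ^ \<kappa> i) * exp (- Q p / 4) * exp (- Q p / 4) \<le> C * exp (- Q p / 4)"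
      by (intro mult_right_mono) auto
    moreover have "exp (- Q p / 2) = exp (- Q p / 4) * exp (- Q p / 4)" by (simp flip: exp_add)
    ultimately show "ennreal ((\<Prod>i\<in>A. \<bar>p i\<bar> ^ \<kappa> i) * exp (- Q p / 2)) \<le> ennreal C * ennreal (exp (- (\<Sum>i\<in>A. \<Sum>j\<in>A. (a i j / 4) * p i * p j)))"
      unfolding Q4 using C by (simp add: mult.assoc ennreal_leI flip: ennreal_mult)
  qed
  also have "\<dots> = ennreal C * (\<integral>\<^sup>+p. ennreal (exp (- (\<Sum>i\<in>A. \<Sum>j\<in>A. (a i j / 4) * p i * p j))) \<partial>Pi\<^sub>M A (\<lambda>_. lborel))"
    using A by (intro nn_integral_cmult) measurable
  also have "\<dots> \<le> ennreal C * ennreal (\<Prod>i\<in>A. sqrt (pi / (m i / 4)))"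
  proof (intro mult_left_mono gaussian_integral_le A)
    fix p :: "'i \<Rightarrow> real" and i assume "i \<in> A"
    then show "m i / 4 * (p i)\<^sup>2 \<le> (\<Sum>i\<in>A. \<Sum>j\<in>A. (a i j / 4) * p i * p j)"
      unfolding Q4 using lb[of i p] by (simp add: Q_def)
  qed (use sym pos in auto)
  also have "\<dots> = ennreal (C * (\<Prod>i\<in>A. sqrt (pi / (m i / 4))))"
    using C pos by (intro ennreal_mult[symmetric] prod_nonneg) (auto simp: less_imp_le)
  also have "C * (\<Prod>i\<in>A. sqrt (pi / (m i / 4))) = (\<Prod>i\<in>A. moment_const (\<kappa> i) * sqrt (4 * n / m i) ^ \<kappa> i * sqrt (4 * pi / m i))"
    unfolding C_def by (simp add: prod.distrib[symmetric] mult_ac)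
  finally show ?thesis unfolding Q_def n_def by simp
qed

section \<open>Integrals of products of spacings\<close>

text \<open>The value \<open>\<infinity>\<close> at 0, where \<open>powr\<close> would give 0, makes the moment bound trivially true at
  coinciding times; the truncation at 1 makes the weight of a point at most the product of the
  weights of its distances to the left and to the right neighbour.\<close>

definition wt :: "real \<Rightarrow> real \<Rightarrow> ennreal" where
  "wt a x = (if x = 0 then \<infinity> else ennreal (max 1 (\<bar>x\<bar> powr (-a))))"

lemma wt_measurable[measurable]: "wt a \<in> borel_measurable borel"
  unfolding wt_def by measurable

lemma wt_ge_1: "1 \<le> wt a x"
  unfolding wt_def by auto

lemma wt_antimono: "0 \<le> a \<Longrightarrow> \<bar>x\<bar> \<le> \<bar>y\<bar> \<Longrightarrow> wt a y \<le> wt a x"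
  unfolding wt_def by (auto intro!: ennreal_leI max.coboundedI2 powr_mono2')

lemma wt_square: "(wt a x)\<^sup>2 = wt (2*a) x"
proof (cases "x = 0")
  case False
  have "(max 1 (\<bar>x\<bar> powr (-a)))\<^sup>2 = max 1 (\<bar>x\<bar> powr (-(2*a)))"
  proof -
    have e: "\<bar>x\<bar> powr (-(2*a)) = (\<bar>x\<bar> powr (-a))\<^sup>2"
      unfolding power2_eq_square by (simp flip: powr_add)
    show ?thesis unfolding e
      by (auto simp: max_def power2_eq_square) (smt (verit) mult_le_cancel_left1 mult_left_le powr_ge_zero)+
  qed
  then show ?thesis using False by (simp add: wt_def ennreal_power)
qed (simp add: wt_def power2_eq_square)

lemma wt_integral_le:
  assumes "0 \<le> a" "a < 1"
  shows "(\<integral>\<^sup>+x. indicator {0..} x * (wt a x * ennreal (exp (-x))) \<partial>lborel) \<le> ennreal (1 + Gamma (1 - a))"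
proof -
  \<comment> \<open>The infinite value at 0 is discarded with a null set; elsewhere the maximum is
    at most the sum, which gives two Gamma integrals.\<close>
  have "(\<integral>\<^sup>+x. indicator {0..} x * (wt a x * ennreal (exp (-x))) \<partial>lborel)
     \<le> (\<integral>\<^sup>+x. ennreal (indicator {0..} x * x powr (1 - 1) / exp x) + ennreal (indicator {0..} x * x powr ((1-a) - 1) / exp x) \<partial>lborel)"
  proof (rule nn_integral_mono_AE, rule AE_mp[OF AE_lborel_singleton[of 0]], intro AE_I2 impI)
    fix x :: real assume x: "x \<noteq> 0"
    have "max 1 (x powr (-a)) * exp (-x) \<le> (1 + x powr (-a)) * exp (-x)"
      by (intro mult_right_mono) auto
    then show "indicator {0..} x * (wt a x * ennreal (exp (-x)))
       \<le> ennreal (indicator {0..} x * x powr (1 - 1) / exp x) + ennreal (indicator {0..} x * x powr ((1-a) - 1) / exp x)"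
      using x by (auto simp: wt_def indicator_def exp_minus field_simps simp flip: ennreal_plus ennreal_mult intro!: ennreal_leI)
  qed
  also have "\<dots> = ennreal (Gamma 1) + ennreal (Gamma (1 - a))"
    using Gamma_conv_nn_integral_real[of 1] Gamma_conv_nn_integral_real[of "1 - a"] assms
    by (subst nn_integral_add) (auto intro!: Gamma_real_nonneg)
  also have "\<dots> = ennreal (1 + Gamma (1 - a))"
    using Gamma_real_pos[of "1 - a"] assms by simp
  finally show ?thesis .
qed

text \<open>The map v will be \<open>\<lambda>x. x\<close> or \<open>\<lambda>x. 1 - x\<close>, so
  that "before" means left or right; since \<open>wt\<close> decreases with the distance, the
  supremum selects the nearest point on that side. The index i itself contributes 1, the value when
  there is no such point. With N the number of points, distances are measured in units of the mean
  spacing.\<close>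

definition side_wt :: "real \<Rightarrow> real \<Rightarrow> (real \<Rightarrow> real) \<Rightarrow> 'i set \<Rightarrow> ('i \<Rightarrow> real) \<Rightarrow> 'i \<Rightarrow> ennreal" where
  "side_wt a N v I u i = (SUP l\<in>I. if l \<noteq> i \<and> v (u l) \<le> v (u i) then wt a (N * (u i - u l)) else 1)"

text \<open>For nonnegative positions this is the exponential decay at the last point. The bound by
  1 covers the empty index set, which then behaves as if its last point were at 0.\<close>

definition top_decay :: "real \<Rightarrow> (real \<Rightarrow> real) \<Rightarrow> 'i set \<Rightarrow> ('i \<Rightarrow> real) \<Rightarrow> ennreal" where
  "top_decay N v I u = inf 1 (INF i\<in>I. ennreal (exp (- (N * v (u i)))))"

lemma side_wt_measurable[measurable]:
  assumes [measurable]: "v \<in> borel_measurable borel" and "finite I" "i \<in> I"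
  shows "(\<lambda>u. side_wt a N v I u i) \<in> borel_measurable (Pi\<^sub>M I (\<lambda>_. lborel))"
proof -
  have [measurable]: "(\<lambda>u. v (u l)) \<in> borel_measurable (Pi\<^sub>M I (\<lambda>_. borel))" if "l \<in> I" for l
    using that by (intro measurable_compose[OF measurable_component_singleton]) auto
  have [measurable]: "Measurable.pred (Pi\<^sub>M I (\<lambda>_. borel)) (\<lambda>u. v (u l) \<le> v (u i))" if "l \<in> I" for l
    unfolding pred_def using that assms(3) by (intro borel_measurable_le) auto
  show ?thesis
    unfolding side_wt_def using assms(2,3)
    by (intro borel_measurable_SUP countable_finite) measurable
qed

lemma top_decay_measurable[measurable]:
  assumes [measurable]: "v \<in> borel_measurable borel" and "finite I"
  shows "top_decay N v I \<in> borel_measurable (Pi\<^sub>M I (\<lambda>_. lborel))"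
proof -
  have [measurable]: "(\<lambda>u. v (u l)) \<in> borel_measurable (Pi\<^sub>M I (\<lambda>_. lborel))" if "l \<in> I" for l
    using that by (intro measurable_compose[OF measurable_component_singleton]) auto
  show ?thesis
    unfolding top_decay_def[abs_def] using assms(2)
    by (intro borel_measurable_inf borel_measurable_INF countable_finite) measurable
qed

text \<open>Shifting by t and scaling by N leaves the integral of \<open>wt_integral_le\<close>; the
  shift releases exactly the decay factor at t, which serves as the decay for the remaining points.
  An affine v of slope 1 or -1 preserves Lebesgue measure, so both directions are treated at
  once.\<close>

lemma last_point_integral:
  fixes v :: "real \<Rightarrow> real"
  assumes a: "0 \<le> a" "a < 1" and N: "N > 0" and v: "v = (\<lambda>x. c + s * x)" "\<bar>s\<bar> = 1"
  shows "(\<integral>\<^sup>+y. indicator {t..} (v y) * (wt a (N * (v y - t)) * ennreal (exp (- (N * v y)))) \<partial>lborel)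
    \<le> ennreal ((1 + Gamma (1 - a)) / N) * ennreal (exp (-(N*t)))"
proof -
  have s: "s \<noteq> 0" using v by auto
  have "(\<integral>\<^sup>+y. indicator {t..} (v y) * (wt a (N * (v y - t)) * ennreal (exp (- (N * v y)))) \<partial>lborel)
     = (\<integral>\<^sup>+z. indicator {t..} z * (wt a (N * (z - t)) * ennreal (exp (- (N * z)))) \<partial>lborel)"
    unfolding v(1) by (subst (2) nn_integral_real_affine[OF _ s, of _ c]) (auto simp: v(2))
  also have "\<dots> = ennreal \<bar>1/N\<bar> * (\<integral>\<^sup>+x. indicator {t..} (t + 1/N * x) * (wt a (N * (t + 1/N * x - t)) * ennreal (exp (- (N * (t + 1/N * x))))) \<partial>lborel)"
    using N by (intro nn_integral_real_affine) auto
  also have "\<dots> = ennreal (1/N) * (\<integral>\<^sup>+x. ennreal (exp (-(N*t))) * (indicator {0..} x * (wt a x * ennreal (exp (-x)))) \<partial>lborel)"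
  proof (rule arg_cong2[where f = "(*)"], use N in simp, rule nn_integral_cong)
    fix x :: real
    have 1: "N * (t + 1/N * x - t) = x" using N by simp
    have 2: "- (N * (t + 1/N * x)) = -(N*t) + -x" using N by (simp add: algebra_simps)
    have 3: "indicator {t..} (t + 1/N * x) = (indicator {0..} x :: ennreal)"
      using N by (auto simp: indicator_def zero_le_divide_iff)
    show "indicator {t..} (t + 1/N * x) * (wt a (N * (t + 1/N * x - t)) * ennreal (exp (- (N * (t + 1/N * x)))))
      = ennreal (exp (-(N*t))) * (indicator {0..} x * (wt a x * ennreal (exp (-x))))"
      unfolding 1 2 3 exp_add by (simp add: ennreal_mult mult_ac)
  qed
  also have "\<dots> = ennreal (1/N) * (ennreal (exp (-(N*t))) * (\<integral>\<^sup>+x. (indicator {0..} x * (wt a x * ennreal (exp (-x)))) \<partial>lborel))"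
    by (subst nn_integral_cmult) auto
  also have "\<dots> \<le> ennreal (1/N) * (ennreal (exp (-(N*t))) * ennreal (1 + Gamma (1 - a)))"
    by (intro mult_left_mono wt_integral_le a) auto
  also have "\<dots> = ennreal ((1 + Gamma (1 - a)) / N) * ennreal (exp (-(N*t)))"
  proof -
    define G where "G = 1 + Gamma (1 - a)"
    have "G \<ge> 0" using Gamma_real_pos[of "1 - a"] a by (simp add: G_def)
    then show ?thesis using N unfolding G_def[symmetric] by (simp add: mult_ac flip: ennreal_mult)
  qed
  finally show ?thesis .
qed

definition ordered_integrand :: "real \<Rightarrow> real \<Rightarrow> (real \<Rightarrow> real) \<Rightarrow> 'i set \<Rightarrow> ('i \<Rightarrow> real) \<Rightarrow> ennreal" where
  "ordered_integrand a N v I u = (\<Prod>i\<in>I. indicator {0..} (v (u i)) * side_wt a N v I u i) * top_decay N v I u"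

lemma ordered_integrand_measurable[measurable]:
  assumes [measurable]: "v \<in> borel_measurable borel" and [simp]: "finite I"
  shows "ordered_integrand a N v I \<in> borel_measurable (Pi\<^sub>M I (\<lambda>_. lborel))"
  unfolding ordered_integrand_def[abs_def] by measurable

text \<open>Integrating out the last point gives a constant factor, and there are \<open>card I\<close> choices for
  the index of the last point.\<close>

lemma ordered_integral_le:
  fixes v :: "real \<Rightarrow> real"
  assumes a: "0 \<le> a" "a < 1" and N: "N > 0" and v: "v = (\<lambda>x. c + s * x)" "\<bar>s\<bar> = 1"
  shows "finite I \<Longrightarrow> card I = n \<Longrightarrow> (\<integral>\<^sup>+u. ordered_integrand a N v I u \<partial>Pi\<^sub>M I (\<lambda>_. lborel))
     \<le> ennreal (fact n * ((1 + Gamma (1 - a)) / N)^n)"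
proof (induction n arbitrary: I)
  case 0
  interpret product_sigma_finite "\<lambda>_. lborel :: real measure" by standard
  have "I = {}" using 0 by simp
  then show ?case by (simp add: ordered_integrand_def top_decay_def space_PiM_empty)
next
  case (Suc n)
  interpret product_sigma_finite "\<lambda>_. lborel :: real measure" by standard
  have vm[measurable]: "v \<in> borel_measurable borel" unfolding v(1) by measurable
  have finI[simp]: "finite I" by fact
  define K where "K = (1 + Gamma (1 - a)) / N"
  have K: "K \<ge> 0" using N Gamma_real_pos[of "1 - a"] a by (simp add: K_def)
  have dist: "\<bar>x - y\<bar> = \<bar>v x - v y\<bar>" for x y
  proof -
    have "v x - v y = s * (x - y)" by (simp add: v(1) algebra_simps)
    then show ?thesis using v(2) by (simp add: abs_mult)
  qed
  \<comment> \<open>The part of the integrand where \<open>u i\<close> is a last point. Some index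
    attains the maximum, so these parts together dominate the whole.\<close>
  define T where "T i u = ordered_integrand a N v I u * (\<Prod>l\<in>I. indicator {0..} (v (u i) - v (u l)))" for i u
  have T_m[measurable]: "T i \<in> borel_measurable (Pi\<^sub>M I (\<lambda>_. lborel))" if "i \<in> I" for i
    unfolding T_def[abs_def] using that by measurable
  have le: "ordered_integrand a N v I u \<le> (\<Sum>i\<in>I. T i u)" for u
  proof -
    have "finite ((\<lambda>i. v (u i)) ` I)" "(\<lambda>i. v (u i)) ` I \<noteq> {}" using Suc.prems by auto
    from Max_in[OF this] obtain i where i: "i \<in> I" "v (u i) = Max ((\<lambda>i. v (u i)) ` I)" by auto
    have "v (u l) \<le> v (u i)" if "l \<in> I" for l
      unfolding i(2) using that by (intro Max_ge) auto
    then have "T i u = ordered_integrand a N v I u"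
      unfolding T_def by (simp add: indicator_def)
    moreover have "T i u \<le> (\<Sum>i\<in>I. T i u)"
      using i by (intro member_le_sum) auto
    ultimately show ?thesis by simp
  qed
  have Ti: "(\<integral>\<^sup>+u. T i u \<partial>Pi\<^sub>M I (\<lambda>_. lborel)) \<le> ennreal (fact n * K^n) * ennreal K" if i: "i \<in> I" for i
  proof -
    define J where "J = I - {i}"
    have J: "I = insert i J" "i \<notin> J" "finite J" "card J = n"
      using i Suc.prems by (auto simp: J_def)
    have "(\<integral>\<^sup>+u. T i u \<partial>Pi\<^sub>M I (\<lambda>_. lborel)) = (\<integral>\<^sup>+x. (\<integral>\<^sup>+y. T i (x(i:=y)) \<partial>lborel) \<partial>Pi\<^sub>M J (\<lambda>_. lborel))"
      unfolding J(1) by (intro product_nn_integral_insert J) (use T_m[OF i] in \<open>simp add: J(1)\<close>)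
    also have "\<dots> \<le> (\<integral>\<^sup>+x. ordered_integrand a N v J x * ennreal K \<partial>Pi\<^sub>M J (\<lambda>_. lborel))"
    proof (rule nn_integral_mono)
      fix x :: "'a \<Rightarrow> real"
      \<comment> \<open>The inserted 0 is the starting point when J is empty and ensures that the
        decay at t does not exceed 1.\<close>
      define t where "t = Max (insert 0 ((\<lambda>l. v (x l)) ` J))"
      have t: "0 \<le> t" "\<And>l. l \<in> J \<Longrightarrow> v (x l) \<le> t"
        unfolding t_def using J by (auto intro!: Max_ge)
      have td: "ennreal (exp (-(N*t))) \<le> top_decay N v J x"
        unfolding top_decay_def using t N by (auto intro!: INF_greatest)
      define g where "g y = indicator {t..} (v y) * (wt a (N * (v y - t)) * ennreal (exp (- (N * v y))))" for y
      define P where "P = (\<Prod>i\<in>J. indicator {0..} (v (x i)) * side_wt a N v J x i)"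
      have "(\<integral>\<^sup>+y. T i (x(i:=y)) \<partial>lborel) \<le> (\<integral>\<^sup>+y. P * g y \<partial>lborel)"
      proof (rule nn_integral_mono_AE)
        \<comment> \<open>Off this null set the last point lies strictly beyond the others, hence
          does not enter their side weights; these are then weights within J.\<close>
        have "AE y in lborel. \<forall>l\<in>J. y \<noteq> x l"
          using J by (subst AE_ball_countable) (auto intro: countable_finite AE_lborel_singleton)
        then show "AE y in lborel. T i (x(i:=y)) \<le> P * g y"
        proof (rule AE_mp, intro AE_I2 impI)
          fix y assume ne: "\<forall>l\<in>J. y \<noteq> x l"
          let ?u = "x(i:=y)"
          show "T i ?u \<le> P * g y"
          proof (cases "v y \<ge> 0 \<and> (\<forall>l\<in>J. v (x l) \<le> v y)")
            case False
            then consider "\<not> v y \<ge> 0" | "\<exists>l\<in>J. v y < v (x l)" by force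
            then have "T i ?u = 0"
            proof cases
              assume "\<not> v y \<ge> 0"
              then have "(\<Prod>l\<in>I. indicator {0..} (v (?u l)) * side_wt a N v I ?u l) = 0"
                using i by (intro prod_zero finI bexI[of _ i]) auto
              then show ?thesis by (simp add: T_def ordered_integrand_def)
            next
              assume "\<exists>l\<in>J. v y < v (x l)"
              then obtain l where l: "l \<in> J" "v y < v (x l)" by auto
              then have "(\<Prod>l\<in>I. indicator {0..} (v (?u i) - v (?u l)) :: ennreal) = 0"
                using J by (intro prod_zero finI bexI[of _ l]) auto
              then show ?thesis by (simp add: T_def)
            qed
            then show ?thesis by simp
          next
            case True
            then have y: "v y \<ge> 0" "\<And>l. l \<in> J \<Longrightarrow> v (x l) \<le> v y" by auto
            have yt: "t \<le> v y" unfolding t_def using J y by auto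
            have "T i ?u \<le> (\<Prod>l\<in>I. indicator {0..} (v (?u l)) * side_wt a N v I ?u l) * top_decay N v I ?u * 1"
              unfolding T_def ordered_integrand_def
              by (intro mult_left_mono prod_le_1) (auto simp: indicator_def)
            also have "(\<Prod>l\<in>I. indicator {0..} (v (?u l)) * side_wt a N v I ?u l)
               = (indicator {0..} (v y) * side_wt a N v I ?u i) * (\<Prod>l\<in>J. indicator {0..} (v (?u l)) * side_wt a N v I ?u l)"
              unfolding J(1) using J(2,3) by simp
            also have "\<dots> * top_decay N v I ?u * 1 \<le> (indicator {t..} (v y) * wt a (N * (v y - t))) * P * ennreal (exp (- (N * v y))) * 1"
            proof (intro mult_mono)
              show "indicator {0..} (v y) \<le> (indicator {t..} (v y) :: ennreal)" using yt y(1) by simp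
              show "side_wt a N v I ?u i \<le> wt a (N * (v y - t))"
                unfolding side_wt_def
              proof (rule SUP_least)
                fix l assume "l \<in> I"
                then have l: "l = i \<or> l \<in> J" using J by auto
                have "wt a (N * (y - x l)) \<le> wt a (N * (v y - t))" if "l \<in> J"
                  using that t(2)[OF that] yt N dist[of y "x l"] a
                  by (intro wt_antimono) (auto simp: abs_mult)
                then show "(if l \<noteq> i \<and> v (?u l) \<le> v (?u i) then wt a (N * (?u i - ?u l)) else 1) \<le> wt a (N * (v y - t))"
                  using l wt_ge_1 by auto
              qed
              show "(\<Prod>l\<in>J. indicator {0..} (v (?u l)) * side_wt a N v I ?u l) \<le> P"
                unfolding P_def
              proof (intro prod_mono_ennreal mult_mono)
                fix l assume l: "l \<in> J"
                then have li: "l \<noteq> i" using J by auto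
                show "indicator {0..} (v (?u l)) \<le> (indicator {0..} (v (x l)) :: ennreal)" using li by simp
                have vl: "v (x l) < v y"
                  using y(2)[OF l] ne l dist[of y "x l"] by (cases "v (x l) = v y") auto
                show "side_wt a N v I ?u l \<le> side_wt a N v J x l"
                  unfolding side_wt_def
                proof (rule SUP_least)
                  fix j assume "j \<in> I"
                  then consider "j = i" | "j \<in> J" "j \<noteq> i" using J by auto
                  then show "(if j \<noteq> l \<and> v (?u j) \<le> v (?u l) then wt a (N * (?u l - ?u j)) else 1) \<le> (SUP j\<in>J. if j \<noteq> l \<and> v (x j) \<le> v (x l) then wt a (N * (x l - x j)) else 1)"
                  proof cases
                    case 1
                    have "1 \<le> (SUP j\<in>J. if j \<noteq> l \<and> v (x j) \<le> v (x l) then wt a (N * (x l - x j)) else 1)"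
                      using l by (intro SUP_upper2[of l]) auto
                    then show ?thesis using 1 li vl by auto
                  next
                    case 2
                    then show ?thesis using li by (intro SUP_upper2[of j]) auto
                  qed
                qed
              qed auto
              show "top_decay N v I ?u \<le> ennreal (exp (- (N * v y)))"
                unfolding top_decay_def using i by (intro le_infI2 INF_lower2[of i]) auto
            qed auto
            also have "\<dots> = P * g y" unfolding g_def by (simp add: mult_ac)
            finally show ?thesis .
          qed
        qed
      qed
      also have "\<dots> = P * (\<integral>\<^sup>+y. g y \<partial>lborel)"
        unfolding g_def by (intro nn_integral_cmult) measurable
      also have "\<dots> \<le> P * (ennreal K * ennreal (exp (-(N*t))))"
        unfolding g_def K_def using last_point_integral[OF a N v] by (intro mult_left_mono) auto
      also have "\<dots> \<le> P * (ennreal K * top_decay N v J x)"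
        by (intro mult_left_mono td) auto
      also have "\<dots> = ordered_integrand a N v J x * ennreal K"
        unfolding ordered_integrand_def P_def by (simp add: mult_ac)
      finally show "(\<integral>\<^sup>+y. T i (x(i:=y)) \<partial>lborel) \<le> ordered_integrand a N v J x * ennreal K" .
    qed
    also have "\<dots> = (\<integral>\<^sup>+x. ordered_integrand a N v J x \<partial>Pi\<^sub>M J (\<lambda>_. lborel)) * ennreal K"
      using J by (intro nn_integral_multc) measurable
    also have "\<dots> \<le> ennreal (fact n * K^n) * ennreal K"
      using Suc.IH[OF J(3,4)] unfolding K_def by (rule mult_right_mono) auto
    finally show ?thesis .
  qed
  have "(\<integral>\<^sup>+u. ordered_integrand a N v I u \<partial>Pi\<^sub>M I (\<lambda>_. lborel)) \<le> (\<integral>\<^sup>+u. (\<Sum>i\<in>I. T i u) \<partial>Pi\<^sub>M I (\<lambda>_. lborel))"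
    by (intro nn_integral_mono le)
  also have "\<dots> = (\<Sum>i\<in>I. \<integral>\<^sup>+u. T i u \<partial>Pi\<^sub>M I (\<lambda>_. lborel))"
    by (intro nn_integral_sum) auto
  also have "\<dots> \<le> (\<Sum>i\<in>I. ennreal (fact n * K^n) * ennreal K)"
    by (intro sum_mono Ti)
  also have "\<dots> = ennreal (fact (Suc n) * K ^ Suc n)"
    using Suc.prems K by (simp add: ennreal_of_nat_eq_real_of_nat mult_ac flip: ennreal_mult del: of_nat_Suc)
  finally show ?case unfolding K_def .
qed

section \<open>Two-sided spacings and their integral over the cube\<close>

definition spacing_wt :: "real \<Rightarrow> real \<Rightarrow> 'i set \<Rightarrow> ('i \<Rightarrow> real) \<Rightarrow> 'i \<Rightarrow> ennreal" where
  "spacing_wt a N I u i = (SUP l\<in>I. if l \<noteq> i then wt a (N * (u i - u l)) else 1)"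

text \<open>The supremum is attained at some l, and \<open>u l\<close> lies on one side of
  \<open>u i\<close>. The weight of that side dominates the square, and the weight of the other side
  is at least 1.\<close>

lemma spacing_wt_square_le:
  assumes "finite I" "i \<in> I"
  shows "(spacing_wt a N I u i)\<^sup>2 \<le> side_wt (2*a) N (\<lambda>x. x) I u i * side_wt (2*a) N (\<lambda>x. 1 - x) I u i"
proof -
  let ?f = "\<lambda>l. if l \<noteq> i then wt a (N * (u i - u l)) else 1"
  have "Max (?f ` I) \<in> ?f ` I" "Max (?f ` I) = Sup (?f ` I)"
    using assms by (intro Max_in Max_Sup; auto)+
  then obtain l where l: "l \<in> I" "spacing_wt a N I u i = ?f l"
    unfolding spacing_wt_def by auto
  have ge1: "1 \<le> side_wt b N v I u i" for b v
    unfolding side_wt_def using assms by (intro SUP_upper2[of i]) auto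
  have le: "wt (2*a) (N * (u i - u l)) \<le> side_wt (2*a) N v I u i" if "l \<noteq> i" "v (u l) \<le> v (u i)" for v
    unfolding side_wt_def using that l by (intro SUP_upper2[of l]) auto
  let ?A = "side_wt (2*a) N (\<lambda>x. x) I u i" and ?B = "side_wt (2*a) N (\<lambda>x. 1 - x) I u i"
  consider "l = i" | "l \<noteq> i" "u l \<le> u i" | "l \<noteq> i" "u i \<le> u l" by linarith
  then show ?thesis
  proof cases
    case 1
    then show ?thesis using l mult_mono[OF ge1[of "2*a" "\<lambda>x. x"] ge1[of "2*a" "\<lambda>x. 1 - x"]] by simp
  next
    case 2
    then have "(spacing_wt a N I u i)\<^sup>2 = wt (2*a) (N * (u i - u l)) * 1" using l by (simp add: wt_square)
    also have "\<dots> \<le> ?A * ?B" using 2 by (intro mult_mono le ge1) auto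
    finally show ?thesis .
  next
    case 3
    then have "(spacing_wt a N I u i)\<^sup>2 = 1 * wt (2*a) (N * (u i - u l))" using l by (simp add: wt_square)
    also have "\<dots> \<le> ?A * ?B" using 3 by (intro mult_mono le ge1) auto
    finally show ?thesis .
  qed
qed

text \<open>A crude inequality of means. It turns the product of left and right weights into a sum
  whose terms look in one direction only, which is what integration in order can handle.\<close>

lemma ennreal_le_add_of_square_le_mult:
  assumes "(x::ennreal)\<^sup>2 \<le> a * b" shows "x \<le> a + b"
proof (rule ccontr)
  assume "\<not> x \<le> a + b"
  then have lt: "a + b < x" by simp
  then have fin: "a + b < \<infinity>" using top.not_eq_extremum by fastforce
  have "(a + b)\<^sup>2 < x\<^sup>2"
  proof (cases "x = \<infinity>")
    case True
    then show ?thesis using fin by (simp add: power2_eq_square ennreal_mult_less_top)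
  next
    case False
    then obtain x' y' where "x = ennreal x'" "0 \<le> x'" "a + b = ennreal y'" "0 \<le> y'"
      using fin by (metis ennreal_cases infinity_ennreal_def less_irrefl)
    then show ?thesis using lt by (simp add: ennreal_power ennreal_less_iff power_strict_mono)
  qed
  also have "\<dots> \<le> a * b" by (rule assms)
  also have "\<dots> \<le> (a + b) * (a + b)" by (intro mult_mono) auto
  finally show False by (simp add: power2_eq_square)
qed

text \<open>The squared integrand is at most the product of all left weights and all right weights,
  with exponent \<open>2 * g\<close> below 1. With N the number of points, the factor
  \<open>fact n\<close> counting the orders is absorbed by the \<open>N ^ n\<close> from scaling,
  and the artificial decay costs \<open>exp N\<close>, so the bound grows only exponentially in the
  number of points.\<close>

lemma spacing_integral_le:
  fixes I :: "'i set"
  assumes g: "0 \<le> g" "2 * g < 1" and I: "finite I" "I \<noteq> {}"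
  shows "(\<integral>\<^sup>+u. (\<Prod>i\<in>I. indicator {0..1} (u i) * spacing_wt g (real (card I)) I u i) \<partial>Pi\<^sub>M I (\<lambda>_. lborel))
    \<le> ennreal (2 * (exp 1 * (1 + Gamma (1 - 2*g))) ^ card I)"
proof -
  define n where "n = card I"
  define N where "N = real n"
  have n: "n \<ge> 1" "N > 0" using I by (auto simp: n_def N_def card_gt_0_iff Suc_le_eq)
  define K where "K = 1 + Gamma (1 - 2*g)"
  have K: "K \<ge> 0" using Gamma_real_pos[of "1 - 2*g"] g by (simp add: K_def)
  let ?O = "\<lambda>v. ordered_integrand (2*g) N v I"
  have pt: "(\<Prod>i\<in>I. indicator {0..1} (u i) * spacing_wt g N I u i)
     \<le> ennreal (exp N) * (?O (\<lambda>x. x) u + ?O (\<lambda>x. 1 - x) u)" for u :: "'i \<Rightarrow> real"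
  proof (cases "\<forall>i\<in>I. u i \<in> {0..1}")
    case False
    then obtain i where "i \<in> I" "u i \<notin> {0..1}" by auto
    then have "(\<Prod>i\<in>I. indicator {0..1} (u i) * spacing_wt g N I u i) = 0"
      using I by (intro prod_zero bexI[of _ i]) auto
    then show ?thesis by (simp only: zero_le)
  next
    case True
    define A where "A v = (\<Prod>i\<in>I. side_wt (2*g) N v I u i)" for v
    have "(\<Prod>i\<in>I. indicator {0..1} (u i) * spacing_wt g N I u i) = (\<Prod>i\<in>I. spacing_wt g N I u i)"
      using True by (intro prod.cong) auto
    also have "\<dots> \<le> A (\<lambda>x. x) + A (\<lambda>x. 1 - x)"
    proof (rule ennreal_le_add_of_square_le_mult)
      have "(\<Prod>i\<in>I. spacing_wt g N I u i)\<^sup>2 = (\<Prod>i\<in>I. (spacing_wt g N I u i)\<^sup>2)"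
        by (rule prod_power_distrib)
      also have "\<dots> \<le> (\<Prod>i\<in>I. side_wt (2*g) N (\<lambda>x. x) I u i * side_wt (2*g) N (\<lambda>x. 1 - x) I u i)"
        by (intro prod_mono_ennreal spacing_wt_square_le I)
      finally show "(\<Prod>i\<in>I. spacing_wt g N I u i)\<^sup>2 \<le> A (\<lambda>x. x) * A (\<lambda>x. 1 - x)"
        by (simp add: A_def prod.distrib)
    qed
    also have "A (\<lambda>x. x) + A (\<lambda>x. 1 - x) \<le> ennreal (exp N) * ?O (\<lambda>x. x) u + ennreal (exp N) * ?O (\<lambda>x. 1 - x) u"
    proof (rule add_mono)
      have *: "A v \<le> ennreal (exp N) * ?O v u" if v: "\<And>i. i \<in> I \<Longrightarrow> 0 \<le> v (u i) \<and> v (u i) \<le> 1" for v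
      proof -
        \<comment> \<open>Positions are at most 1, so inserting the decay costs no more than
          \<open>exp N\<close>.\<close>
        have "ennreal (exp (-N)) \<le> top_decay N v I u"
          unfolding top_decay_def using v n by (auto intro!: INF_greatest)
        then have "ennreal (exp N) * ennreal (exp (-N)) \<le> ennreal (exp N) * top_decay N v I u"
          by (intro mult_left_mono) auto
        then have "1 \<le> ennreal (exp N) * top_decay N v I u"
          by (simp flip: ennreal_mult exp_add)
        then have "A v * 1 \<le> A v * (ennreal (exp N) * top_decay N v I u)"
          by (intro mult_left_mono) auto
        moreover have "(\<Prod>i\<in>I. indicator {0..} (v (u i)) * side_wt (2*g) N v I u i) = A v"
          unfolding A_def using v by (intro prod.cong) auto
        ultimately show ?thesis unfolding ordered_integrand_def by (simp add: mult_ac)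
      qed
      show "A (\<lambda>x. x) \<le> ennreal (exp N) * ?O (\<lambda>x. x) u" "A (\<lambda>x. 1 - x) \<le> ennreal (exp N) * ?O (\<lambda>x. 1 - x) u"
        using True by (intro *; auto)+
    qed
    finally show ?thesis by (simp add: distrib_left)
  qed
  have "(\<integral>\<^sup>+u. (\<Prod>i\<in>I. indicator {0..1} (u i) * spacing_wt g N I u i) \<partial>Pi\<^sub>M I (\<lambda>_. lborel))
    \<le> (\<integral>\<^sup>+u. ennreal (exp N) * (?O (\<lambda>x. x) u + ?O (\<lambda>x. 1 - x) u) \<partial>Pi\<^sub>M I (\<lambda>_. lborel))"
    by (intro nn_integral_mono pt)
  also have "\<dots> = ennreal (exp N) * ((\<integral>\<^sup>+u. ?O (\<lambda>x. x) u \<partial>Pi\<^sub>M I (\<lambda>_. lborel)) + (\<integral>\<^sup>+u. ?O (\<lambda>x. 1 - x) u \<partial>Pi\<^sub>M I (\<lambda>_. lborel)))"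
    using I by (subst nn_integral_cmult, measurable, subst nn_integral_add) measurable
  also have "\<dots> \<le> ennreal (exp N) * (ennreal (fact n * (K / N)^n) + ennreal (fact n * (K / N)^n))"
  proof (intro mult_left_mono add_mono)
    show "(\<integral>\<^sup>+u. ?O (\<lambda>x. x) u \<partial>Pi\<^sub>M I (\<lambda>_. lborel)) \<le> ennreal (fact n * (K / N)^n)"
      unfolding K_def using g n I by (intro ordered_integral_le[where c = 0 and s = 1]) (auto simp: n_def)
    show "(\<integral>\<^sup>+u. ?O (\<lambda>x. 1 - x) u \<partial>Pi\<^sub>M I (\<lambda>_. lborel)) \<le> ennreal (fact n * (K / N)^n)"
      unfolding K_def using g n I by (intro ordered_integral_le[where c = 1 and s = "-1"]) (auto simp: n_def)
  qed auto
  also have "\<dots> = ennreal (exp N * (2 * (fact n * (K / N)^n)))"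
    using K n by (simp flip: ennreal_plus ennreal_mult)
  also have "\<dots> \<le> ennreal (2 * (exp 1 * K) ^ n)"
  proof (rule ennreal_leI)
    have "fact n * (K / N)^n \<le> N ^ n * (K / N)^n"
      using fact_le_power[of n, where 'a=real] K n unfolding N_def by (intro mult_right_mono) auto
    also have "\<dots> = K ^ n" using n by (simp add: power_divide)
    finally have "exp N * (2 * (fact n * (K / N)^n)) \<le> exp N * (2 * K ^ n)" by simp
    moreover have "exp N = exp 1 ^ n" unfolding N_def by (simp flip: exp_of_nat_mult)
    ultimately show "exp N * (2 * (fact n * (K / N)^n)) \<le> 2 * (exp 1 * K) ^ n"
      by (simp add: power_mult_distrib)
  qed
  finally show ?thesis unfolding N_def n_def K_def .
qed

section \<open>Fourier representation of the heat kernel derivatives\<close>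

definition gauss_deriv :: "real \<Rightarrow> nat \<Rightarrow> real \<Rightarrow> real" where
  "gauss_deriv \<epsilon> m = (deriv ^^ m) (\<lambda>x. exp (- x\<^sup>2 / (2*\<epsilon>)) / sqrt (2 * pi * \<epsilon>))"

text \<open>Normalised as the inverse Fourier transform of
  \<open>exp (- \<epsilon> * p\<^sup>2 / 2)\<close>; each derivative in x brings down a factor
  \<open>\<i> * p\<close>.\<close>

definition fourier_integrand :: "real \<Rightarrow> nat \<Rightarrow> real \<Rightarrow> real \<Rightarrow> complex" where
  "fourier_integrand \<epsilon> m x p = (\<i> * p) ^ m * iexp (p * x) * exp (- \<epsilon> * p\<^sup>2 / 2) / (2 * pi)"

definition fourier_int :: "real \<Rightarrow> nat \<Rightarrow> real \<Rightarrow> complex" where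
  "fourier_int \<epsilon> m x = (\<integral>p. fourier_integrand \<epsilon> m x p \<partial>lborel)"

lemma fourier_integrand_measurable[measurable]:
  "(\<lambda>z. fourier_integrand \<epsilon> m (f z) (h z)) \<in> borel_measurable M"
  if [measurable]: "f \<in> borel_measurable M" "h \<in> borel_measurable M"
proof -
  have "(\<lambda>z. exp (\<i> * complex_of_real z)) \<in> borel_measurable borel"
    by (intro borel_measurable_continuous_onI continuous_intros)
  from measurable_compose[OF _ this]
  have [measurable]: "(\<lambda>z. iexp (h z * f z)) \<in> borel_measurable M" by measurable
  show ?thesis unfolding fourier_integrand_def by measurable
qed

lemma norm_fourier_integrand:
  "norm (fourier_integrand \<epsilon> m x p) = \<bar>p\<bar> ^ m * exp (- \<epsilon> * p\<^sup>2 / 2) / (2 * pi)"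
  unfolding fourier_integrand_def by (simp add: norm_mult norm_power norm_divide)

lemma integrable_moment_gauss:
  assumes "\<epsilon> > 0"
  shows "integrable lborel (\<lambda>p::real. \<bar>p\<bar> ^ m * exp (- \<epsilon> * p\<^sup>2 / 2) / (2 * pi))"
proof -
  define s where "s = 1 / sqrt \<epsilon>"
  have s: "s > 0" "s\<^sup>2 = 1 / \<epsilon>" using assms by (auto simp: s_def power_divide)
  have "integrable lborel (\<lambda>p. (sqrt (2 * pi * s\<^sup>2) / (2 * pi)) * (normal_density 0 s p * \<bar>p - 0\<bar> ^ m))"
    by (intro integrable_mult_right integrable_normal_moment_abs s)
  moreover have "(sqrt (2 * pi * s\<^sup>2) / (2 * pi)) * (normal_density 0 s p * \<bar>p - 0\<bar> ^ m) = \<bar>p\<bar> ^ m * exp (- \<epsilon> * p\<^sup>2 / 2) / (2 * pi)" for p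
    using assms unfolding normal_density_def s(2) by (simp add: field_simps)
  ultimately show ?thesis by (simp only:)
qed

lemma integrable_fourier_integrand:
  assumes "\<epsilon> > 0"
  shows "integrable lborel (fourier_integrand \<epsilon> m x)"
  by (rule Bochner_Integration.integrable_bound[OF integrable_moment_gauss[OF assms, of m]])
     (auto simp: norm_fourier_integrand intro!: AE_I2)

lemma fourier_int_0:
  assumes "\<epsilon> > 0"
  shows "fourier_int \<epsilon> 0 x = complex_of_real (exp (- x\<^sup>2 / (2*\<epsilon>)) / sqrt (2 * pi * \<epsilon>))"
proof -
  define s where "s = 1 / sqrt \<epsilon>"
  have s: "s > 0" "s\<^sup>2 = 1 / \<epsilon>" using assms by (auto simp: s_def power_divide)
  have "fourier_int \<epsilon> 0 x = \<bar>s\<bar> *\<^sub>R (\<integral>q. fourier_integrand \<epsilon> 0 x (0 + s * q) \<partial>lborel)"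
    unfolding fourier_int_def using s by (intro lborel_integral_real_affine) auto
  also have "(\<integral>q. fourier_integrand \<epsilon> 0 x (0 + s * q) \<partial>lborel) = (\<integral>q. complex_of_real (1 / sqrt (2 * pi)) * (std_normal_density q *\<^sub>R iexp (s * x * q)) \<partial>lborel)"
  proof (intro Bochner_Integration.integral_cong refl)
    fix q
    have 1: "\<epsilon> * (s * q)\<^sup>2 = q\<^sup>2" using s assms by (simp add: power_mult_distrib)
    have 2: "1 / (2 * pi) = 1 / sqrt (2 * pi) * (1 / sqrt (2 * pi))" by simp
    have "fourier_integrand \<epsilon> 0 x (0 + s * q) = complex_of_real (1 / (2 * pi) * exp (- q\<^sup>2 / 2)) * iexp (s * x * q)"
      unfolding fourier_integrand_def using 1 by (simp add: mult_ac)
    also have "1 / (2 * pi) * exp (- q\<^sup>2 / 2) = 1 / sqrt (2 * pi) * std_normal_density q"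
      unfolding 2 std_normal_density_def by simp
    finally show "fourier_integrand \<epsilon> 0 x (0 + s * q) = complex_of_real (1 / sqrt (2 * pi)) * (std_normal_density q *\<^sub>R iexp (s * x * q))"
      by (simp add: scaleR_conv_of_real)
  qed
  also have "\<dots> = complex_of_real (1 / sqrt (2 * pi)) * (\<integral>q. std_normal_density q *\<^sub>R iexp (s * x * q) \<partial>lborel)"
    by (rule integral_mult_right_zero)
  also have "(\<integral>q. std_normal_density q *\<^sub>R iexp (s * x * q) \<partial>lborel) = char std_normal_distribution (s * x)"
    unfolding char_def by (subst integral_density) auto
  also have "\<dots> = complex_of_real (exp (- (s * x)\<^sup>2 / 2))"
    by (simp add: char_std_normal_distribution)
  also have "(s * x)\<^sup>2 = x\<^sup>2 / \<epsilon>" using s by (simp add: power_mult_distrib)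
  finally show ?thesis using s assms by (simp add: s_def scaleR_conv_of_real real_sqrt_mult mult_ac)
qed

text \<open>The first-order Taylor remainder of \<open>iexp (p * h)\<close> is at most
  \<open>(p * h)\<^sup>2\<close>, and the Gaussian factor makes the power m + 2 of p integrable. The
  error of the difference quotient is therefore at most \<open>\<bar>h\<bar> * M\<close>.\<close>

lemma fourier_int_has_vector_derivative:
  assumes e: "\<epsilon> > 0"
  shows "(fourier_int \<epsilon> m has_vector_derivative fourier_int \<epsilon> (Suc m) x) (at x)"
  unfolding has_vector_derivative_def has_derivative_at
proof (intro conjI)
  define M where "M = (\<integral>p. \<bar>p\<bar> ^ (m+2) * exp (- \<epsilon> * p\<^sup>2 / 2) / (2 * pi) \<partial>lborel)"
  show "bounded_linear (\<lambda>h. h *\<^sub>R fourier_int \<epsilon> (Suc m) x)" by (rule bounded_linear_scaleR_left)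
  have bnd: "norm (fourier_int \<epsilon> m (x + h) - fourier_int \<epsilon> m x - h *\<^sub>R fourier_int \<epsilon> (Suc m) x) \<le> h\<^sup>2 * M" for h
  proof -
    have e1: "fourier_int \<epsilon> m (x + h) - fourier_int \<epsilon> m x - h *\<^sub>R fourier_int \<epsilon> (Suc m) x
      = (\<integral>p. fourier_integrand \<epsilon> m (x + h) p - fourier_integrand \<epsilon> m x p - h *\<^sub>R fourier_integrand \<epsilon> (Suc m) x p \<partial>lborel)"
      unfolding fourier_int_def using integrable_fourier_integrand[OF e] by simp
    have e2: "norm (\<integral>p. fourier_integrand \<epsilon> m (x + h) p - fourier_integrand \<epsilon> m x p - h *\<^sub>R fourier_integrand \<epsilon> (Suc m) x p \<partial>lborel)
      \<le> (\<integral>p. h\<^sup>2 * (\<bar>p\<bar> ^ (m+2) * exp (- \<epsilon> * p\<^sup>2 / 2) / (2 * pi)) \<partial>lborel)"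
    proof (rule Bochner_Integration.integral_norm_bound_integral)
      show "integrable lborel (\<lambda>p. fourier_integrand \<epsilon> m (x + h) p - fourier_integrand \<epsilon> m x p - h *\<^sub>R fourier_integrand \<epsilon> (Suc m) x p)"
        using integrable_fourier_integrand[OF e] by (intro Bochner_Integration.integrable_diff integrable_scaleR_right) auto
      show "integrable lborel (\<lambda>p. h\<^sup>2 * (\<bar>p\<bar> ^ (m+2) * exp (- \<epsilon> * p\<^sup>2 / 2) / (2 * pi)))"
        by (intro integrable_mult_right integrable_moment_gauss e)
      fix p :: real
      have "fourier_integrand \<epsilon> m (x + h) p - fourier_integrand \<epsilon> m x p - h *\<^sub>R fourier_integrand \<epsilon> (Suc m) x p
        = fourier_integrand \<epsilon> m x p * (iexp (p * h) - (\<Sum>k \<le> 1. (\<i> * (p * h))^k / fact k))"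
        unfolding fourier_integrand_def by (simp add: scaleR_conv_of_real field_simps exp_add[symmetric])
      also have "norm \<dots> \<le> norm (fourier_integrand \<epsilon> m x p) * (\<bar>p * h\<bar> ^ Suc 1 / fact (Suc 1))"
        unfolding norm_mult by (intro mult_left_mono) (use iexp_approx1[of "p * h" 1] in simp_all)
      also have "\<dots> \<le> norm (fourier_integrand \<epsilon> m x p) * (\<bar>p\<bar>\<^sup>2 * h\<^sup>2)"
        using zero_le_square[of "p * h"]
        by (intro mult_left_mono) (simp_all add: power_mult_distrib power2_eq_square mult_ac)
      also have "\<dots> = h\<^sup>2 * (\<bar>p\<bar> ^ (m+2) * exp (- \<epsilon> * p\<^sup>2 / 2) / (2 * pi))"
        by (simp only: norm_fourier_integrand power_add mult_ac times_divide_eq_right times_divide_eq_left)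
      finally show "norm (fourier_integrand \<epsilon> m (x + h) p - fourier_integrand \<epsilon> m x p - h *\<^sub>R fourier_integrand \<epsilon> (Suc m) x p) \<le> \<dots>" .
    qed
    show ?thesis using e2 unfolding e1 M_def integral_mult_right_zero .
  qed
  show "(\<lambda>h. norm (fourier_int \<epsilon> m (x + h) - fourier_int \<epsilon> m x - h *\<^sub>R fourier_int \<epsilon> (Suc m) x) / norm h) \<midarrow>0\<rightarrow> 0"
  proof (rule tendsto_sandwich[of "\<lambda>_. 0" _ _ "\<lambda>h. \<bar>h\<bar> * M"])
    show "\<forall>\<^sub>F h in at 0. norm (fourier_int \<epsilon> m (x + h) - fourier_int \<epsilon> m x - h *\<^sub>R fourier_int \<epsilon> (Suc m) x) / norm h \<le> \<bar>h\<bar> * M"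
    proof (rule eventually_mono[OF eventually_neq_at_within[of 0]])
      fix h :: real assume h: "h \<noteq> 0"
      have "\<bar>h\<bar> * M * \<bar>h\<bar> = h\<^sup>2 * M"
        unfolding power2_abs[of h, symmetric] by (simp only: power2_eq_square mult_ac)
      then show "norm (fourier_int \<epsilon> m (x + h) - fourier_int \<epsilon> m x - h *\<^sub>R fourier_int \<epsilon> (Suc m) x) / norm h \<le> \<bar>h\<bar> * M"
        using bnd[of h] h by (simp only: real_norm_def divide_le_eq abs_not_less_zero zero_less_abs_iff if_True simp_thms)
    qed
    show "(\<lambda>h. \<bar>h\<bar> * M) \<midarrow>0\<rightarrow> 0" by (auto intro!: tendsto_eq_intros)
  qed auto
qed

lemma gauss_deriv_eq_fourier_int:
  assumes e: "\<epsilon> > 0"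
  shows "complex_of_real (gauss_deriv \<epsilon> m x) = fourier_int \<epsilon> m x"
    and "(gauss_deriv \<epsilon> m has_real_derivative gauss_deriv \<epsilon> (Suc m) x) (at x)"
proof -
  have step: "(gauss_deriv \<epsilon> m has_real_derivative Re (fourier_int \<epsilon> (Suc m) x)) (at x) \<and>
      complex_of_real (gauss_deriv \<epsilon> (Suc m) x) = fourier_int \<epsilon> (Suc m) x"
    if IH: "\<And>x. complex_of_real (gauss_deriv \<epsilon> m x) = fourier_int \<epsilon> m x" for m x
  proof -
    have vd: "((\<lambda>x. complex_of_real (gauss_deriv \<epsilon> m x)) has_vector_derivative fourier_int \<epsilon> (Suc m) x) (at x)"
      unfolding IH by (rule fourier_int_has_vector_derivative[OF e])
    have 1: "(gauss_deriv \<epsilon> m has_real_derivative Re (fourier_int \<epsilon> (Suc m) x)) (at x)"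
      using bounded_linear.has_vector_derivative[OF bounded_linear_Re vd]
      by (simp add: has_real_derivative_iff_has_vector_derivative)
    \<comment> \<open>By the induction hypothesis the Fourier integral at m is real on the whole
      line, so its derivative has imaginary part 0.\<close>
    have "((\<lambda>x. 0::real) has_vector_derivative Im (fourier_int \<epsilon> (Suc m) x)) (at x)"
      using bounded_linear.has_vector_derivative[OF bounded_linear_Im vd] by simp
    from vector_derivative_unique_at[OF this has_vector_derivative_const]
    have "Im (fourier_int \<epsilon> (Suc m) x) = 0" by simp
    moreover have "gauss_deriv \<epsilon> (Suc m) x = Re (fourier_int \<epsilon> (Suc m) x)"
      unfolding gauss_deriv_def using DERIV_imp_deriv[OF 1] by (simp add: gauss_deriv_def)
    ultimately show ?thesis using 1 by (simp add: complex_eq_iff)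
  qed
  have *: "\<forall>x. complex_of_real (gauss_deriv \<epsilon> m x) = fourier_int \<epsilon> m x" for m
  proof (induction m)
    case 0
    then show ?case using e by (simp add: gauss_deriv_def fourier_int_0)
  next
    case (Suc m)
    then show ?case using step by blast
  qed
  then show "complex_of_real (gauss_deriv \<epsilon> m x) = fourier_int \<epsilon> m x" by blast
  show "(gauss_deriv \<epsilon> m has_real_derivative gauss_deriv \<epsilon> (Suc m) x) (at x)"
    using step[of m x] * by (metis Re_complex_of_real)
qed

lemma gauss_deriv_continuous: "\<epsilon> > 0 \<Longrightarrow> continuous_on UNIV (gauss_deriv \<epsilon> m)"
  using gauss_deriv_eq_fourier_int(2) by (intro DERIV_continuous_on) (auto intro: has_field_derivative_at_within)

lemma gauss_deriv_measurable[measurable]: "\<epsilon> > 0 \<Longrightarrow> gauss_deriv \<epsilon> m \<in> borel_measurable borel"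
  by (intro borel_measurable_continuous_onI gauss_deriv_continuous)

lemma gauss_deriv_bounded:
  assumes "\<epsilon> > 0"
  obtains C where "\<And>x. \<bar>gauss_deriv \<epsilon> m x\<bar> \<le> C"
proof
  fix x
  have "\<bar>gauss_deriv \<epsilon> m x\<bar> = norm (fourier_int \<epsilon> m x)"
    using gauss_deriv_eq_fourier_int(1)[OF assms, of m x] by (metis norm_of_real)
  also have "\<dots> \<le> (\<integral>p. norm (fourier_integrand \<epsilon> m x p) \<partial>lborel)"
    unfolding fourier_int_def by (rule integral_norm_bound)
  finally show "\<bar>gauss_deriv \<epsilon> m x\<bar> \<le> (\<integral>p. \<bar>p\<bar> ^ m * exp (- \<epsilon> * p\<^sup>2 / 2) / (2 * pi) \<partial>lborel)"
    by (simp add: norm_fourier_integrand)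
qed

section \<open>Derivatives of the d-dimensional heat kernel\<close>

lemma heat_kernel_prod:
  assumes "\<epsilon> > 0"
  shows "heat_kernel \<epsilon> (x :: real ^ 'd::finite) = (\<Prod>l\<in>UNIV. gauss_deriv \<epsilon> 0 (x $ l))"
proof -
  have "(norm x)\<^sup>2 = (\<Sum>l\<in>UNIV. (x $ l)\<^sup>2)"
    unfolding norm_vec_def L2_set_def by (simp add: sum_nonneg)
  then have "exp (- (norm x)\<^sup>2 / (2 * \<epsilon>)) = (\<Prod>l\<in>UNIV. exp (- (x $ l)\<^sup>2 / (2 * \<epsilon>)))"
    by (simp add: exp_sum[symmetric] sum_negf sum_divide_distrib)
  moreover have "(2 * pi * \<epsilon>) powr (- real CARD('d) / 2) = (\<Prod>l\<in>(UNIV::'d set). 1 / sqrt (2 * pi * \<epsilon>))"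
  proof -
    have "(\<Prod>l\<in>(UNIV::'d set). 1 / sqrt (2 * pi * \<epsilon>)) = ((2 * pi * \<epsilon>) powr (-1/2)) ^ CARD('d)"
      using assms by (simp add: powr_half_sqrt powr_minus_divide)
    also have "\<dots> = (2 * pi * \<epsilon>) powr (- real CARD('d) / 2)"
      using assms by (subst powr_power) auto
    finally show ?thesis by simp
  qed
  ultimately show ?thesis
    unfolding heat_kernel_def gauss_deriv_def by (simp only: prod.distrib[symmetric] funpow_0) (simp add: mult.commute)
qed

lemma partial_deriv_prod_gauss:
  assumes e: "\<epsilon> > 0"
  shows "partial_deriv j (\<lambda>x::real ^ 'd::finite. \<Prod>l\<in>UNIV. gauss_deriv \<epsilon> (\<kappa> l) (x $ l))
    = (\<lambda>x. \<Prod>l\<in>UNIV. gauss_deriv \<epsilon> ((\<kappa>(j := Suc (\<kappa> j))) l) (x $ l))"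
proof
  fix x :: "real ^ 'd"
  define c where "c = (\<Prod>l\<in>UNIV - {j}. gauss_deriv \<epsilon> (\<kappa> l) (x $ l))"
  have "(\<Prod>l\<in>UNIV. gauss_deriv \<epsilon> (\<kappa> l) ((x + t *\<^sub>R axis j 1) $ l)) = gauss_deriv \<epsilon> (\<kappa> j) (x $ j + t) * c" for t
    unfolding c_def by (subst prod.remove[of _ j]) (auto simp: axis_def intro!: prod.cong)
  moreover have "(\<Prod>l\<in>UNIV. gauss_deriv \<epsilon> ((\<kappa>(j := Suc (\<kappa> j))) l) (x $ l)) = gauss_deriv \<epsilon> (Suc (\<kappa> j)) (x $ j) * c"
    unfolding c_def by (subst prod.remove[of _ j]) (auto intro!: prod.cong)
  moreover have "((\<lambda>t. gauss_deriv \<epsilon> (\<kappa> j) (x $ j + t) * c) has_real_derivative gauss_deriv \<epsilon> (Suc (\<kappa> j)) (x $ j) * c) (at 0)"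
  proof -
    have "((\<lambda>t. gauss_deriv \<epsilon> (\<kappa> j) (t + x $ j)) has_real_derivative gauss_deriv \<epsilon> (Suc (\<kappa> j)) (x $ j)) (at 0)"
      using gauss_deriv_eq_fourier_int(2)[OF e, of "\<kappa> j" "0 + x $ j"] by (subst (asm) DERIV_shift) simp
    then show ?thesis by (intro DERIV_cmult_right) (simp add: add.commute)
  qed
  ultimately show "partial_deriv j (\<lambda>x. \<Prod>l\<in>UNIV. gauss_deriv \<epsilon> (\<kappa> l) (x $ l)) x
    = (\<Prod>l\<in>UNIV. gauss_deriv \<epsilon> ((\<kappa>(j := Suc (\<kappa> j))) l) (x $ l))"
    unfolding partial_deriv_def by (simp add: DERIV_imp_deriv)
qed

text \<open>Products of one-dimensional derivatives are closed under partial derivatives, each of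
  which raises the order of one factor. Over a list of distinct coordinates the fold thus sets every
  order once.\<close>

lemma multi_deriv_heat_kernel:
  fixes k :: "nat ^ 'd::{finite,linorder}"
  assumes e: "\<epsilon> > 0"
  shows "multi_deriv k (heat_kernel \<epsilon>) = (\<lambda>x. \<Prod>l\<in>UNIV. gauss_deriv \<epsilon> (k $ l) (x $ l))"
proof -
  define G where "G \<kappa> = (\<lambda>x::(real, 'd) vec. \<Prod>l\<in>UNIV. gauss_deriv \<epsilon> (\<kappa> l) (x $ l))" for \<kappa>
  have pd: "partial_deriv j (G \<kappa>) = G (\<kappa>(j := Suc (\<kappa> j)))" for j \<kappa>
    unfolding G_def by (rule partial_deriv_prod_gauss[OF e])
  have pw: "(partial_deriv j ^^ n) (G \<kappa>) = G (\<kappa>(j := \<kappa> j + n))" for j n \<kappa>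
    by (induction n) (auto simp: pd fun_upd_def intro!: arg_cong[where f = G])
  have "foldr (\<lambda>j. partial_deriv j ^^ (k $ j)) xs (G (\<lambda>_. 0)) = G (\<lambda>l. if l \<in> set xs then k $ l else 0)" if "distinct xs" for xs
    using that
  proof (induction xs)
    case (Cons j xs)
    then show ?case by (auto simp: pw intro!: arg_cong[where f = G])
  qed simp
  from this[of "sorted_list_of_set UNIV"] show ?thesis
    unfolding multi_deriv_def G_def heat_kernel_prod[OF e, abs_def] by simp
qed

text \<open>Fubini moves the expectation inside the Fourier integral, where it becomes the
  characteristic function; it applies because the norm of the integrand does not depend on \<omega>
  and is integrable in p. Only then is the Gaussian factor with \<epsilon> bounded by 1, so the
  result is free of \<epsilon>.\<close>

lemma (in prob_space) expectation_prod_gauss_deriv_le: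
  fixes X :: "'i \<Rightarrow> 'a \<Rightarrow> real"
  assumes e: "\<epsilon> > 0" and A: "finite A" and X: "\<And>a. a \<in> A \<Longrightarrow> X a \<in> borel_measurable M"
    and char: "\<And>p. (\<integral>\<omega>. iexp (\<Sum>a\<in>A. p a * X a \<omega>) \<partial>M) = complex_of_real (exp (- V p / 2))"
    and V: "V \<in> borel_measurable (Pi\<^sub>M A (\<lambda>_. lborel))"
  shows "ennreal \<bar>\<integral>\<omega>. (\<Prod>a\<in>A. gauss_deriv \<epsilon> (\<kappa> a) (X a \<omega>)) \<partial>M\<bar>
    \<le> (\<integral>\<^sup>+p. ennreal ((\<Prod>a\<in>A. \<bar>p a\<bar> ^ \<kappa> a) * exp (- V p / 2)) \<partial>Pi\<^sub>M A (\<lambda>_. lborel))"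
proof -
  let ?L = "Pi\<^sub>M A (\<lambda>_. lborel :: real measure)"
  interpret S: product_sigma_finite "\<lambda>_. lborel :: real measure" by standard
  interpret L: finite_product_sigma_finite "\<lambda>_. lborel :: real measure" A by standard fact
  interpret pair_sigma_finite M ?L ..
  note [measurable] = X V
  define f where "f \<omega> p = (\<Prod>a\<in>A. fourier_integrand \<epsilon> (\<kappa> a) (X a \<omega>) (p a))" for \<omega> p
  define F where "F p = (\<Prod>a\<in>A. \<bar>p a\<bar> ^ \<kappa> a * exp (- \<epsilon> * (p a)\<^sup>2 / 2) / (2 * pi))" for p :: "'i \<Rightarrow> real"
  have normf: "norm (f \<omega> p) = F p" for \<omega> p
    unfolding f_def F_def by (simp add: prod_norm[symmetric] norm_fourier_integrand)
  have intF: "integrable ?L F"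
    unfolding F_def by (intro S.product_integrable_prod A integrable_moment_gauss e)
  have intf: "integrable ?L (f \<omega>)" for \<omega>
    unfolding f_def by (intro S.product_integrable_prod A integrable_fourier_integrand e)
  have fm[measurable]: "case_prod f \<in> borel_measurable (M \<Otimes>\<^sub>M ?L)"
    unfolding f_def case_prod_beta by measurable
  have intMf: "integrable (M \<Otimes>\<^sub>M ?L) (case_prod f)"
    by (rule Fubini_integrable) (auto simp: normf intf)
  have "complex_of_real (\<integral>\<omega>. (\<Prod>a\<in>A. gauss_deriv \<epsilon> (\<kappa> a) (X a \<omega>)) \<partial>M)
      = (\<integral>\<omega>. complex_of_real (\<Prod>a\<in>A. gauss_deriv \<epsilon> (\<kappa> a) (X a \<omega>)) \<partial>M)"
    by (rule integral_complex_of_real[symmetric])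
  also have "\<dots> = (\<integral>\<omega>. (\<integral>p. f \<omega> p \<partial>?L) \<partial>M)"
    unfolding f_def using e A
    by (subst S.product_integral_prod) (auto simp: gauss_deriv_eq_fourier_int(1) integrable_fourier_integrand simp flip: fourier_int_def)
  also have "\<dots> = (\<integral>p. (\<integral>\<omega>. f \<omega> p \<partial>M) \<partial>?L)"
    using Fubini_integral[OF intMf] by simp
  finally have eq: "complex_of_real (\<integral>\<omega>. (\<Prod>a\<in>A. gauss_deriv \<epsilon> (\<kappa> a) (X a \<omega>)) \<partial>M) = (\<integral>p. (\<integral>\<omega>. f \<omega> p \<partial>M) \<partial>?L)" .
  have inner: "norm (\<integral>\<omega>. f \<omega> p \<partial>M) \<le> (\<Prod>a\<in>A. \<bar>p a\<bar> ^ \<kappa> a) * exp (- V p / 2)" for p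
  proof -
    have "(\<integral>\<omega>. f \<omega> p \<partial>M) = (\<integral>\<omega>. (\<Prod>a\<in>A. (\<i> * p a) ^ \<kappa> a * exp (- \<epsilon> * (p a)\<^sup>2 / 2) / (2 * pi)) * iexp (\<Sum>a\<in>A. p a * X a \<omega>) \<partial>M)"
      unfolding f_def fourier_integrand_def
      using A by (simp add: exp_sum sum_distrib_left prod.distrib[symmetric] mult_ac)
    also have "\<dots> = (\<Prod>a\<in>A. (\<i> * p a) ^ \<kappa> a * exp (- \<epsilon> * (p a)\<^sup>2 / 2) / (2 * pi)) * complex_of_real (exp (- V p / 2))"
      by (subst integral_mult_right_zero) (simp only: char)
    also have "norm \<dots> = F p * exp (- V p / 2)"
      unfolding F_def norm_mult prod_norm[symmetric] by (simp add: norm_mult norm_power norm_divide)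
    also have "F p \<le> (\<Prod>a\<in>A. \<bar>p a\<bar> ^ \<kappa> a)"
      unfolding F_def
    proof (intro prod_mono conjI)
      fix a assume "a \<in> A"
      have "exp (- \<epsilon> * (p a)\<^sup>2 / 2) / (2 * pi) \<le> 1 / 1"
        using e pi_ge_two by (intro frac_le) auto
      then have "\<bar>p a\<bar> ^ \<kappa> a * (exp (- \<epsilon> * (p a)\<^sup>2 / 2) / (2 * pi)) \<le> \<bar>p a\<bar> ^ \<kappa> a * 1"
        by (intro mult_left_mono) auto
      then show "\<bar>p a\<bar> ^ \<kappa> a * exp (- \<epsilon> * (p a)\<^sup>2 / 2) / (2 * pi) \<le> \<bar>p a\<bar> ^ \<kappa> a" by simp
    qed auto
    finally show ?thesis by (simp add: mult_right_mono)
  qed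
  have "ennreal \<bar>\<integral>\<omega>. (\<Prod>a\<in>A. gauss_deriv \<epsilon> (\<kappa> a) (X a \<omega>)) \<partial>M\<bar> = ennreal (norm (\<integral>p. (\<integral>\<omega>. f \<omega> p \<partial>M) \<partial>?L))"
    by (simp flip: eq)
  also have "\<dots> \<le> (\<integral>\<^sup>+p. ennreal (norm (\<integral>\<omega>. f \<omega> p \<partial>M)) \<partial>?L)"
    by (rule integral_norm_bound_ennreal) (use integrable_snd[OF intMf] in simp)
  also have "\<dots> \<le> (\<integral>\<^sup>+p. ennreal ((\<Prod>a\<in>A. \<bar>p a\<bar> ^ \<kappa> a) * exp (- V p / 2)) \<partial>?L)"
    by (intro nn_integral_mono ennreal_leI inner)
  finally show ?thesis .
qed

section \<open>Fractional Brownian motion\<close>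

lemma (in prob_space) centered_gaussian_rv:
  assumes g: "gaussian_rv M X" and m0: "expectation X = 0"
  shows "integrable M (\<lambda>\<omega>. (X \<omega>)\<^sup>2)"
    and "(\<integral>\<omega>. iexp (X \<omega>) \<partial>M) = complex_of_real (exp (- expectation (\<lambda>\<omega>. (X \<omega>)\<^sup>2) / 2))"
proof -
  have [measurable]: "X \<in> borel_measurable M" using g by (simp add: gaussian_rv_def)
  have "integrable M (\<lambda>\<omega>. (X \<omega>)\<^sup>2) \<and> (\<integral>\<omega>. iexp (X \<omega>) \<partial>M) = complex_of_real (exp (- expectation (\<lambda>\<omega>. (X \<omega>)\<^sup>2) / 2))"
  proof -
    obtain m where "(AE \<omega> in M. X \<omega> = m) \<or> (\<exists>\<sigma>>0. distributed M lborel X (normal_density m \<sigma>))"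
      using g unfolding gaussian_rv_def by auto
    then show ?thesis
    proof (elim disjE exE conjE)
      assume ae: "AE \<omega> in M. X \<omega> = m"
      have "expectation X = expectation (\<lambda>_. m)"
        using ae by (intro integral_cong_AE) auto
      then have m: "m = 0" using m0 by (simp add: prob_space)
      have i: "integrable M (\<lambda>\<omega>. (X \<omega>)\<^sup>2)"
        using ae m by (subst integrable_cong_AE[where g = "\<lambda>_. 0"]) auto
      have "(\<integral>\<omega>. iexp (X \<omega>) \<partial>M) = (\<integral>\<omega>. 1 \<partial>M)"
        using ae m by (intro integral_cong_AE) auto
      moreover have "expectation (\<lambda>\<omega>. (X \<omega>)\<^sup>2) = expectation (\<lambda>\<omega>. 0)"
        using ae m by (intro integral_cong_AE) auto
      ultimately show ?thesis using i by (simp add: prob_space)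
    next
      fix s :: real assume s: "s > 0" and D: "distributed M lborel X (normal_density m s)"
      have m: "m = 0" using normal_distributed_expectation[OF s D] m0 by simp
      note D = D[unfolded m]
      have i: "integrable M (\<lambda>\<omega>. (X \<omega>)\<^sup>2)"
        using integrable_normal_moment[OF s, of 0 2] distributed_integrable[OF D, of "\<lambda>x. x\<^sup>2"] by simp
      have var: "expectation (\<lambda>\<omega>. (X \<omega>)\<^sup>2) = s\<^sup>2"
        using normal_distributed_variance[OF s D] m0 by simp
      have D1: "distributed M lborel (\<lambda>\<omega>. X \<omega> / s) std_normal_density"
        using D s by (subst (asm) normal_standard_normal_convert) auto
      have "(\<integral>\<omega>. iexp (X \<omega>) \<partial>M) = (\<integral>\<omega>. iexp (s * (X \<omega> / s)) \<partial>M)" using s by simp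
      also have "\<dots> = (\<integral>q. iexp (s * q) \<partial>distr M lborel (\<lambda>\<omega>. X \<omega> / s))"
        by (subst integral_distr) auto
      also have "distr M lborel (\<lambda>\<omega>. X \<omega> / s) = std_normal_distribution"
        using D1 by (simp add: distributed_def)
      also have "(\<integral>q. iexp (s * q) \<partial>std_normal_distribution) = char std_normal_distribution s"
        by (simp add: char_def)
      finally show ?thesis using i var by (simp add: char_std_normal_distribution)
    qed
  qed
  then show "integrable M (\<lambda>\<omega>. (X \<omega>)\<^sup>2)"
    and "(\<integral>\<omega>. iexp (X \<omega>) \<partial>M) = complex_of_real (exp (- expectation (\<lambda>\<omega>. (X \<omega>)\<^sup>2) / 2))" by auto
qed

lemma (in prob_space) square_integrable_product:
  fixes X Y :: "'a \<Rightarrow> real"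
  assumes [measurable]: "X \<in> borel_measurable M" "Y \<in> borel_measurable M"
    and "integrable M (\<lambda>\<omega>. (X \<omega>)\<^sup>2)" "integrable M (\<lambda>\<omega>. (Y \<omega>)\<^sup>2)"
  shows "integrable M (\<lambda>\<omega>. X \<omega> * Y \<omega>)"
proof (rule Bochner_Integration.integrable_bound)
  show "integrable M (\<lambda>\<omega>. (X \<omega>)\<^sup>2 + (Y \<omega>)\<^sup>2)" using assms by auto
  have "\<bar>x * y\<bar> \<le> x\<^sup>2 + y\<^sup>2" for x y :: real
  proof -
    have "0 \<le> (\<bar>x\<bar> - \<bar>y\<bar>)\<^sup>2" by simp
    then have "2 * \<bar>x * y\<bar> \<le> x\<^sup>2 + y\<^sup>2" by (simp add: power2_eq_square algebra_simps abs_mult)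
    then show ?thesis using abs_ge_zero[of "x * y"] by linarith
  qed
  then show "AE \<omega> in M. norm (X \<omega> * Y \<omega>) \<le> norm ((X \<omega>)\<^sup>2 + (Y \<omega>)\<^sup>2)" by (intro AE_I2) simp
qed auto

section \<open>Covariances of a fractional Brownian motion\<close>

locale fbm = prob_space P for P :: "'w measure" +
  fixes H :: real and B :: "real \<Rightarrow> 'w \<Rightarrow> real ^ 'd::finite"
  assumes H: "0 < H" "H < 1" and fbm: "fractional_brownian_motion P H B"
begin

lemma gauss: "centered_gaussian_process P (UNIV \<times> {0..}) (\<lambda>(j, t) \<omega>. B t \<omega> $ j)"
  using fbm by (simp add: fractional_brownian_motion_def)

text \<open>A Gaussian process is defined by sums over distinct indices, whereas here times and
  components may repeat; coefficients belonging to the same index are added up.\<close>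

lemma gaussian_sum:
  assumes I: "finite I" and t: "\<And>i. i \<in> I \<Longrightarrow> t i \<ge> 0"
  shows "gaussian_rv P (\<lambda>\<omega>. \<Sum>i\<in>I. c i * B (t i) \<omega> $ l i)"
proof -
  define f where "f i = (l i, t i)" for i
  have "gaussian_rv P (\<lambda>\<omega>. \<Sum>x\<in>f ` I. (\<Sum>i\<in>{i\<in>I. f i = x}. c i) * (\<lambda>(j, t) \<omega>. B t \<omega> $ j) x \<omega>)"
  proof -
    have "finite (f ` I) \<and> f ` I \<subseteq> UNIV \<times> {0..}" using I t by (auto simp: f_def)
    with gauss[unfolded centered_gaussian_process_def, THEN conjunct1, THEN spec[of _ "f ` I"],
        THEN spec[of _ "\<lambda>x. \<Sum>i\<in>{i\<in>I. f i = x}. c i"]]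
    show ?thesis by (rule mp)
  qed
  also have "(\<lambda>\<omega>. \<Sum>x\<in>f ` I. (\<Sum>i\<in>{i\<in>I. f i = x}. c i) * (\<lambda>(j, t) \<omega>. B t \<omega> $ j) x \<omega>) = (\<lambda>\<omega>. \<Sum>i\<in>I. c i * B (t i) \<omega> $ l i)"
  proof
    fix \<omega>
    have "(\<Sum>i\<in>I. c i * B (t i) \<omega> $ l i) = (\<Sum>x\<in>f ` I. \<Sum>i\<in>{i\<in>I. f i = x}. c i * B (t i) \<omega> $ l i)"
      by (rule sum.image_gen[OF I])
    also have "\<dots> = (\<Sum>x\<in>f ` I. (\<Sum>i\<in>{i\<in>I. f i = x}. c i) * (\<lambda>(j, t) \<omega>. B t \<omega> $ j) x \<omega>)"
      unfolding sum_distrib_right by (intro sum.cong refl) (auto simp: f_def)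
    finally show "(\<Sum>x\<in>f ` I. (\<Sum>i\<in>{i\<in>I. f i = x}. c i) * (\<lambda>(j, t) \<omega>. B t \<omega> $ j) x \<omega>) = (\<Sum>i\<in>I. c i * B (t i) \<omega> $ l i)" ..
  qed
  finally show ?thesis .
qed

lemma gaussian_comp: "t \<ge> 0 \<Longrightarrow> gaussian_rv P (\<lambda>\<omega>. B t \<omega> $ l)"
  using gaussian_sum[of "{()}" "\<lambda>_. t" "\<lambda>_. 1" "\<lambda>_. l"] by simp

lemma comp_measurable[measurable]: "t \<ge> 0 \<Longrightarrow> (\<lambda>\<omega>. B t \<omega> $ l) \<in> borel_measurable P"
  using gaussian_comp by (simp add: gaussian_rv_def)

lemma expectation_comp: "t \<ge> 0 \<Longrightarrow> expectation (\<lambda>\<omega>. B t \<omega> $ l) = 0"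
  using gauss unfolding centered_gaussian_process_def by (auto dest!: bspec[of _ _ "(l, t)"])

lemma integrable_square: "t \<ge> 0 \<Longrightarrow> integrable P (\<lambda>\<omega>. (B t \<omega> $ l)\<^sup>2)"
  using centered_gaussian_rv(1)[OF gaussian_comp expectation_comp] .

lemma integrable_product: "t \<ge> 0 \<Longrightarrow> s \<ge> 0 \<Longrightarrow> integrable P (\<lambda>\<omega>. B t \<omega> $ l * B s \<omega> $ l')"
  by (intro square_integrable_product integrable_square) auto

lemma integrable_comp: "t \<ge> 0 \<Longrightarrow> integrable P (\<lambda>\<omega>. B t \<omega> $ l)"
  using square_integrable_imp_integrable[OF comp_measurable integrable_square] .

lemma covariance_same:
  "t \<ge> 0 \<Longrightarrow> s \<ge> 0 \<Longrightarrow> expectation (\<lambda>\<omega>. B t \<omega> $ l * B s \<omega> $ l) = 1/2 * (t powr (2*H) + s powr (2*H) - \<bar>t - s\<bar> powr (2*H))"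
  using fbm unfolding fractional_brownian_motion_def by blast

lemma covariance_diff:
  assumes ts: "t \<ge> 0" "s \<ge> 0" and "l \<noteq> l'"
  shows "expectation (\<lambda>\<omega>. B t \<omega> $ l * B s \<omega> $ l') = 0"
proof -
  \<comment> \<open>Choosing one time for each component turns independence of whole paths into
    independence of the two values.\<close>
  define \<tau> where "\<tau> j = (if j = l then t else s)" for j :: 'd
  have \<tau>: "\<tau> j \<ge> 0" for j using ts by (simp add: \<tau>_def)
  have "indep_vars (\<lambda>j. \<Pi>\<^sub>M t\<in>{0..}. borel) (\<lambda>j \<omega>. \<lambda>t\<in>{0..}. B t \<omega> $ j) UNIV"
    using fbm by (simp add: fractional_brownian_motion_def)
  then have "indep_vars (\<lambda>j. borel) (\<lambda>j \<omega>. (\<lambda>x. x (\<tau> j)) (\<lambda>t\<in>{0..}. B t \<omega> $ j)) UNIV"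
    by (rule indep_vars_compose2) (use \<tau> in \<open>auto intro!: measurable_component_singleton\<close>)
  then have "indep_vars (\<lambda>j. borel) (\<lambda>j \<omega>. B (\<tau> j) \<omega> $ j) UNIV" using \<tau> by simp
  then have "indep_vars (\<lambda>j. borel) (\<lambda>j \<omega>. B (\<tau> j) \<omega> $ j) {l, l'}"
    by (rule indep_vars_subset) auto
  then have "expectation (\<lambda>\<omega>. \<Prod>j\<in>{l, l'}. B (\<tau> j) \<omega> $ j) = (\<Prod>j\<in>{l, l'}. expectation (\<lambda>\<omega>. B (\<tau> j) \<omega> $ j))"
    using \<tau> by (intro indep_vars_lebesgue_integral integrable_comp) auto
  then show ?thesis using assms by (simp add: \<tau>_def expectation_comp)
qed

text \<open>Different components are uncorrelated, and within a component the terms depending on one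
  time only vanish because the coefficients sum to 0. The variance is thus a sum of forms
  \<open>W l\<close> to which local nondeterminism applies. The same bound shows that each
  \<open>W l\<close> is nonnegative, so a single one can be kept.\<close>

lemma expectation_square_ge:
  fixes u :: "nat \<Rightarrow> real" and q :: "nat \<Rightarrow> 'd \<Rightarrow> real"
  assumes u: "\<And>i. i < N \<Longrightarrow> u i \<ge> 0" and q: "\<And>l. (\<Sum>i<N. q i l) = 0"
    and i: "i < N" and r: "r > 0" and sep: "\<And>j. j < N \<Longrightarrow> j \<noteq> i \<Longrightarrow> \<bar>u j - u i\<bar> \<ge> r"
  shows "lnd_const H * (q i l)\<^sup>2 * r powr (2*H) \<le> expectation (\<lambda>\<omega>. (\<Sum>l\<in>UNIV. \<Sum>i<N. q i l * B (u i) \<omega> $ l)\<^sup>2)"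
proof -
  define W where "W l = - (1/2) * (\<Sum>j<N. \<Sum>j'<N. q j l * q j' l * \<bar>u j - u j'\<bar> powr (2*H))" for l
  have "expectation (\<lambda>\<omega>. (\<Sum>l\<in>UNIV. \<Sum>i<N. q i l * B (u i) \<omega> $ l)\<^sup>2)
     = expectation (\<lambda>\<omega>. \<Sum>l\<in>UNIV. \<Sum>l'\<in>UNIV. \<Sum>j<N. \<Sum>j'<N. q j l * q j' l' * (B (u j) \<omega> $ l * B (u j') \<omega> $ l'))"
    unfolding power2_eq_square sum_product by (simp add: mult_ac)
  also have "\<dots> = (\<Sum>l\<in>UNIV. \<Sum>l'\<in>UNIV. \<Sum>j<N. \<Sum>j'<N. q j l * q j' l' * expectation (\<lambda>\<omega>. B (u j) \<omega> $ l * B (u j') \<omega> $ l'))"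
    using u by (intro has_bochner_integral_integral_eq has_bochner_integral_sum has_bochner_integral_mult_right
        has_bochner_integral_integrable integrable_product) auto
  also have "\<dots> = (\<Sum>l\<in>UNIV. \<Sum>l'\<in>UNIV. if l' = l then W l else 0)"
  proof (intro sum.cong refl)
    fix l l' :: 'd
    show "(\<Sum>j<N. \<Sum>j'<N. q j l * q j' l' * expectation (\<lambda>\<omega>. B (u j) \<omega> $ l * B (u j') \<omega> $ l')) = (if l' = l then W l else 0)"
    proof (cases "l' = l")
      case False
      then show ?thesis using u by (auto intro!: sum.neutral simp: covariance_diff)
    next
      case True
      have "(\<Sum>j<N. \<Sum>j'<N. q j l * q j' l * expectation (\<lambda>\<omega>. B (u j) \<omega> $ l * B (u j') \<omega> $ l))
        = (\<Sum>j<N. \<Sum>j'<N. (q j l * u j powr (2*H) / 2) * q j' l + q j l * (q j' l * u j' powr (2*H) / 2)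
             + - (1/2) * (q j l * q j' l * \<bar>u j - u j'\<bar> powr (2*H)))"
        using u by (intro sum.cong refl) (simp add: covariance_same field_simps)
      also have "\<dots> = (\<Sum>j<N. q j l * u j powr (2*H) / 2) * (\<Sum>j<N. q j l)
          + (\<Sum>j<N. q j l) * (\<Sum>j<N. q j l * u j powr (2*H) / 2) + W l"
        unfolding W_def sum_product sum.distrib by (simp add: sum_distrib_left)
      finally show ?thesis using True q by simp
    qed
  qed
  also have "\<dots> = (\<Sum>l\<in>UNIV. W l)" by simp
  finally have eq: "expectation (\<lambda>\<omega>. (\<Sum>l\<in>UNIV. \<Sum>i<N. q i l * B (u i) \<omega> $ l)\<^sup>2) = (\<Sum>l\<in>UNIV. W l)" .
  have W: "lnd_const H * (q i l)\<^sup>2 * r powr (2*H) \<le> W l" for l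
    unfolding W_def using i sep q r by (intro strong_local_nondeterminism H) auto
  have "W l \<ge> 0" for l
  proof -
    have "0 \<le> lnd_const H * (q i l)\<^sup>2 * r powr (2*H)" using lnd_const_pos[OF H] by simp
    also note W[of l]
    finally show ?thesis .
  qed
  then have "W l \<le> (\<Sum>l\<in>UNIV. W l)" by (intro member_le_sum) auto
  then show ?thesis using W[of l] eq by simp
qed

end

section \<open>Expectations of products over pairs of times\<close>

lemma sum_pairs: "(\<Sum>i<2*n. g i) = (\<Sum>j<n. g (2*j) + g (2*j+1 :: nat) :: 'a::comm_monoid_add)"
  by (induction n) (simp_all add: add.assoc)

lemma prod_pairs: "(\<Prod>i<2*n. g i) = (\<Prod>j<n. g (2*j) * g (2*j+1 :: nat) :: 'a::comm_monoid_mult)"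
  by (induction n) (simp_all add: mult.assoc)

lemma spacing_wt_ge_1: "finite I \<Longrightarrow> i \<in> I \<Longrightarrow> 1 \<le> spacing_wt g N I u i"
  unfolding spacing_wt_def by (intro SUP_upper2[of i]) auto

lemma wt_le_spacing_wt: "l \<in> I \<Longrightarrow> l \<noteq> i \<Longrightarrow> wt g (N * (u i - u l)) \<le> spacing_wt g N I u i"
  unfolding spacing_wt_def by (intro SUP_upper2[of l]) auto

text \<open>Two equal times make one factor infinite; the others are at least 1, so the convention
  that 0 times infinity is 0 cannot interfere.\<close>

lemma spacing_wt_prod_collision:
  assumes "finite I" "\<not> inj_on u I"
  shows "(\<Prod>i\<in>I. spacing_wt g N I u i) = \<infinity>"
proof -
  obtain i l where il: "i \<in> I" "l \<in> I" "i \<noteq> l" "u i = u l" using assms by (auto simp: inj_on_def)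
  have "spacing_wt g N I u i = \<infinity>"
    using wt_le_spacing_wt[of l I i g N u] il by (simp add: wt_def top.extremum_unique)
  moreover have "(\<Prod>j\<in>I - {i}. 1::ennreal) \<le> (\<Prod>j\<in>I - {i}. spacing_wt g N I u j)"
    using assms by (intro prod_mono_ennreal spacing_wt_ge_1) auto
  ultimately have "(\<Prod>j\<in>I - {i}. spacing_wt g N I u j) \<noteq> 0"
    by (metis not_one_le_zero prod.neutral_const)
  then have "\<infinity> * (\<Prod>j\<in>I - {i}. spacing_wt g N I u j) = \<infinity>"
    by (simp only: infinity_ennreal_def ennreal_top_mult if_False)
  then show ?thesis
    using il assms \<open>spacing_wt g N I u i = \<infinity>\<close> by (subst prod.remove[of _ i]) (simp_all only:)
qed

context fbm begin

text \<open>What one increment contributes apart from powers of n and of the distances. The number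
  of coordinates is \<open>n * CARD('d)\<close>; its factor \<open>CARD('d)\<close> is kept
  here.\<close>

definition dens_const :: "nat ^ 'd::finite \<Rightarrow> real" where
  "dens_const k = (\<Prod>l\<in>UNIV. moment_const (k $ l) * sqrt (4 * CARD('d)) ^ (k $ l) * sqrt (4 * pi)
     * lnd_const H powr (- (real (k $ l) + 1) / 2))"

lemma dens_const_pos: "dens_const k > 0"
  unfolding dens_const_def moment_const_def using lnd_const_pos[OF H]
  by (intro prod_pos) auto

definition pair_inc :: "(nat \<Rightarrow> real) \<Rightarrow> nat \<times> 'd \<Rightarrow> 'w \<Rightarrow> real" where
  "pair_inc u x \<omega> = B (u (2 * fst x)) \<omega> $ snd x - B (u (2 * fst x + 1)) \<omega> $ snd x"

text \<open>An increment gives opposite coefficients to its two endpoints. Hence the coefficients of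
  each component sum to 0, as local nondeterminism requires.\<close>

lemma increments_sum:
  fixes p :: "nat \<times> 'd \<Rightarrow> real"
  defines "q \<equiv> \<lambda>i l. if even i then p (i div 2, l) else - p (i div 2, l)"
  shows "(\<Sum>x\<in>{..<n} \<times> UNIV. p x * pair_inc u x \<omega>) = (\<Sum>l\<in>UNIV. \<Sum>i<2*n. q i l * B (u i) \<omega> $ l)"
    and "(\<Sum>i<2*n. q i l) = 0"
proof -
  have "(\<Sum>x\<in>{..<n} \<times> UNIV. p x * pair_inc u x \<omega>) = (\<Sum>j<n. \<Sum>l\<in>UNIV. p (j, l) * pair_inc u (j, l) \<omega>)"
    by (simp add: sum.cartesian_product)
  also have "\<dots> = (\<Sum>l\<in>UNIV. \<Sum>j<n. p (j, l) * pair_inc u (j, l) \<omega>)"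
    by (rule sum.swap)
  also have "\<dots> = (\<Sum>l\<in>UNIV. \<Sum>i<2*n. q i l * B (u i) \<omega> $ l)"
    unfolding sum_pairs by (intro sum.cong refl) (simp add: q_def pair_inc_def algebra_simps)
  finally show "(\<Sum>x\<in>{..<n} \<times> UNIV. p x * pair_inc u x \<omega>) = (\<Sum>l\<in>UNIV. \<Sum>i<2*n. q i l * B (u i) \<omega> $ l)" .
  show "(\<Sum>i<2*n. q i l) = 0" unfolding sum_pairs q_def by simp
qed

context
  fixes n :: nat and u :: "nat \<Rightarrow> real"
  assumes u0: "\<And>i. i < 2*n \<Longrightarrow> u i \<ge> 0"
begin

lemma pair_inc_measurable[measurable]: "x \<in> {..<n} \<times> UNIV \<Longrightarrow> pair_inc u x \<in> borel_measurable P"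
  unfolding pair_inc_def[abs_def] using u0[of "2 * fst x"] u0[of "2 * fst x + 1"] by auto

lemma integrable_pair_inc_product:
  assumes "x \<in> {..<n} \<times> UNIV" "y \<in> {..<n} \<times> UNIV"
  shows "integrable P (\<lambda>\<omega>. pair_inc u x \<omega> * pair_inc u y \<omega>)"
proof -
  have t: "u (2 * fst x) \<ge> 0" "u (2 * fst x + 1) \<ge> 0" "u (2 * fst y) \<ge> 0" "u (2 * fst y + 1) \<ge> 0"
    using assms by (auto intro!: u0)
  show ?thesis
    unfolding pair_inc_def left_diff_distrib right_diff_distrib
    by (intro Bochner_Integration.integrable_diff integrable_product t)
qed

lemma expectation_increments_square:
  "expectation (\<lambda>\<omega>. (\<Sum>x\<in>{..<n} \<times> UNIV. p x * pair_inc u x \<omega>)\<^sup>2)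
   = (\<Sum>x\<in>{..<n} \<times> UNIV. \<Sum>y\<in>{..<n} \<times> UNIV. expectation (\<lambda>\<omega>. pair_inc u x \<omega> * pair_inc u y \<omega>) * p x * p y)"
proof -
  have "expectation (\<lambda>\<omega>. (\<Sum>x\<in>{..<n} \<times> UNIV. p x * pair_inc u x \<omega>)\<^sup>2)
    = expectation (\<lambda>\<omega>. \<Sum>x\<in>{..<n} \<times> UNIV. \<Sum>y\<in>{..<n} \<times> UNIV. (p x * p y) * (pair_inc u x \<omega> * pair_inc u y \<omega>))"
    unfolding power2_eq_square sum_product by (simp only: mult_ac)
  also have "\<dots> = (\<Sum>x\<in>{..<n} \<times> UNIV. \<Sum>y\<in>{..<n} \<times> UNIV. (p x * p y) * expectation (\<lambda>\<omega>. pair_inc u x \<omega> * pair_inc u y \<omega>))"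
    by (intro has_bochner_integral_integral_eq has_bochner_integral_sum has_bochner_integral_mult_right
        has_bochner_integral_integrable integrable_pair_inc_product) auto
  finally show ?thesis by (simp only: mult_ac)
qed

lemma increments_char:
  "(\<integral>\<omega>. iexp (\<Sum>x\<in>{..<n} \<times> UNIV. p x * pair_inc u x \<omega>) \<partial>P)
    = complex_of_real (exp (- expectation (\<lambda>\<omega>. (\<Sum>x\<in>{..<n} \<times> UNIV. p x * pair_inc u x \<omega>)\<^sup>2) / 2))"
proof (rule centered_gaussian_rv(2))
  define q where "q i l = (if even i then p (i div 2, l) else - p (i div 2, l))" for i l
  have "gaussian_rv P (\<lambda>\<omega>. \<Sum>x\<in>UNIV \<times> {..<2*n}. q (snd x) (fst x) * B (u (snd x)) \<omega> $ fst x)"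
    by (rule gaussian_sum) (auto intro: u0)
  then show "gaussian_rv P (\<lambda>\<omega>. \<Sum>x\<in>{..<n} \<times> UNIV. p x * pair_inc u x \<omega>)"
    unfolding increments_sum(1) q_def by (simp add: sum.cartesian_product case_prod_beta)
  have "has_bochner_integral P (\<lambda>\<omega>. \<Sum>l\<in>UNIV. \<Sum>i<2*n. q i l * B (u i) \<omega> $ l) (\<Sum>l\<in>UNIV. \<Sum>i<2*n. q i l * expectation (\<lambda>\<omega>. B (u i) \<omega> $ l))"
    by (intro has_bochner_integral_sum has_bochner_integral_mult_right has_bochner_integral_integrable integrable_comp)
       (auto intro: u0)
  then show "expectation (\<lambda>\<omega>. \<Sum>x\<in>{..<n} \<times> UNIV. p x * pair_inc u x \<omega>) = 0"
    unfolding increments_sum(1) q_def by (simp add: has_bochner_integral_iff expectation_comp u0)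
qed

text \<open>Up to sign, \<open>p x\<close> is the coefficient at either endpoint, so the bound holds
  with the larger of the two distances, hence with their geometric mean.\<close>

lemma increments_square_ge:
  assumes d: "\<And>i. i < 2*n \<Longrightarrow> d i > 0"
    and sep: "\<And>i j. i < 2*n \<Longrightarrow> j < 2*n \<Longrightarrow> j \<noteq> i \<Longrightarrow> \<bar>u j - u i\<bar> \<ge> d i"
    and x: "x \<in> {..<n} \<times> UNIV"
  shows "lnd_const H * (d (2 * fst x) * d (2 * fst x + 1)) powr H * (p x)\<^sup>2
    \<le> expectation (\<lambda>\<omega>. (\<Sum>x\<in>{..<n} \<times> UNIV. p x * pair_inc u x \<omega>)\<^sup>2)"
proof -
  define q where "q i l = (if even i then p (i div 2, l) else - p (i div 2, l))" for i l
  define E where "E = expectation (\<lambda>\<omega>. (\<Sum>x\<in>{..<n} \<times> UNIV. p x * pair_inc u x \<omega>)\<^sup>2)"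
  obtain j l where jl: "x = (j, l)" "j < n" using x by auto
  define d1 d2 where "d1 = d (2*j)" "d2 = d (2*j+1)"
  have dd: "d1 > 0" "d2 > 0" using d jl by (auto simp: d1_d2_def)
  have *: "lnd_const H * (q i l)\<^sup>2 * d i powr (2*H) \<le> E" if "i < 2*n" for i
    unfolding E_def increments_sum(1) q_def
    by (rule expectation_square_ge) (use u0 that d sep increments_sum(2) in auto)
  have "lnd_const H * (p x)\<^sup>2 * d1 powr (2*H) \<le> E" "lnd_const H * (p x)\<^sup>2 * d2 powr (2*H) \<le> E"
    using *[of "2*j"] *[of "2*j+1"] jl by (simp_all add: q_def d1_d2_def)
  moreover have "(d1 * d2) powr H \<le> max d1 d2 powr (2*H)"
  proof -
    have "(d1 * d2) powr H \<le> (max d1 d2 * max d1 d2) powr H"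
      using dd H by (intro powr_mono2 mult_mono) auto
    also have "\<dots> = max d1 d2 powr (2*H)" using dd by (simp add: powr_mult powr_add[symmetric])
    finally show ?thesis .
  qed
  then have "lnd_const H * (p x)\<^sup>2 * (d1 * d2) powr H \<le> lnd_const H * (p x)\<^sup>2 * max d1 d2 powr (2*H)"
    using lnd_const_pos[OF H] by (intro mult_left_mono) auto
  ultimately have "lnd_const H * (p x)\<^sup>2 * (d1 * d2) powr H \<le> E" by (auto simp: max_def split: if_splits)
  then show ?thesis unfolding E_def d1_d2_def jl by (simp add: mult_ac)
qed

lemma expectation_product_distinct:
  fixes k :: "nat ^ 'd::finite"
  assumes n: "n > 0" and e: "\<epsilon> > 0" and d: "\<And>i. i < 2*n \<Longrightarrow> d i > 0"
    and sep: "\<And>i j. i < 2*n \<Longrightarrow> j < 2*n \<Longrightarrow> j \<noteq> i \<Longrightarrow> \<bar>u j - u i\<bar> \<ge> d i"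
  defines "g \<equiv> H * (real (multi_order k) + CARD('d)) / 2"
  shows "ennreal \<bar>expectation (\<lambda>\<omega>. \<Prod>j<n. \<Prod>l\<in>UNIV. gauss_deriv \<epsilon> (k $ l) (B (u (2*j)) \<omega> $ l - B (u (2*j+1)) \<omega> $ l))\<bar>
    \<le> ennreal (dens_const k ^ n * real n powr (real n * real (multi_order k) / 2) * (\<Prod>i<2*n. d i powr (-g)))"
proof -
  define A where "A = {..<n} \<times> (UNIV :: 'd set)"
  define m where "m x = lnd_const H * (d (2 * fst x) * d (2 * fst x + 1)) powr H" for x :: "nat \<times> 'd"
  define a where "a x y = (if x \<in> A \<and> y \<in> A then expectation (\<lambda>\<omega>. pair_inc u x \<omega> * pair_inc u y \<omega>) else 0)" for x y
  define V where "V p = (\<Sum>x\<in>A. \<Sum>y\<in>A. a x y * p x * p y)" for p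
  have A: "finite A" "A \<noteq> {}" "card A = n * CARD('d)" using n by (auto simp: A_def)
  have V: "expectation (\<lambda>\<omega>. (\<Sum>x\<in>{..<n} \<times> UNIV. p x * pair_inc u x \<omega>)\<^sup>2) = V p" for p
    unfolding expectation_increments_square V_def a_def A_def by (intro sum.cong refl) auto
  have c: "lnd_const H > 0" by (rule lnd_const_pos[OF H])
  have mpos: "m x > 0" if "x \<in> A" for x
    unfolding m_def using d[of "2 * fst x"] d[of "2 * fst x + 1"] that c by (auto simp: A_def)
  have "ennreal \<bar>expectation (\<lambda>\<omega>. \<Prod>j<n. \<Prod>l\<in>UNIV. gauss_deriv \<epsilon> (k $ l) (B (u (2*j)) \<omega> $ l - B (u (2*j+1)) \<omega> $ l))\<bar>
    = ennreal \<bar>expectation (\<lambda>\<omega>. \<Prod>x\<in>A. gauss_deriv \<epsilon> (k $ snd x) (pair_inc u x \<omega>))\<bar>"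
    unfolding A_def pair_inc_def by (simp add: prod.cartesian_product case_prod_beta)
  also have "\<dots> \<le> (\<integral>\<^sup>+p. ennreal ((\<Prod>x\<in>A. \<bar>p x\<bar> ^ (k $ snd x)) * exp (- V p / 2)) \<partial>Pi\<^sub>M A (\<lambda>_. lborel))"
  proof (rule expectation_prod_gauss_deriv_le[OF e A(1)])
    show "(\<integral>\<omega>. iexp (\<Sum>x\<in>A. p x * pair_inc u x \<omega>) \<partial>P) = complex_of_real (exp (- V p / 2))" for p
      using increments_char[of p] unfolding V A_def .
    show "V \<in> borel_measurable (Pi\<^sub>M A (\<lambda>_. lborel))" unfolding V_def[abs_def] by measurable
  qed (auto simp: A_def)
  also have "\<dots> \<le> ennreal (\<Prod>x\<in>A. moment_const (k $ snd x) * sqrt (4 * card A / m x) ^ (k $ snd x) * sqrt (4 * pi / m x))"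
    unfolding V_def
  proof (rule gaussian_moment_integral_le[OF A(1,2)])
    show "a x y = a y x" for x y unfolding a_def by (simp add: mult.commute conj_commute)
    show "m x * (p x)\<^sup>2 \<le> (\<Sum>x\<in>A. \<Sum>y\<in>A. a x y * p x * p y)" if "x \<in> A" for x p
      using increments_square_ge[of d x p] d sep that unfolding V V_def m_def A_def by auto
  qed (rule mpos)
  \<comment> \<open>Every derivative costs one factor \<open>m x\<close> to the power -1/2, and the
    density costs one more; this is the exponent \<open>(k $ l + 1) / 2\<close>. Summed over the
    components and multiplied by H it becomes g for each endpoint.\<close>
  also have "(\<Prod>x\<in>A. moment_const (k $ snd x) * sqrt (4 * card A / m x) ^ (k $ snd x) * sqrt (4 * pi / m x))
     = (\<Prod>j<n. \<Prod>l\<in>UNIV. (moment_const (k $ l) * sqrt (4 * CARD('d)) ^ (k $ l) * sqrt (4 * pi) * lnd_const H powr (- (real (k $ l) + 1) / 2))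
          * real n powr (real (k $ l) / 2) * (d (2*j) * d (2*j+1)) powr (- H * (real (k $ l) + 1) / 2))"
    unfolding A_def prod.cartesian_product case_prod_beta
  proof (intro prod.cong refl)
    fix x :: "nat \<times> 'd" assume x: "x \<in> {..<n} \<times> UNIV"
    define K where "K = k $ snd x"
    define D where "D = d (2 * fst x) * d (2 * fst x + 1)"
    have D: "D > 0" unfolding D_def using x d[of "2 * fst x"] d[of "2 * fst x + 1"] by auto
    have mx: "m x > 0" using mpos x by (auto simp: A_def)
    have pw: "sqrt y ^ K = y powr (real K / 2)" if "y > 0" for y
      using that by (simp add: powr_half_sqrt[symmetric] powr_power)
    have "sqrt (4 * card ({..<n} \<times> (UNIV::'d set)) / m x) ^ K * sqrt (4 * pi / m x)
       = sqrt (4 * CARD('d)) ^ K * sqrt (real n) ^ K * sqrt (4 * pi) * (1 / sqrt (m x)) ^ (K + 1)"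
      by (simp add: real_sqrt_mult real_sqrt_divide power_mult_distrib power_divide mult_ac)
    also have "sqrt (real n) ^ K = real n powr (real K / 2)" using n by (intro pw) auto
    also have "(1 / sqrt (m x)) ^ (K + 1) = m x powr (- (real K + 1) / 2)"
    proof -
      have "1 / sqrt (m x) = m x powr (-1/2)" using mx by (simp add: powr_minus_divide powr_half_sqrt)
      then have "(1 / sqrt (m x)) ^ (K + 1) = m x powr (real (K + 1) * (-1/2))"
        using mx by (simp only: powr_power)
      also have "real (K + 1) * (-1/2) = - (real K + 1) / 2"
        unfolding of_nat_add of_nat_1 by linarith
      finally show ?thesis .
    qed
    also have "m x powr (- (real K + 1) / 2) = lnd_const H powr (- (real K + 1) / 2) * D powr (- H * (real K + 1) / 2)"
    proof -
      have "H * (- (real K + 1) / 2) = - H * (real K + 1) / 2" by (simp add: algebra_simps)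
      then show ?thesis
        unfolding m_def D_def[symmetric] using c D by (simp only: powr_mult powr_powr)
    qed
    finally show "moment_const (k $ snd x) * sqrt (4 * card ({..<n} \<times> (UNIV::'d set)) / m x) ^ (k $ snd x) * sqrt (4 * pi / m x)
      = (moment_const (k $ snd x) * sqrt (4 * CARD('d)) ^ (k $ snd x) * sqrt (4 * pi) * lnd_const H powr (- (real (k $ snd x) + 1) / 2))
          * real n powr (real (k $ snd x) / 2) * (d (2*fst x) * d (2*fst x+1)) powr (- H * (real (k $ snd x) + 1) / 2)"
      unfolding K_def D_def by (simp add: mult_ac)
  qed
  also have "\<dots> = (\<Prod>j<n. dens_const k * real n powr (real (multi_order k) / 2) * (d (2*j) powr (-g) * d (2*j+1) powr (-g)))"
  proof (intro prod.cong refl)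
    fix j assume j: "j \<in> {..<n}"
    have D: "d (2*j) > 0" "d (2*j+1) > 0" using j by (auto intro!: d)
    have "(\<Prod>l\<in>UNIV. real n powr (real (k $ l) / 2)) = real n powr (real (multi_order k) / 2)"
      using n by (simp add: powr_sum[symmetric] multi_order_def sum_divide_distrib)
    moreover have "(\<Prod>l\<in>UNIV. (d (2*j) * d (2*j+1)) powr (- H * (real (k $ l) + 1) / 2)) = (d (2*j) * d (2*j+1)) powr (-g)"
    proof -
      have "(\<Sum>l\<in>(UNIV::'d set). - H * (real (k $ l) + 1) / 2) = -g"
        unfolding g_def multi_order_def by (simp add: sum_divide_distrib[symmetric] sum_distrib_left[symmetric] sum.distrib sum_negf)
      then show ?thesis using D by (subst powr_sum[symmetric]) auto
    qed
    ultimately show "(\<Prod>l\<in>UNIV. (moment_const (k $ l) * sqrt (4 * CARD('d)) ^ (k $ l) * sqrt (4 * pi) * lnd_const H powr (- (real (k $ l) + 1) / 2))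
          * real n powr (real (k $ l) / 2) * (d (2*j) * d (2*j+1)) powr (- H * (real (k $ l) + 1) / 2))
      = dens_const k * real n powr (real (multi_order k) / 2) * (d (2*j) powr (-g) * d (2*j+1) powr (-g))"
      unfolding prod.distrib[of _ _ UNIV] dens_const_def using D by (simp add: powr_mult)
  qed
  also have "\<dots> = dens_const k ^ n * real n powr (real n * real (multi_order k) / 2) * (\<Prod>i<2*n. d i powr (-g))"
    unfolding prod_pairs using n by (simp add: prod.distrib power_mult_distrib powr_power mult_ac)
  finally show ?thesis .
qed

text \<open>Measuring the nearest distances in units of \<open>1 / (2 * n)\<close> produces the
  power of \<open>2 * n\<close> and leaves spacing weights. For coinciding times the right-hand side
  is infinite, so no exceptional set has to be carried along.\<close>

lemma expectation_product_le:
  fixes k :: "nat ^ 'd::finite"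
  assumes n: "n > 0" and e: "\<epsilon> > 0"
  defines "g \<equiv> H * (real (multi_order k) + CARD('d)) / 2"
  shows "ennreal \<bar>expectation (\<lambda>\<omega>. \<Prod>j<n. \<Prod>l\<in>UNIV. gauss_deriv \<epsilon> (k $ l) (B (u (2*j)) \<omega> $ l - B (u (2*j+1)) \<omega> $ l))\<bar>
    \<le> ennreal (dens_const k ^ n * real n powr (real n * real (multi_order k) / 2) * real (2*n) powr (real (2*n) * g))
       * (\<Prod>i<2*n. spacing_wt g (real (2*n)) {..<2*n} u i)"
proof (cases "inj_on u {..<2*n}")
  case False
  then have "(\<Prod>i<2*n. spacing_wt g (real (2*n)) {..<2*n} u i) = \<infinity>"
    by (intro spacing_wt_prod_collision) auto
  moreover have "ennreal (dens_const k ^ n * real n powr (real n * real (multi_order k) / 2) * real (2*n) powr (real (2*n) * g)) \<noteq> 0"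
    using dens_const_pos[of k] n by (simp add: ennreal_eq_0_iff not_le)
  ultimately show ?thesis
    by (simp only: infinity_ennreal_def ennreal_mult_top if_False top_greatest)
next
  case True
  define d where "d i = Min ((\<lambda>j. \<bar>u j - u i\<bar>) ` ({..<2*n} - {i}))" for i
  have ne: "(\<lambda>j. \<bar>u j - u i\<bar>) ` ({..<2*n} - {i}) \<noteq> {}" for i
  proof -
    have "(if i = 0 then 1 else 0) \<in> {..<2*n} - {i}" using n by auto
    then show ?thesis by blast
  qed
  have att: "\<exists>j\<in>{..<2*n} - {i}. d i = \<bar>u j - u i\<bar>" for i
    using Min_in[OF _ ne[of i]] unfolding d_def by auto
  have dpos: "d i > 0" if "i < 2*n" for i
    using att[of i] True that by (auto simp: inj_on_def)
  have sep: "\<bar>u j - u i\<bar> \<ge> d i" if "i < 2*n" "j < 2*n" "j \<noteq> i" for i j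
    unfolding d_def using that by (intro Min_le) auto
  let ?c = "dens_const k ^ n * real n powr (real n * real (multi_order k) / 2)"
  have c: "?c \<ge> 0" using dens_const_pos[of k] by simp
  have "ennreal \<bar>expectation (\<lambda>\<omega>. \<Prod>j<n. \<Prod>l\<in>UNIV. gauss_deriv \<epsilon> (k $ l) (B (u (2*j)) \<omega> $ l - B (u (2*j+1)) \<omega> $ l))\<bar>
    \<le> ennreal (?c * (\<Prod>i<2*n. d i powr (-g)))"
    unfolding g_def by (intro expectation_product_distinct n e dpos sep)
  also have "(\<Prod>i<2*n. d i powr (-g)) = real (2*n) powr (real (2*n) * g) * (\<Prod>i<2*n. (real (2*n) * d i) powr (-g))"
  proof -
    have "(\<Prod>i<2*n. d i powr (-g)) = (\<Prod>i<2*n. real (2*n) powr g * (real (2*n) * d i) powr (-g))"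
    proof (intro prod.cong refl)
      fix i assume "i \<in> {..<2*n}"
      then have "d i > 0" using dpos by auto
      then show "d i powr (-g) = real (2*n) powr g * (real (2*n) * d i) powr (-g)"
      proof -
        have "real (2*n) powr g * (real (2*n) * d i) powr (-g) = (real (2*n) powr g * real (2*n) powr (-g)) * d i powr (-g)"
          using \<open>d i > 0\<close> n by (simp only: powr_mult mult.assoc)
        also have "real (2*n) powr g * real (2*n) powr (-g) = 1"
          using n by (simp flip: powr_add)
        finally show ?thesis by simp
      qed
    qed
    then show ?thesis using n by (simp add: prod.distrib powr_power mult_ac)
  qed
  also have "ennreal (?c * (real (2*n) powr (real (2*n) * g) * (\<Prod>i<2*n. (real (2*n) * d i) powr (-g))))
     = ennreal (?c * real (2*n) powr (real (2*n) * g)) * (\<Prod>i<2*n. ennreal ((real (2*n) * d i) powr (-g)))"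
  proof -
    have 1: "(\<Prod>i<2*n. ennreal ((real (2*n) * d i) powr (-g))) = ennreal (\<Prod>i<2*n. (real (2*n) * d i) powr (-g))"
      by (rule prod_ennreal) auto
    have 2: "(\<Prod>i<2*n. (real (2*n) * d i) powr (-g)) \<ge> 0" by (intro prod_nonneg) auto
    have 3: "?c * real (2*n) powr (real (2*n) * g) \<ge> 0" using c by simp
    show ?thesis unfolding 1 ennreal_mult[OF 3 2, symmetric] by (simp only: mult.assoc)
  qed
  also have "\<dots> \<le> ennreal (?c * real (2*n) powr (real (2*n) * g)) * (\<Prod>i<2*n. spacing_wt g (real (2*n)) {..<2*n} u i)"
  proof (intro mult_left_mono prod_mono_ennreal)
    fix i assume i: "i \<in> {..<2*n}"
    obtain j where j: "j \<in> {..<2*n} - {i}" "d i = \<bar>u j - u i\<bar>" using att by blast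
    have "ennreal ((real (2*n) * d i) powr (-g)) \<le> wt g (real (2*n) * (u i - u j))"
      using j dpos[of i] i n by (auto simp: wt_def abs_mult abs_minus_commute intro!: ennreal_leI)
    also have "\<dots> \<le> spacing_wt g (real (2*n)) {..<2*n} u i"
      using j by (intro wt_le_spacing_wt) auto
    finally show "ennreal ((real (2*n) * d i) powr (-g)) \<le> spacing_wt g (real (2*n)) {..<2*n} u i" .
  qed auto
  finally show ?thesis .
qed

end

end

section \<open>Moments of the approximations\<close>

text \<open>Rounding the time down to a grid leaves countably many values, so the rounded process is
  jointly measurable; by continuity it converges pointwise as the grid is refined.\<close>

lemma jointly_measurable_continuous:
  fixes Y :: "real \<Rightarrow> 'w \<Rightarrow> real"
  assumes m: "\<And>t. Y t \<in> borel_measurable M"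
    and c: "\<And>\<omega>. \<omega> \<in> space M \<Longrightarrow> continuous_on UNIV (\<lambda>t. Y t \<omega>)"
  shows "(\<lambda>(\<omega>, t). Y t \<omega>) \<in> borel_measurable (M \<Otimes>\<^sub>M borel)"
proof (rule borel_measurable_LIMSEQ_real)
  let ?r = "\<lambda>m t. real_of_int \<lfloor>real (Suc m) * t\<rfloor> / real (Suc m)"
  show "(\<lambda>(\<omega>, t). Y (?r m t) \<omega>) \<in> borel_measurable (M \<Otimes>\<^sub>M borel)" for m
  proof -
    have "(\<lambda>x. (\<lambda>i x. Y (real_of_int i / real (Suc m)) (fst x)) (\<lfloor>real (Suc m) * snd x\<rfloor>) x) \<in> borel_measurable (M \<Otimes>\<^sub>M borel)"
      by (rule measurable_compose_countable) (auto intro: measurable_compose[OF measurable_fst m])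
    then show ?thesis by (simp add: case_prod_beta)
  qed
  fix x assume x: "x \<in> space (M \<Otimes>\<^sub>M (borel :: real measure))"
  obtain \<omega> t where [simp]: "x = (\<omega>, t)" by (cases x)
  have "\<omega> \<in> space M" using x by (simp add: space_pair_measure)
  have "(\<lambda>m. ?r m t) \<longlonglongrightarrow> t"
  proof (rule tendsto_sandwich)
    show "\<forall>\<^sub>F m in sequentially. t - 1 / real (Suc m) \<le> ?r m t"
    proof (intro always_eventually allI)
      fix m
      have "real (Suc m) * t - 1 \<le> real_of_int \<lfloor>real (Suc m) * t\<rfloor>" by linarith
      then have "(real (Suc m) * t - 1) / real (Suc m) \<le> ?r m t" by (intro divide_right_mono) auto
      then show "t - 1 / real (Suc m) \<le> ?r m t" by (simp add: diff_divide_distrib)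
    qed
    show "\<forall>\<^sub>F m in sequentially. ?r m t \<le> t"
    proof (intro always_eventually allI)
      fix m
      have "?r m t \<le> (real (Suc m) * t) / real (Suc m)" by (intro divide_right_mono) auto
      then show "?r m t \<le> t" by simp
    qed
    show "(\<lambda>m. t - 1 / real (Suc m)) \<longlonglongrightarrow> t"
      using tendsto_diff[OF tendsto_const[of t] LIMSEQ_Suc[OF lim_1_over_n]] by simp
  qed auto
  then show "(\<lambda>m. (\<lambda>(\<omega>, t). Y (?r m t) \<omega>) x) \<longlonglongrightarrow> (\<lambda>(\<omega>, t). Y t \<omega>) x"
    using c[OF \<open>\<omega> \<in> space M\<close>] by (auto intro: continuous_on_tendsto_compose)
qed

lemma integrable_bounded_unit_cube:
  fixes F :: "('i \<Rightarrow> real) \<Rightarrow> real"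
  assumes I: "finite I" and m: "F \<in> borel_measurable (Pi\<^sub>M I (\<lambda>_. lborel))"
    and b: "\<And>u. \<bar>F u\<bar> \<le> C * (\<Prod>i\<in>I. indicator {0..1} (u i))"
  shows "integrable (Pi\<^sub>M I (\<lambda>_. lborel)) F"
proof (rule Bochner_Integration.integrable_bound[OF _ m AE_I2])
  interpret product_sigma_finite "\<lambda>_::'i. lborel :: real measure" by standard
  show "integrable (Pi\<^sub>M I (\<lambda>_. lborel)) (\<lambda>u::'i \<Rightarrow> real. C * (\<Prod>i\<in>I. indicator {0..1} (u i) :: real))"
    by (intro integrable_mult_right product_integrable_prod I) auto
  show "norm (F u) \<le> norm (C * (\<Prod>i\<in>I. indicator {0..1} (u i) :: real))" for u
    using b[of u] abs_ge_self[of "C * (\<Prod>i\<in>I. indicator {0..1} (u i) :: real)"] by simp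
qed

text \<open>Each factor receives its own pair of coordinates; the induction splits off the last pair
  by Fubini, which the bound on the unit square permits.\<close>

lemma double_integral_power:
  fixes f :: "real \<Rightarrow> real \<Rightarrow> real"
  assumes m[measurable]: "case_prod f \<in> borel_measurable (lborel \<Otimes>\<^sub>M lborel)"
    and b: "\<And>s r. \<bar>f s r\<bar> \<le> C * (indicator {0..1} s * indicator {0..1} r)"
  shows "(\<integral>s. (\<integral>r. f s r \<partial>lborel) \<partial>lborel) ^ n
    = (\<integral>u. (\<Prod>j<n. f (u (2*j)) (u (2*j+1))) \<partial>Pi\<^sub>M {..<2*n} (\<lambda>_. lborel))"
proof (induction n)
  case 0
  interpret product_sigma_finite "\<lambda>_. lborel :: real measure" by standard
  show ?case by (simp add: space_PiM_empty measure_def)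
next
  case (Suc n)
  interpret product_sigma_finite "\<lambda>_. lborel :: real measure" by standard
  interpret pair_sigma_finite "lborel :: real measure" "lborel :: real measure" ..
  let ?c = "\<integral>s. (\<integral>r. f s r \<partial>lborel) \<partial>lborel"
  have C: "C \<ge> 0" using b[of 0 0] by (simp add: abs_le_iff)
  have fm: "(\<lambda>u. f (u a) (u b)) \<in> borel_measurable (Pi\<^sub>M I (\<lambda>_. lborel))" if "a \<in> I" "b \<in> I" for a b and I :: "nat set"
  proof -
    have "(\<lambda>u. (u a, u b)) \<in> Pi\<^sub>M I (\<lambda>_. lborel) \<rightarrow>\<^sub>M lborel \<Otimes>\<^sub>M (lborel :: real measure)"
      using that by (intro measurable_Pair measurable_component_singleton)
    from measurable_compose[OF this m] show ?thesis by simp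
  qed
  define I where "I = {..<2*n}"
  define J where "J = {2*n, 2*n+1}"
  have IJ: "{..<2 * Suc n} = I \<union> J" "I \<inter> J = {}" "finite I" "finite J" by (auto simp: I_def J_def)
  have int: "integrable (Pi\<^sub>M (I \<union> J) (\<lambda>_. lborel)) (\<lambda>u. \<Prod>j<Suc n. f (u (2*j)) (u (2*j+1)))"
  proof (rule integrable_bounded_unit_cube)
    show "(\<lambda>u. \<Prod>j<Suc n. f (u (2*j)) (u (2*j+1))) \<in> borel_measurable (Pi\<^sub>M (I \<union> J) (\<lambda>_. lborel))"
      unfolding IJ(1)[symmetric] by (intro borel_measurable_prod fm) auto
    fix u :: "nat \<Rightarrow> real"
    have "\<bar>\<Prod>j<Suc n. f (u (2*j)) (u (2*j+1))\<bar> \<le> (\<Prod>j<Suc n. C * (indicator {0..1} (u (2*j)) * indicator {0..1} (u (2*j+1))))"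
      unfolding abs_prod by (intro prod_mono) (use b in auto)
    also have "\<dots> = C ^ Suc n * (\<Prod>i\<in>I \<union> J. indicator {0..1} (u i))"
      unfolding IJ(1)[symmetric] prod_pairs by (simp only: prod.distrib prod_constant card_lessThan)
    finally show "\<bar>\<Prod>j<Suc n. f (u (2*j)) (u (2*j+1))\<bar> \<le> C ^ Suc n * (\<Prod>i\<in>I \<union> J. indicator {0..1} (u i))" .
  qed (use IJ in auto)
  have J: "(\<integral>y. f (y (2*n)) (y (2*n+1)) \<partial>Pi\<^sub>M J (\<lambda>_. lborel)) = ?c"
  proof -
    have "integrable (Pi\<^sub>M (insert (2*n+1) {2*n}) (\<lambda>_. lborel)) (\<lambda>y. f (y (2*n)) (y (2*n+1)))"
    proof (rule integrable_bounded_unit_cube[where C = C])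
      show "(\<lambda>y. f (y (2*n)) (y (2*n+1))) \<in> borel_measurable (Pi\<^sub>M {2*n+1, 2*n} (\<lambda>_. lborel))"
        by (rule fm) auto
    qed (use b in \<open>auto simp: mult_ac\<close>)
    then have "(\<integral>y. f (y (2*n)) (y (2*n+1)) \<partial>Pi\<^sub>M (insert (2*n+1) {2*n}) (\<lambda>_. lborel))
      = (\<integral>x. (\<integral>r. f ((x(2*n+1 := r)) (2*n)) ((x(2*n+1 := r)) (2*n+1)) \<partial>lborel) \<partial>Pi\<^sub>M {2*n} (\<lambda>_. lborel))"
      by (intro product_integral_insert) auto
    also have "\<dots> = (\<integral>x. (\<lambda>s. \<integral>r. f s r \<partial>lborel) (x (2*n)) \<partial>Pi\<^sub>M {2*n} (\<lambda>_. lborel))" by simp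
    also have "\<dots> = ?c"
      by (rule product_integral_singleton) measurable
    finally show ?thesis by (simp add: J_def insert_commute)
  qed
  have "(\<integral>u. (\<Prod>j<Suc n. f (u (2*j)) (u (2*j+1))) \<partial>Pi\<^sub>M {..<2 * Suc n} (\<lambda>_. lborel))
    = (\<integral>x. (\<integral>y. (\<Prod>j<Suc n. f (merge I J (x, y) (2*j)) (merge I J (x, y) (2*j+1))) \<partial>Pi\<^sub>M J (\<lambda>_. lborel)) \<partial>Pi\<^sub>M I (\<lambda>_. lborel))"
    unfolding IJ(1) by (rule product_integral_fold[OF IJ(2-4) int])
  also have "\<dots> = (\<integral>x. (\<integral>y. (\<Prod>j<n. f (x (2*j)) (x (2*j+1))) * f (y (2*n)) (y (2*n+1)) \<partial>Pi\<^sub>M J (\<lambda>_. lborel)) \<partial>Pi\<^sub>M I (\<lambda>_. lborel))"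
  proof (intro Bochner_Integration.integral_cong refl)
    fix x y :: "nat \<Rightarrow> real"
    have "(\<Prod>j<n. f (merge I J (x, y) (2*j)) (merge I J (x, y) (2*j+1))) = (\<Prod>j<n. f (x (2*j)) (x (2*j+1)))"
      by (intro prod.cong refl) (auto simp: merge_def I_def)
    moreover have "merge I J (x, y) (2*n) = y (2*n)" "merge I J (x, y) (2*n+1) = y (2*n+1)"
      by (auto simp: merge_def I_def J_def)
    ultimately show "(\<Prod>j<Suc n. f (merge I J (x, y) (2*j)) (merge I J (x, y) (2*j+1))) = (\<Prod>j<n. f (x (2*j)) (x (2*j+1))) * f (y (2*n)) (y (2*n+1))"
      by simp
  qed
  also have "\<dots> = (\<integral>x. (\<Prod>j<n. f (x (2*j)) (x (2*j+1))) * ?c \<partial>Pi\<^sub>M I (\<lambda>_. lborel))"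
    by (simp only: integral_mult_right_zero J)
  also have "\<dots> = ?c ^ n * ?c"
    unfolding I_def integral_mult_left_zero Suc.IH[symmetric] ..
  finally show ?case by simp
qed

section \<open>Moment bound uniform in the regularisation\<close>

context fbm begin

text \<open>The prefactor of \<open>expectation_product_le\<close> times the spacing integral for
  \<open>2 * n\<close> points; \<epsilon> does not occur.\<close>

definition moment_bound :: "nat ^ 'd::finite \<Rightarrow> nat \<Rightarrow> real" where
  "moment_bound k n = (let g = H * (real (multi_order k) + CARD('d)) / 2 in
     dens_const k ^ n * real n powr (real n * real (multi_order k) / 2) * real (2*n) powr (real (2*n) * g)
       * (2 * (exp 1 * (1 + Gamma (1 - 2*g))) ^ (2*n)))"

text \<open>Paths are continuous only almost surely, so the pathwise integral need not be measurable
  itself; the estimate is made for a measurable function agreeing with it almost everywhere. Its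
  power is a \<open>2 * n\<close>-fold integral, and exchanging this with the expectation reduces
  the claim to the pointwise bound and the spacing integral.\<close>

lemma approx_moment_le:
  fixes k :: "nat ^ 'd::finite"
  assumes e: "\<epsilon> > 0" and n: "n > 0" and small: "H * real (multi_order k) + H * real CARD('d) < 1"
    and F: "\<And>x. F x = (\<Prod>l\<in>UNIV. gauss_deriv \<epsilon> (k $ l) (x $ l))"
  obtains \<alpha>' where "\<alpha>' \<in> borel_measurable P"
    "AE \<omega> in P. (LINT s:{0..1}|lborel. LINT r:{0..s}|lborel. F (B s \<omega> - B r \<omega>)) = \<alpha>' \<omega>"
    "integrable P (\<lambda>\<omega>. \<alpha>' \<omega> ^ n)" "\<bar>expectation (\<lambda>\<omega>. \<alpha>' \<omega> ^ n)\<bar> \<le> moment_bound k n"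
proof -
  define g where "g = H * (real (multi_order k) + CARD('d)) / 2"
  have g: "0 \<le> g" "2 * g < 1" using H small by (auto simp: g_def algebra_simps)
  have "AE \<omega> in P. continuous_on {0..} (\<lambda>t. B t \<omega>)"
    using fbm by (simp add: fractional_brownian_motion_def)
  then obtain N where N: "{\<omega> \<in> space P. \<not> continuous_on {0..} (\<lambda>t. B t \<omega>)} \<subseteq> N" "emeasure P N = 0" "N \<in> sets P"
    by (rule AE_E)
  have aeN: "AE \<omega> in P. \<omega> \<notin> N" using N by (intro AE_not_in) auto
  \<comment> \<open>Zero on the exceptional set and constant for negative times, Y is continuous
    everywhere on the line and hence jointly measurable.\<close>
  define Y where "Y l t \<omega> = (if \<omega> \<in> N then 0 else B (max t 0) \<omega> $ l)" for l t \<omega>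
  have Ym: "Y l t \<in> borel_measurable P" for l t
  proof -
    have [measurable]: "(\<lambda>\<omega>. B (max t 0) \<omega> $ l) \<in> borel_measurable P" by (rule comp_measurable) auto
    show ?thesis unfolding Y_def[abs_def] using N(3) by measurable
  qed
  have Yc: "continuous_on UNIV (\<lambda>t. Y l t \<omega>)" if "\<omega> \<in> space P" for l \<omega>
  proof (cases "\<omega> \<in> N")
    case False
    then have c: "continuous_on {0..} (\<lambda>t. B t \<omega>)" using N(1) that by auto
    have "continuous_on UNIV (\<lambda>t. B (max t 0) \<omega>)"
      by (rule continuous_on_compose2[OF c]) (auto intro!: continuous_intros)
    then show ?thesis using False unfolding Y_def by (simp add: continuous_intros)
  qed (simp add: Y_def)
  have Yj[measurable]: "(\<lambda>(\<omega>, t). Y l t \<omega>) \<in> borel_measurable (P \<Otimes>\<^sub>M borel)" for l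
    by (rule jointly_measurable_continuous[OF Ym Yc])
  have Yj'[measurable (raw)]: "(\<lambda>z. Y l (t z) (w z)) \<in> borel_measurable M" if "t \<in> borel_measurable M" "w \<in> M \<rightarrow>\<^sub>M P" for l t w and M :: "'z measure"
    using measurable_compose[OF measurable_Pair[OF that(2,1)] Yj] by simp
  note [measurable] = gauss_deriv_measurable[OF e]
  define Z where "Z \<omega> s r = indicator {0..1} s * (indicator {0..1} r * (if r \<le> s then (\<Prod>l\<in>UNIV. gauss_deriv \<epsilon> (k $ l) (Y l s \<omega> - Y l r \<omega>)) else 0))" for \<omega> and s r :: real
  have Zm[measurable (raw)]: "(\<lambda>z. Z (w z) (s z) (r z)) \<in> borel_measurable M" if [measurable]: "w \<in> M \<rightarrow>\<^sub>M P" "s \<in> borel_measurable M" "r \<in> borel_measurable M" for w s r and M :: "'z measure"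
    unfolding Z_def by measurable
  have "\<forall>l. \<exists>C. \<forall>x. \<bar>gauss_deriv \<epsilon> (k $ l) x\<bar> \<le> C" using gauss_deriv_bounded[OF e] by metis
  then obtain D where D: "\<And>l x. \<bar>gauss_deriv \<epsilon> (k $ l) x\<bar> \<le> D l" by metis
  \<comment> \<open>This bound depends on \<epsilon>; it only justifies integrability and Fubini and
    does not enter the final estimate.\<close>
  define C where "C = (\<Prod>l\<in>UNIV. D l)"
  have D0: "D l \<ge> 0" for l using D[of l 0] by linarith
  have C: "C \<ge> 0" unfolding C_def using D0 by (intro prod_nonneg) auto
  have Zb: "\<bar>Z \<omega> s r\<bar> \<le> C * (indicator {0..1} s * indicator {0..1} r)" for \<omega> s r
  proof -
    have "\<bar>\<Prod>l\<in>UNIV. gauss_deriv \<epsilon> (k $ l) (Y l s \<omega> - Y l r \<omega>)\<bar> \<le> C"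
      unfolding C_def abs_prod by (intro prod_mono) (use D in auto)
    then show ?thesis using C unfolding Z_def by (auto simp: indicator_def)
  qed
  define \<alpha>' where "\<alpha>' \<omega> = (\<integral>s. (\<integral>r. Z \<omega> s r \<partial>lborel) \<partial>lborel)" for \<omega>
  let ?L = "Pi\<^sub>M {..<2*n} (\<lambda>_. lborel :: real measure)"
  interpret S: product_sigma_finite "\<lambda>_. lborel :: real measure" by standard
  interpret L: finite_product_sigma_finite "\<lambda>_. lborel :: real measure" "{..<2*n}" by standard simp
  interpret PL: pair_sigma_finite P ?L ..
  define W where "W \<omega> u = (\<Prod>j<n. Z \<omega> (u (2*j)) (u (2*j+1)))" for \<omega> and u :: "nat \<Rightarrow> real"
  have cpt: "(\<lambda>z. u z i) \<in> borel_measurable M" if "u \<in> M \<rightarrow>\<^sub>M ?L" "i < 2*n" for u i and M :: "'z measure"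
    using measurable_compose[OF that(1) measurable_component_singleton[of i]] that(2) by simp
  have Wm: "case_prod W \<in> borel_measurable (P \<Otimes>\<^sub>M ?L)"
    unfolding W_def case_prod_beta by (intro borel_measurable_prod Zm cpt measurable_fst measurable_snd) auto
  have Wb: "\<bar>W \<omega> u\<bar> \<le> C ^ n * (\<Prod>i<2*n. indicator {0..1} (u i))" for \<omega> u
  proof -
    have "\<bar>W \<omega> u\<bar> \<le> (\<Prod>j<n. C * (indicator {0..1} (u (2*j)) * indicator {0..1} (u (2*j+1))))"
      unfolding W_def abs_prod by (intro prod_mono) (use Zb in auto)
    also have "\<dots> = C ^ n * (\<Prod>i<2*n. indicator {0..1} (u i))"
      unfolding prod_pairs by (simp only: prod.distrib prod_constant card_lessThan)
    finally show ?thesis .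
  qed
  have Wint: "integrable (P \<Otimes>\<^sub>M ?L) (case_prod W)"
  proof (rule Bochner_Integration.integrable_bound[OF _ Wm AE_I2])
    have iL: "integrable ?L (\<lambda>u. C ^ n * (\<Prod>i<2*n. indicator {0..1} (u i)))"
      by (intro integrable_mult_right S.product_integrable_prod) auto
    have "integrable (P \<Otimes>\<^sub>M ?L) (\<lambda>z. C ^ n * (\<Prod>i<2*n. indicator {0..1} (snd z i)))"
    proof (rule PL.Fubini_integrable)
      show "(\<lambda>z. C ^ n * (\<Prod>i<2*n. indicator {0..1} (snd z i))) \<in> borel_measurable (P \<Otimes>\<^sub>M ?L)"
        using measurable_compose[OF measurable_snd borel_measurable_integrable[OF iL]] by simp
    qed (use iL in auto)
    then show "integrable (P \<Otimes>\<^sub>M ?L) (\<lambda>z. C ^ n * (\<Prod>i<2*n. indicator {0..1} (snd z i)))" .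
    show "norm (case_prod W z) \<le> norm (C ^ n * (\<Prod>i<2*n. indicator {0..1} (snd z i)))" for z
      using Wb[of "fst z" "snd z"] by (auto simp: case_prod_beta)
  qed
  have pow: "\<alpha>' \<omega> ^ n = (\<integral>u. W \<omega> u \<partial>?L)" if \<omega>: "\<omega> \<in> space P" for \<omega>
    unfolding \<alpha>'_def W_def
  proof (rule double_integral_power[OF _ Zb])
    show "case_prod (Z \<omega>) \<in> borel_measurable (lborel \<Otimes>\<^sub>M lborel)"
      unfolding case_prod_beta using \<omega> by (intro Zm) auto
  qed
  have \<alpha>'m: "\<alpha>' \<in> borel_measurable P"
    unfolding \<alpha>'_def[abs_def] by measurable
  have int: "integrable P (\<lambda>\<omega>. \<alpha>' \<omega> ^ n)"
    using PL.integrable_fst[OF Wint] pow by (subst Bochner_Integration.integrable_cong[OF refl pow]) auto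
  have EW: "ennreal \<bar>\<integral>\<omega>. W \<omega> u \<partial>P\<bar> \<le> ennreal (dens_const k ^ n * real n powr (real n * real (multi_order k) / 2) * real (2*n) powr (real (2*n) * g))
       * (\<Prod>i<2*n. indicator {0..1} (u i) * spacing_wt g (real (2*n)) {..<2*n} u i)" for u
  proof (cases "(\<forall>i<2*n. u i \<in> {0..1}) \<and> (\<forall>j<n. u (2*j+1) \<le> u (2*j))")
    case False
    then obtain j where "j < n" "u (2*j) \<notin> {0..1} \<or> u (2*j+1) \<notin> {0..1} \<or> \<not> u (2*j+1) \<le> u (2*j)"
    proof -
      assume *: "\<And>j. j < n \<Longrightarrow> u (2*j) \<notin> {0..1} \<or> u (2*j+1) \<notin> {0..1} \<or> \<not> u (2*j+1) \<le> u (2*j) \<Longrightarrow> thesis"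
      consider i where "i < 2*n" "u i \<notin> {0..1}" | j where "j < n" "\<not> u (2*j+1) \<le> u (2*j)" using False by blast
      then show thesis
      proof cases
        case 1
        then have "i = 2 * (i div 2) \<or> i = 2 * (i div 2) + 1" "i div 2 < n" by auto
        then show thesis using *[of "i div 2"] 1 by metis
      qed (use * in blast)
    qed
    then have "W \<omega> u = 0" for \<omega>
      unfolding W_def Z_def by (intro prod_zero) (auto intro!: bexI[of _ j])
    then show ?thesis by simp
  next
    case True
    have "(\<integral>\<omega>. W \<omega> u \<partial>P) = (\<integral>\<omega>. (\<Prod>j<n. \<Prod>l\<in>UNIV. gauss_deriv \<epsilon> (k $ l) (B (u (2*j)) \<omega> $ l - B (u (2*j+1)) \<omega> $ l)) \<partial>P)"
    proof (rule integral_cong_AE)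
      show "(\<lambda>\<omega>. W \<omega> u) \<in> borel_measurable P" unfolding W_def by measurable
      show "(\<lambda>\<omega>. \<Prod>j<n. \<Prod>l\<in>UNIV. gauss_deriv \<epsilon> (k $ l) (B (u (2*j)) \<omega> $ l - B (u (2*j+1)) \<omega> $ l)) \<in> borel_measurable P"
        using True by (intro borel_measurable_prod measurable_compose[OF _ gauss_deriv_measurable[OF e]] borel_measurable_diff comp_measurable) auto
      show "AE \<omega> in P. W \<omega> u = (\<Prod>j<n. \<Prod>l\<in>UNIV. gauss_deriv \<epsilon> (k $ l) (B (u (2*j)) \<omega> $ l - B (u (2*j+1)) \<omega> $ l))"
        using aeN
      proof eventually_elim
        case (elim \<omega>)
        show ?case unfolding W_def
        proof (intro prod.cong refl)
          fix j assume j: "j \<in> {..<n}"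
          then have "u (2*j) \<in> {0..1}" "u (2*j+1) \<in> {0..1}" "u (2*j+1) \<le> u (2*j)" using True by auto
          then show "Z \<omega> (u (2*j)) (u (2*j+1)) = (\<Prod>l\<in>UNIV. gauss_deriv \<epsilon> (k $ l) (B (u (2*j)) \<omega> $ l - B (u (2*j+1)) \<omega> $ l))"
            using elim unfolding Z_def Y_def by (simp add: max.absorb1)
        qed
      qed
    qed
    moreover have "(\<Prod>i<2*n. indicator {0..1} (u i) * spacing_wt g (real (2*n)) {..<2*n} u i) = (\<Prod>i<2*n. spacing_wt g (real (2*n)) {..<2*n} u i)"
      using True by (intro prod.cong) auto
    ultimately show ?thesis
      using expectation_product_le[of n u \<epsilon> k] True n e unfolding g_def by simp
  qed
  have "ennreal \<bar>expectation (\<lambda>\<omega>. \<alpha>' \<omega> ^ n)\<bar> = ennreal \<bar>\<integral>u. (\<integral>\<omega>. W \<omega> u \<partial>P) \<partial>?L\<bar>"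
    using PL.Fubini_integral[OF Wint] pow by (simp cong: Bochner_Integration.integral_cong)
  also have "\<dots> \<le> (\<integral>\<^sup>+u. ennreal \<bar>\<integral>\<omega>. W \<omega> u \<partial>P\<bar> \<partial>?L)"
    using integral_norm_bound_ennreal[OF PL.integrable_snd[OF Wint]] by simp
  also have "\<dots> \<le> (\<integral>\<^sup>+u. ennreal (dens_const k ^ n * real n powr (real n * real (multi_order k) / 2) * real (2*n) powr (real (2*n) * g))
       * (\<Prod>i<2*n. indicator {0..1} (u i) * spacing_wt g (real (2*n)) {..<2*n} u i) \<partial>?L)"
    by (intro nn_integral_mono EW)
  also have "\<dots> = ennreal (dens_const k ^ n * real n powr (real n * real (multi_order k) / 2) * real (2*n) powr (real (2*n) * g))
       * (\<integral>\<^sup>+u. (\<Prod>i<2*n. indicator {0..1} (u i) * spacing_wt g (real (2*n)) {..<2*n} u i) \<partial>?L)"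
    by (rule nn_integral_cmult) (auto simp: spacing_wt_def)
  also have "\<dots> \<le> ennreal (dens_const k ^ n * real n powr (real n * real (multi_order k) / 2) * real (2*n) powr (real (2*n) * g))
       * ennreal (2 * (exp 1 * (1 + Gamma (1 - 2*g))) ^ (2*n))"
  proof (rule mult_left_mono)
    have "{..<2*n} \<noteq> {}" using n by (auto simp: lessThan_empty_iff)
    from spacing_integral_le[OF g finite_lessThan this]
    show "(\<integral>\<^sup>+u. (\<Prod>i<2*n. indicator {0..1} (u i) * spacing_wt g (real (2*n)) {..<2*n} u i) \<partial>?L)
      \<le> ennreal (2 * (exp 1 * (1 + Gamma (1 - 2*g))) ^ (2*n))" by simp
  qed simp
  also have "\<dots> = ennreal (moment_bound k n)"
    unfolding moment_bound_def Let_def g_def[symmetric]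
    using dens_const_pos[of k] Gamma_real_pos[of "1 - 2*g"] g by (intro ennreal_mult[symmetric]) auto
  finally have fin: "ennreal \<bar>expectation (\<lambda>\<omega>. \<alpha>' \<omega> ^ n)\<bar> \<le> ennreal (moment_bound k n)" .
  have mb: "moment_bound k n \<ge> 0"
    unfolding moment_bound_def Let_def g_def[symmetric]
    using dens_const_pos[of k] Gamma_real_pos[of "1 - 2*g"] g by auto
  have ae: "AE \<omega> in P. (LINT s:{0..1}|lborel. LINT r:{0..s}|lborel. F (B s \<omega> - B r \<omega>)) = \<alpha>' \<omega>"
    using aeN
  proof eventually_elim
    case (elim \<omega>)
    show ?case unfolding \<alpha>'_def set_lebesgue_integral_def
    proof (intro Bochner_Integration.integral_cong refl)
      fix s :: real
      have "indicator {0..1} s *\<^sub>R (\<integral>r. indicator {0..s} r *\<^sub>R F (B s \<omega> - B r \<omega>) \<partial>lborel)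
         = (\<integral>r. indicator {0..1} s *\<^sub>R (indicator {0..s} r *\<^sub>R F (B s \<omega> - B r \<omega>)) \<partial>lborel)"
        by simp
      also have "\<dots> = (\<integral>r. Z \<omega> s r \<partial>lborel)"
        unfolding Z_def F Y_def using elim
        by (intro Bochner_Integration.integral_cong refl) (auto simp: indicator_def max_def)
      finally show "indicator {0..1} s *\<^sub>R (\<integral>r. indicator {0..s} r *\<^sub>R F (B s \<omega> - B r \<omega>) \<partial>lborel) = (\<integral>r. Z \<omega> s r \<partial>lborel)" .
    qed
  qed
  show thesis
    by (rule that[OF \<alpha>'m ae int]) (use fin mb in simp)
qed

end

section \<open>Exponential moments\<close>

lemma abs_add_power_le:
  fixes x y :: real
  shows "\<bar>x + y\<bar> ^ n \<le> 2 ^ n * (\<bar>x\<bar> ^ n + \<bar>y\<bar> ^ n)"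
proof -
  have "\<bar>x + y\<bar> ^ n \<le> (2 * max \<bar>x\<bar> \<bar>y\<bar>) ^ n" by (intro power_mono) auto
  also have "\<dots> = 2 ^ n * max \<bar>x\<bar> \<bar>y\<bar> ^ n" by (simp add: power_mult_distrib)
  also have "\<dots> \<le> 2 ^ n * (\<bar>x\<bar> ^ n + \<bar>y\<bar> ^ n)"
    by (intro mult_left_mono) (auto simp: max_def)
  finally show ?thesis .
qed

text \<open>On the logarithmic scale the moments grow like \<open>\<theta> * b * q * ln q\<close>
  and the factorial like \<open>q * ln q\<close>, up to linear terms;
  \<open>\<theta> * b < 1\<close> leaves a negative leading coefficient. The shift by 4 is the room
  needed to round \<open>b * q\<close> up to an even integer.\<close>

lemma summable_moment_series:
  fixes C \<theta> b :: real
  assumes C: "C \<ge> 1" and \<theta>: "\<theta> \<ge> 0" and b: "0 \<le> b" "\<theta> * b < 1"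
  shows "summable (\<lambda>q. (1 + C powr (b * real q + 4) * (b * real q + 4) powr (\<theta> * (b * real q + 4))) / fact q)"
proof -
  define c where "c = ln (b + 4)"
  \<comment> \<open>The summand \<open>ln 2\<close> sets aside the geometric factor
    \<open>(1/2) ^ q\<close> used for the comparison.\<close>
  define A where "A = b * ln C + 1 + \<theta> * b * c + ln 2"
  define D where "D = 4 * ln C + 4 * \<theta> * c"
  define \<delta> where "\<delta> = 1 - \<theta> * b"
  have \<delta>: "\<delta> > 0" using b by (simp add: \<delta>_def)

  have "filterlim (\<lambda>x::real. - \<delta> * (x * ln x) + A * x + 4 * \<theta> * ln x + D) at_bot at_top"
    using \<delta> by real_asymp
  then have lim: "filterlim (\<lambda>q::nat. - \<delta> * (real q * ln (real q)) + A * real q + 4 * \<theta> * ln (real q) + D) at_bot at_top"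
    by (rule filterlim_compose[OF _ filterlim_real_sequentially])
  have ev: "\<forall>\<^sub>F q in sequentially. norm (C powr (b * real q + 4) * (b * real q + 4) powr (\<theta> * (b * real q + 4)) / fact q) \<le> (1/2) ^ q"
    using lim[unfolded filterlim_at_bot, rule_format, of 0] eventually_ge_at_top[of 1]
  proof eventually_elim
    case (elim q)
    have q: "real q \<ge> 1" using elim by simp
    define y where "y = b * real q + 4"
    have y: "y > 0" "y \<le> (b + 4) * real q" using q b by (auto simp: y_def algebra_simps add_nonneg_pos)
    have lny: "ln y \<le> c + ln (real q)"
    proof -
      have "ln y \<le> ln ((b + 4) * real q)" using y q b by (subst ln_le_cancel_iff) auto
      also have "\<dots> = c + ln (real q)" unfolding c_def using q b by (subst ln_mult_pos) auto
      finally show ?thesis .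
    qed
    have "C powr y * y powr (\<theta> * y) = exp (y * ln C + \<theta> * y * ln y)"
      using C y by (simp add: powr_def exp_add)
    also have "\<dots> \<le> exp (y * ln C + \<theta> * y * (c + ln (real q)))"
      using lny y \<theta> by (simp add: mult_left_mono)
    finally have 1: "C powr y * y powr (\<theta> * y) \<le> exp (y * ln C + \<theta> * y * (c + ln (real q)))" .
    have "1 / fact q \<le> exp (real q) / real q ^ q"
      using power_div_fact_le_exp[of "real q" q] q by (simp add: field_simps)
    also have "\<dots> = exp (real q - real q * ln (real q))"
      using q by (simp add: exp_diff exp_of_nat_mult)
    finally have 2: "1 / fact q \<le> exp (real q - real q * ln (real q))" .
    have "C powr y * y powr (\<theta> * y) * (1 / fact q) \<le> exp (y * ln C + \<theta> * y * (c + ln (real q))) * exp (real q - real q * ln (real q))"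
      by (intro mult_mono 1 2) auto
    also have "\<dots> = exp (- \<delta> * (real q * ln (real q)) + A * real q + 4 * \<theta> * ln (real q) + D + real q * (- ln 2))"
      unfolding exp_add[symmetric] y_def A_def D_def \<delta>_def by (simp add: algebra_simps)
    also have "\<dots> \<le> exp (real q * (- ln 2))" using elim by simp
    also have "\<dots> = (1/2) ^ q" by (simp add: exp_of_nat_mult exp_minus power_divide inverse_eq_divide)
    finally show ?case using C y unfolding y_def[symmetric] by (simp add: abs_mult)
  qed
  have "summable (\<lambda>q. C powr (b * real q + 4) * (b * real q + 4) powr (\<theta> * (b * real q + 4)) / fact q)"
    by (rule summable_comparison_test_ev[OF ev]) (simp add: summable_geometric)
  moreover have "summable (\<lambda>q. 1 / fact q :: real)"
    using summable_exp[of "1::real"] by (simp add: inverse_eq_divide)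
  ultimately show ?thesis
    unfolding add_divide_distrib by (intro summable_add)
qed

text \<open>In the exponential series the fractional power \<open>b * q\<close> of the variable is
  at most 1 plus an even integer power slightly above it, so even moments suffice.\<close>

lemma (in prob_space) exp_moment_finite:
  fixes X :: "'a \<Rightarrow> real"
  assumes X[measurable]: "X \<in> borel_measurable M"
    and C: "C \<ge> 1" and \<theta>: "\<theta> \<ge> 0" and b: "0 \<le> b" "\<theta> * b < 1"
    and mom: "\<And>n. n > 0 \<Longrightarrow> even n \<Longrightarrow> (\<integral>\<^sup>+\<omega>. ennreal (\<bar>X \<omega>\<bar> ^ n) \<partial>M) \<le> ennreal (C ^ n * real n powr (\<theta> * real n))"
  shows "(\<integral>\<^sup>+\<omega>. ennreal (exp (\<bar>X \<omega>\<bar> powr b)) \<partial>M) < \<infinity>"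
proof -
  define T where "T q = (1 + C powr (b * real q + 4) * (b * real q + 4) powr (\<theta> * (b * real q + 4))) / fact q" for q :: nat
  have T0: "T q \<ge> 0" for q unfolding T_def by simp
  have term_le: "(\<integral>\<^sup>+\<omega>. ennreal ((\<bar>X \<omega>\<bar> powr b) ^ q / fact q) \<partial>M) \<le> ennreal (T q)" for q
  proof -
    \<comment> \<open>An even integer between \<open>b * q\<close> and \<open>b * q + 4\<close>; the
      added 1 keeps it positive for q = 0.\<close>
    define n where "n = 2 * (nat \<lceil>b * real q / 2\<rceil> + 1)"
    have n: "n > 0" "even n" by (auto simp: n_def)
    have nl: "b * real q \<le> real n" and nu: "real n \<le> b * real q + 4"
    proof -
      have "b * real q / 2 \<ge> 0" using b by simp
      then have e: "real (nat \<lceil>b * real q / 2\<rceil>) = real_of_int \<lceil>b * real q / 2\<rceil>" by simp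
      have "real n = 2 * real_of_int \<lceil>b * real q / 2\<rceil> + 2" using e by (simp add: n_def)
      then show "b * real q \<le> real n" "real n \<le> b * real q + 4" by linarith+
    qed
    have pw: "(y powr b) ^ q \<le> 1 + y ^ n" if y: "y \<ge> 0" for y :: real
    proof (cases "y \<le> 1")
      case True
      then have "(y powr b) ^ q \<le> 1" using y b by (intro power_le_one) (auto simp: powr_le1)
      then show ?thesis using zero_le_power[OF y, of n] by linarith
    next
      case False
      then have "(y powr b) ^ q = y powr (b * real q)" by (simp add: powr_power mult.commute)
      also have "\<dots> \<le> y powr real n" using False nl by (intro powr_mono) auto
      also have "\<dots> = y ^ n" using False by (simp add: powr_realpow)
      finally show ?thesis by simp
    qed
    have "(\<integral>\<^sup>+\<omega>. ennreal ((\<bar>X \<omega>\<bar> powr b) ^ q / fact q) \<partial>M) \<le> (\<integral>\<^sup>+\<omega>. ennreal (1 / fact q) * (1 + ennreal (\<bar>X \<omega>\<bar> ^ n)) \<partial>M)"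
    proof (intro nn_integral_mono)
      fix \<omega>
      have "(\<bar>X \<omega>\<bar> powr b) ^ q / fact q \<le> 1 / fact q * (1 + \<bar>X \<omega>\<bar> ^ n)"
        using pw[of "\<bar>X \<omega>\<bar>"] by (simp add: divide_right_mono)
      then have "ennreal ((\<bar>X \<omega>\<bar> powr b) ^ q / fact q) \<le> ennreal (1 / fact q * (1 + \<bar>X \<omega>\<bar> ^ n))"
        by (rule ennreal_leI)
      also have "\<dots> = ennreal (1 / fact q) * (1 + ennreal (\<bar>X \<omega>\<bar> ^ n))"
        by (subst ennreal_mult) auto
      finally show "ennreal ((\<bar>X \<omega>\<bar> powr b) ^ q / fact q) \<le> \<dots>" .
    qed
    also have "\<dots> = ennreal (1 / fact q) * (1 + (\<integral>\<^sup>+\<omega>. ennreal (\<bar>X \<omega>\<bar> ^ n) \<partial>M))"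
      by (subst nn_integral_cmult, simp, subst nn_integral_add) (auto simp: emeasure_space_1)
    also have "\<dots> \<le> ennreal (1 / fact q) * (1 + ennreal (C ^ n * real n powr (\<theta> * real n)))"
      by (intro mult_left_mono add_left_mono mom n) auto
    also have "\<dots> = ennreal (1 / fact q * (1 + C ^ n * real n powr (\<theta> * real n)))"
      using C by (subst ennreal_mult) (auto)
    also have "\<dots> \<le> ennreal (T q)"
    proof (rule ennreal_leI)
      have "C ^ n \<le> C powr (b * real q + 4)"
        using C nu powr_realpow[of C n] powr_mono[of "real n" "b * real q + 4" C] by simp
      moreover have "real n powr (\<theta> * real n) \<le> (b * real q + 4) powr (\<theta> * (b * real q + 4))"
      proof -
        have "real n powr (\<theta> * real n) \<le> (b * real q + 4) powr (\<theta> * real n)"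
          using nu \<theta> by (intro powr_mono2) auto
        also have "\<dots> \<le> (b * real q + 4) powr (\<theta> * (b * real q + 4))"
          using nu \<theta> b by (intro powr_mono mult_left_mono) (auto simp: add_increasing)
        finally show ?thesis .
      qed
      ultimately have "C ^ n * real n powr (\<theta> * real n) \<le> C powr (b * real q + 4) * (b * real q + 4) powr (\<theta> * (b * real q + 4))"
        using C by (intro mult_mono) auto
      then show "1 / fact q * (1 + C ^ n * real n powr (\<theta> * real n)) \<le> T q"
        unfolding T_def by (simp add: divide_right_mono)
    qed
    finally show ?thesis .
  qed
  have "(\<integral>\<^sup>+\<omega>. ennreal (exp (\<bar>X \<omega>\<bar> powr b)) \<partial>M) = (\<integral>\<^sup>+\<omega>. (\<Sum>q. ennreal ((\<bar>X \<omega>\<bar> powr b) ^ q / fact q)) \<partial>M)"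
  proof (intro nn_integral_cong)
    fix \<omega>
    show "ennreal (exp (\<bar>X \<omega>\<bar> powr b)) = (\<Sum>q. ennreal ((\<bar>X \<omega>\<bar> powr b) ^ q / fact q))"
      using summable_exp_generic[of "\<bar>X \<omega>\<bar> powr b"]
      by (subst suminf_ennreal2) (auto simp: exp_def divide_inverse mult.commute)
  qed
  also have "\<dots> = (\<Sum>q. \<integral>\<^sup>+\<omega>. ennreal ((\<bar>X \<omega>\<bar> powr b) ^ q / fact q) \<partial>M)"
    by (rule nn_integral_suminf) measurable
  also have "\<dots> \<le> (\<Sum>q. ennreal (T q))"
    by (intro suminf_le term_le) auto
  also have "\<dots> = ennreal (\<Sum>q. T q)"
    using summable_moment_series[OF C \<theta> b] T0 by (intro suminf_ennreal2) (auto simp: T_def)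
  also have "\<dots> < \<infinity>" by simp
  finally show ?thesis .
qed

section \<open>Passage to the limit and conclusion\<close>

context fbm begin

lemma moment_bound_le:
  fixes k :: "nat ^ 'd::finite"
  assumes small: "H * real (multi_order k) + H * real CARD('d) < 1"
  obtains C where "C \<ge> 1" and
    "\<And>n. n > 0 \<Longrightarrow> 2 ^ n * (moment_bound k n + 1) \<le> C ^ n * real n powr ((real (multi_order k) / 2 + H * (real (multi_order k) + CARD('d))) * real n)"
proof -
  define g where "g = H * (real (multi_order k) + CARD('d)) / 2"
  define K where "K = exp 1 * (1 + Gamma (1 - 2*g))"
  have g: "0 \<le> g" "2 * g < 1" using H small by (auto simp: g_def algebra_simps)
  have K: "K \<ge> 0" using Gamma_real_pos[of "1 - 2*g"] g by (simp add: K_def)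
  define D where "D = dens_const k * 2 powr (2*g) * K\<^sup>2"
  have D: "D \<ge> 0" using dens_const_pos[of k] by (simp add: D_def)
  define \<theta> where "\<theta> = real (multi_order k) / 2 + H * (real (multi_order k) + CARD('d))"
  have \<theta>: "\<theta> = real (multi_order k) / 2 + 2 * g" "\<theta> \<ge> 0" using g by (auto simp: \<theta>_def g_def)
  \<comment> \<open>Here 6 is 2 times 3: \<open>2 ^ n\<close> stands on the left, and
    \<open>3 ^ n\<close> covers the leading 2 of \<open>moment_bound\<close> together with the added
    1.\<close>
  have "2 ^ n * (moment_bound k n + 1) \<le> (6 * max 1 D) ^ n * real n powr (\<theta> * real n)" if n: "n > 0" for n
  proof -
    define R where "R = real n powr (\<theta> * real n)"
    have R: "R \<ge> 1" unfolding R_def using n \<theta> by (intro ge_one_powr_ge_zero) auto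
    have mb: "moment_bound k n = 2 * D ^ n * R"
    proof -
      have "real (2*n) powr (real (2*n) * g) = (2 powr (2*g)) ^ n * real n powr (2 * g * real n)"
        using n by (simp add: powr_mult powr_power mult_ac)
      moreover have "real n powr (real n * real (multi_order k) / 2) * real n powr (2 * g * real n) = R"
        unfolding R_def \<theta>(1) powr_add[symmetric] by (simp add: algebra_simps)
      moreover have "K ^ (2*n) = (K\<^sup>2) ^ n" by (rule power_mult)
      ultimately show ?thesis
        unfolding moment_bound_def Let_def g_def[symmetric] K_def[symmetric]
        unfolding D_def power_mult_distrib by (simp add: mult_ac)
    qed
    have "D ^ n \<le> max 1 D ^ n" using D by (intro power_mono) auto
    moreover have "1 \<le> max 1 D ^ n" by (intro one_le_power) auto
    ultimately have "2 * D ^ n * R + 1 \<le> 2 * max 1 D ^ n * R + max 1 D ^ n * R"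
      using R mult_mono[of 1 "max 1 D ^ n" 1 R] by (intro add_mono mult_right_mono) auto
    also have "\<dots> = 3 * (max 1 D ^ n * R)" by simp
    also have "\<dots> \<le> 3 ^ n * (max 1 D ^ n * R)"
      using n R self_le_power[of 3 n] by (intro mult_right_mono) auto
    finally have "2 ^ n * (2 * D ^ n * R + 1) \<le> 2 ^ n * (3 ^ n * (max 1 D ^ n * R))" by simp
    also have "\<dots> = (6 * max 1 D) ^ n * R"
    proof -
      have "(6::real) ^ n = 2 ^ n * 3 ^ n" by (simp flip: power_mult_distrib)
      then show ?thesis by (simp add: power_mult_distrib mult_ac)
    qed
    finally show ?thesis unfolding mb R_def .
  qed
  moreover have "6 * max 1 D \<ge> 1" by simp
  ultimately show thesis using that unfolding \<theta>_def by blast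
qed

end

text \<open>Since the moment bound is uniform in \<epsilon>, one \<epsilon> whose n-th power
  distance to \<alpha> is below 1 is enough; that distance is the added 1, and \<open>2 ^ n\<close>
  comes from splitting the power of a sum. For even n the plain power of the approximation is its
  absolute moment.\<close>

lemma silt_deriv_moment_le:
  fixes P :: "'w measure"
    and B :: "real \<Rightarrow> 'w \<Rightarrow> real ^ 'd::{finite,linorder}"
    and k :: "nat ^ 'd::{finite,linorder}"
  assumes "fbm P H B" and silt: "is_silt_deriv P B k \<alpha>"
    and small: "H * real (multi_order k) + H * real CARD('d) < 1" and n: "n > 0" "even n"
  shows "(\<integral>\<^sup>+\<omega>. ennreal (\<bar>\<alpha> \<omega>\<bar> ^ n) \<partial>P) \<le> ennreal (2 ^ n * (fbm.moment_bound H k n + 1))"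
proof -
  interpret fbm P H B by fact
  have \<alpha>m[measurable]: "\<alpha> \<in> borel_measurable P" using silt by (simp add: is_silt_deriv_def)
  let ?S = "silt_approx B k"
  have n1: "real n \<ge> 1" using n by simp
  have conv: "converges_in_Lp (completion P) (real n) ?S \<alpha> (at_right 0)"
    using silt n1 by (simp add: is_silt_deriv_def)
  have pn: "\<bar>x\<bar> powr real n = \<bar>x\<bar> ^ n" for x :: real
    using n by (cases "x = 0") (auto simp: powr_realpow)
  have "\<forall>\<^sub>F \<epsilon> in at_right 0. \<epsilon> > 0 \<and> ?S \<epsilon> \<in> borel_measurable (completion P) \<and> integrable (completion P) (\<lambda>\<omega>. \<bar>?S \<epsilon> \<omega>\<bar> ^ n)
      \<and> (\<integral>\<omega>. \<bar>?S \<epsilon> \<omega> - \<alpha> \<omega>\<bar> ^ n \<partial>completion P) < 1"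
    using conv unfolding converges_in_Lp_def pn
    by (intro eventually_conj eventually_at_right_less order_tendstoD(2)[of _ 0])
       (auto elim: eventually_mono)
  then obtain \<epsilon> where e: "\<epsilon> > 0" and Sm: "?S \<epsilon> \<in> borel_measurable (completion P)"
    and Si: "integrable (completion P) (\<lambda>\<omega>. \<bar>?S \<epsilon> \<omega>\<bar> ^ n)"
    and Sd: "(\<integral>\<omega>. \<bar>?S \<epsilon> \<omega> - \<alpha> \<omega>\<bar> ^ n \<partial>completion P) < 1"
    using eventually_happens[of _ "at_right (0::real)"] by (auto simp: trivial_limit_at_right_real)
  obtain \<alpha>' where a': "\<alpha>' \<in> borel_measurable P" "AE \<omega> in P. ?S \<epsilon> \<omega> = \<alpha>' \<omega>"
    "integrable P (\<lambda>\<omega>. \<alpha>' \<omega> ^ n)" "\<bar>expectation (\<lambda>\<omega>. \<alpha>' \<omega> ^ n)\<bar> \<le> moment_bound k n"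
  proof (rule approx_moment_le[OF e n(1) small])
    show "multi_deriv k (heat_kernel \<epsilon>) x = (\<Prod>l\<in>UNIV. gauss_deriv \<epsilon> (k $ l) (x $ l))" for x
      by (simp add: multi_deriv_heat_kernel[OF e])
    fix \<alpha>''
    assume "\<alpha>'' \<in> borel_measurable P" "integrable P (\<lambda>\<omega>. \<alpha>'' \<omega> ^ n)" "\<bar>expectation (\<lambda>\<omega>. \<alpha>'' \<omega> ^ n)\<bar> \<le> moment_bound k n"
      "AE \<omega> in P. (LINT s:{0..1}|lborel. LINT r:{0..s}|lborel. multi_deriv k (heat_kernel \<epsilon>) (B s \<omega> - B r \<omega>)) = \<alpha>'' \<omega>"
    then show thesis by (intro that[of \<alpha>'']) (simp_all add: silt_approx_def)
  qed
  note [measurable] = a'(1)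
  have aec: "AE \<omega> in completion P. ?S \<epsilon> \<omega> = \<alpha>' \<omega>"
    using a'(2) by (rule AE_completion)
  have cm: "f \<in> borel_measurable (completion P)" if "f \<in> borel_measurable P" for f :: "'w \<Rightarrow> real"
    using that by (rule measurable_completion)
  have ev: "\<bar>x\<bar> ^ n = x ^ n" for x :: real using n(2) by (rule power_even_abs)
  have \<alpha>i: "integrable P (\<lambda>\<omega>. \<bar>\<alpha> \<omega>\<bar> ^ n)"
  proof -
    have "integrable (completion P) (\<lambda>\<omega>. \<bar>\<alpha> \<omega>\<bar> ^ n)"
      using conv unfolding converges_in_Lp_def pn by simp
    then show ?thesis by (subst (asm) integrable_completion) auto
  qed
  have Di: "integrable P (\<lambda>\<omega>. \<bar>\<alpha>' \<omega> - \<alpha> \<omega>\<bar> ^ n)"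
  proof (rule Bochner_Integration.integrable_bound)
    show "integrable P (\<lambda>\<omega>. 2 ^ n * (\<bar>\<alpha>' \<omega>\<bar> ^ n + \<bar>\<alpha> \<omega>\<bar> ^ n))"
      using \<alpha>i a'(3) by (intro integrable_mult_right Bochner_Integration.integrable_add) (simp_all add: ev)
    show "AE \<omega> in P. norm (\<bar>\<alpha>' \<omega> - \<alpha> \<omega>\<bar> ^ n) \<le> norm (2 ^ n * (\<bar>\<alpha>' \<omega>\<bar> ^ n + \<bar>\<alpha> \<omega>\<bar> ^ n))"
      using abs_add_power_le[of "\<alpha>' _" "- \<alpha> _" n] by (intro AE_I2) simp
  qed auto
  have D1: "expectation (\<lambda>\<omega>. \<bar>\<alpha>' \<omega> - \<alpha> \<omega>\<bar> ^ n) \<le> 1"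
  proof -
    have "expectation (\<lambda>\<omega>. \<bar>\<alpha>' \<omega> - \<alpha> \<omega>\<bar> ^ n) = (\<integral>\<omega>. \<bar>\<alpha>' \<omega> - \<alpha> \<omega>\<bar> ^ n \<partial>completion P)"
      by (rule integral_completion[symmetric]) auto
    also have "\<dots> = (\<integral>\<omega>. \<bar>?S \<epsilon> \<omega> - \<alpha> \<omega>\<bar> ^ n \<partial>completion P)"
      using aec Sm cm[OF a'(1)] cm[OF \<alpha>m] by (intro integral_cong_AE) auto
    finally show ?thesis using Sd by simp
  qed
  have "(\<integral>\<^sup>+\<omega>. ennreal (\<bar>\<alpha> \<omega>\<bar> ^ n) \<partial>P) = ennreal (expectation (\<lambda>\<omega>. \<bar>\<alpha> \<omega>\<bar> ^ n))"
    by (rule nn_integral_eq_integral[OF \<alpha>i]) auto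
  also have "\<dots> \<le> ennreal (expectation (\<lambda>\<omega>. 2 ^ n * (\<alpha>' \<omega> ^ n + \<bar>\<alpha>' \<omega> - \<alpha> \<omega>\<bar> ^ n)))"
  proof (intro ennreal_leI integral_mono \<alpha>i)
    show "integrable P (\<lambda>\<omega>. 2 ^ n * (\<alpha>' \<omega> ^ n + \<bar>\<alpha>' \<omega> - \<alpha> \<omega>\<bar> ^ n))"
      using a'(3) Di by (intro integrable_mult_right Bochner_Integration.integrable_add)
    show "\<bar>\<alpha> \<omega>\<bar> ^ n \<le> 2 ^ n * (\<alpha>' \<omega> ^ n + \<bar>\<alpha>' \<omega> - \<alpha> \<omega>\<bar> ^ n)" for \<omega>
      using abs_add_power_le[of "\<alpha>' \<omega>" "\<alpha> \<omega> - \<alpha>' \<omega>" n] by (simp add: ev[of "\<alpha>' \<omega>"] abs_minus_commute)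
  qed
  also have "expectation (\<lambda>\<omega>. 2 ^ n * (\<alpha>' \<omega> ^ n + \<bar>\<alpha>' \<omega> - \<alpha> \<omega>\<bar> ^ n)) = 2 ^ n * (expectation (\<lambda>\<omega>. \<alpha>' \<omega> ^ n) + expectation (\<lambda>\<omega>. \<bar>\<alpha>' \<omega> - \<alpha> \<omega>\<bar> ^ n))"
    using a'(3) Di by simp
  also have "ennreal \<dots> \<le> ennreal (2 ^ n * (moment_bound k n + 1))"
    using a'(4) D1 by (intro ennreal_leI mult_left_mono add_mono) auto
  finally show ?thesis .
qed

theorem theorem1p4:
  fixes P :: "'w measure"
    and B :: "real \<Rightarrow> 'w \<Rightarrow> real ^ 'd::{finite,linorder}"
    and k :: "nat ^ 'd::{finite,linorder}"
    and H \<beta> :: real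
    and \<alpha> :: "'w \<Rightarrow> real"
  assumes "prob_space P"
    and "0 < H" and "H < 1"
    and "fractional_brownian_motion P H B"
    and "is_silt_deriv P B k \<alpha>"
    and "H * real (multi_order k) + H * real CARD('d) < 1"
    and "0 \<le> \<beta>"
    and "\<beta> < 1 / (real (multi_order k) + real (multi_order k) * H + real CARD('d) * H)"
  shows "\<exists>M>0. (\<integral>\<^sup>+\<omega>. ennreal (exp (M * \<bar>\<alpha> \<omega>\<bar> powr \<beta>)) \<partial>P) < \<infinity>"
proof -
  interpret prob_space P by fact
  interpret fbm P H B by unfold_locales (use assms in auto)
  define \<theta> where "\<theta> = real (multi_order k) / 2 + H * (real (multi_order k) + CARD('d))"
  define \<theta>' where "\<theta>' = real (multi_order k) + real (multi_order k) * H + real CARD('d) * H"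
  have "0 < real CARD('d) * H" using assms(2) by simp
  then have pos: "\<theta>' > 0" unfolding \<theta>'_def using assms(2)
    by (intro add_nonneg_pos add_nonneg_nonneg mult_nonneg_nonneg) auto
  have \<theta>: "0 \<le> \<theta>" "\<theta> \<le> \<theta>'" using assms(2) by (auto simp: \<theta>_def \<theta>'_def algebra_simps)
  \<comment> \<open>The exponent \<theta> of the moment bound has half the order of k where
    \<theta>', the denominator in the theorem, has the whole order.\<close>
  have "\<theta> * \<beta> \<le> \<theta>' * \<beta>" using \<theta> assms(7) by (intro mult_right_mono) auto
  also have "\<dots> < 1" using assms(8) pos unfolding \<theta>'_def[symmetric] by (simp add: field_simps)
  finally have \<theta>\<beta>: "\<theta> * \<beta> < 1" .
  obtain C where C: "C \<ge> 1" and mom: "\<And>n. n > 0 \<Longrightarrow> 2 ^ n * (moment_bound k n + 1) \<le> C ^ n * real n powr (\<theta> * real n)"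
    using moment_bound_le[OF assms(6)] unfolding \<theta>_def by metis
  have "(\<integral>\<^sup>+\<omega>. ennreal (exp (\<bar>\<alpha> \<omega>\<bar> powr \<beta>)) \<partial>P) < \<infinity>"
  proof (rule exp_moment_finite[OF _ C \<theta>(1) assms(7) \<theta>\<beta>])
    show "\<alpha> \<in> borel_measurable P" using assms(5) by (simp add: is_silt_deriv_def)
    fix n :: nat assume n: "n > 0" "even n"
    have "(\<integral>\<^sup>+\<omega>. ennreal (\<bar>\<alpha> \<omega>\<bar> ^ n) \<partial>P) \<le> ennreal (2 ^ n * (moment_bound k n + 1))"
      by (rule silt_deriv_moment_le) (use assms n fbm_axioms in auto)
    also have "\<dots> \<le> ennreal (C ^ n * real n powr (\<theta> * real n))"
      by (intro ennreal_leI mom n)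
    finally show "(\<integral>\<^sup>+\<omega>. ennreal (\<bar>\<alpha> \<omega>\<bar> ^ n) \<partial>P) \<le> ennreal (C ^ n * real n powr (\<theta> * real n))" .
  qed
  \<comment> \<open>M = 1 works: as \<theta> times \<beta> is strictly below 1, the factorial
    outgrows the moments whatever the base C.\<close>
  then show ?thesis by (intro exI[of _ 1]) simp
qed

end
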